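(* Let $(\mathcal{F},\nu)$ be an RDS of circle homeomorphisms without finite orbits and let $(\mathcal{F}^-,\nu^-)$ be its inverse RDS. Let $d_+$ and $d_-$ be the numbers of ergodic stationary measures of $(\mathcal{F},\nu)$ and $(\mathcal{F}^-,\nu^-)$ respectively. Then $$|d_+-d_-|\leq 1.$$ Moreover, if $\mathcal{F}\subset\mathrm{Hom}^+(\mathbb{S}^1)$, then $d_+=d_-$.
   Context: $\mathrm{Hom}(\mathbb{S}^1)$ is the group of homeomorphisms of the circle (with the uniform topology) and $\mathrm{Hom}^+(\mathbb{S}^1)$ the subgroup of orientation-preserving ones. An RDS $(\mathcal{F},\nu)$ of circle homeomorphisms consists of $\mathcal{F}\subset\mathrm{Hom}(\mathbb{S}^1)$ and a probability measure $\nu$ on $\mathrm{Hom}(\mathbb{S}^1)$ whose support is exactly $\mathcal{F}$. It is without finite orbits if for every $x\in\mathbb{S}^1$ the set $\{f(x): f\in G_{\mathcal{F}}\}$ is infinite, where $G_{\mathcal{F}}$ is the semigroup generated by $\mathcal{F}$ under composition. The inverse RDS is given by $\mathcal{F}^-=\{f^{-1}: f\in\mathcal{F}\}$ and $\nu^-(\cdot)=\nu(\{f: f^{-1}\in\cdot\})$. Let $\sigma$ be the shift on $\mathcal{F}^{\mathbb{N}}$ and $T(\omega,x)=(\sigma\omega,f_1(x))$ for $\omega=(f_n)_{n\ge1}\in\mathcal{F}^{\mathbb{N}}$, $x\in\mathbb{S}^1$. A probability measure $\mu$ on $\mathbb{S}^1$ is stationary for $(\mathcal{F},\nu)$ if $\nu^{\mathbb{N}}\otimes\mu$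 is $T$-invariant, and ergodic stationary if moreover $\nu^{\mathbb{N}}\otimes\mu$ is $T$-ergodic. Known facts (Malicet 2017): for an RDS without finite orbits the number of ergodic stationary measures is finite, and their topological supports are pairwise disjoint and are exactly the closed minimal $\mathcal{F}$-invariant sets; moreover, if $\mathcal{F}$ has no finite orbit then neither does $\mathcal{F}^-$. *)

theory Defs
  imports "HOL-Probability.Probability"
begin

typedef circle = "sphere (0::complex) 1"
  morphisms complex_of_circle circle_of_complex
proof
  show "1 \<in> sphere (0::complex) 1" by simp
qed

setup_lifting type_definition_circle

instantiation circle :: metric_space
begin

lift_definition dist_circle :: "circle \<Rightarrow> circle \<Rightarrow> real" is dist .

definition uniformity_circle :: "(circle \<times> circle) filter" where
  "uniformity_circle = (INF e\<in>{0<..}. principal {(x, y). dist x y < e})"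

definition open_circle :: "circle set \<Rightarrow> bool" where
  "open_circle U \<longleftrightarrow> (\<forall>x\<in>U. \<forall>\<^sub>F (x', y) in uniformity. x' = x \<longrightarrow> y \<in> U)"

instance
proof
  show "dist x y = 0 \<longleftrightarrow> x = y" for x y :: circle
    by transfer simp
  show "dist x y \<le> dist x z + dist y z" for x y z :: circle
    by transfer (rule dist_triangle2)
qed (simp_all add: uniformity_circle_def open_circle_def)

end

lift_definition circle_cis :: "real \<Rightarrow> circle" is cis
  by simp

lemma dist_circle_le_2: "dist (x::circle) y \<le> 2"
proof transfer
  fix x y :: complex
  assume "x \<in> sphere 0 1" "y \<in> sphere 0 1"
  then show "dist x y \<le> 2"
    using norm_triangle_ineq4[of x y] by (simp add: dist_norm)
qed

typedef circle_homeo = "{f :: circle \<Rightarrow> circle. \<exists>g. homeomorphism UNIV UNIV f g}"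
  morphisms app_homeo Abs_circle_homeo
proof
  show "id \<in> {f :: circle \<Rightarrow> circle. \<exists>g. homeomorphism UNIV UNIV f g}"
    using homeomorphism_ident[of "UNIV :: circle set"] by (auto simp: id_def)
qed

setup_lifting type_definition_circle_homeo

lift_definition comp_homeo :: "circle_homeo \<Rightarrow> circle_homeo \<Rightarrow> circle_homeo" is "(\<circ>)"
  using homeomorphism_compose by blast

lift_definition inv_homeo :: "circle_homeo \<Rightarrow> circle_homeo" is inv
proof -
  fix f :: "circle \<Rightarrow> circle"
  assume "\<exists>g. homeomorphism UNIV UNIV f g"
  then obtain g where g: "homeomorphism UNIV UNIV f g" by blast
  have "inv f = g"
    using g by (intro inv_equality) (auto simp: homeomorphism_def)
  then show "\<exists>h. homeomorphism UNIV UNIV (inv f) h"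
    using g homeomorphism_sym by blast
qed

text \<open>The metric of uniform convergence; its Borel sets are the measurable sets of
  \<^typ>\<open>circle_homeo\<close>.\<close>

instantiation circle_homeo :: metric_space
begin

definition dist_circle_homeo :: "circle_homeo \<Rightarrow> circle_homeo \<Rightarrow> real" where
  "dist_circle_homeo f g = (SUP x. dist (app_homeo f x) (app_homeo g x))"

definition uniformity_circle_homeo :: "(circle_homeo \<times> circle_homeo) filter" where
  "uniformity_circle_homeo = (INF e\<in>{0<..}. principal {(f, g). dist f g < e})"

definition open_circle_homeo :: "circle_homeo set \<Rightarrow> bool" where
  "open_circle_homeo U \<longleftrightarrow> (\<forall>f\<in>U. \<forall>\<^sub>F (f', g) in uniformity. f' = f \<longrightarrow> g \<in> U)"

instance
proof
  have bdd: "bdd_above (range (\<lambda>x. dist (app_homeo f x) (app_homeo g x)))" for f g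
    by (rule bdd_aboveI[of _ 2]) (auto simp: dist_circle_le_2)
  have le: "dist (app_homeo f x) (app_homeo g x) \<le> dist f g" for f g x
    unfolding dist_circle_homeo_def by (rule cSUP_upper[OF UNIV_I bdd])
  show "dist f g = 0 \<longleftrightarrow> f = g" for f g :: circle_homeo
  proof
    assume "dist f g = 0"
    then have "app_homeo f x = app_homeo g x" for x
      using le[of f x g] by simp
    then show "f = g"
      by (simp add: app_homeo_inject[symmetric] fun_eq_iff)
  qed (simp add: dist_circle_homeo_def)
  show "dist f g \<le> dist f h + dist g h" for f g h :: circle_homeo
  proof -
    have "dist (app_homeo f x) (app_homeo g x) \<le> dist f h + dist g h" for x
      using dist_triangle2[of "app_homeo f x" "app_homeo g x" "app_homeo h x"]
        le[of f x h] le[of g x h] by linarith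
    then show ?thesis
      unfolding dist_circle_homeo_def[of f g] by (intro cSUP_least) auto
  qed
qed (simp_all add: uniformity_circle_homeo_def open_circle_homeo_def)

end

text \<open>Orientation-preserving homeomorphisms are those with a continuous increasing lift to the
  universal cover \<^term>\<open>circle_cis\<close>.\<close>

definition orientation_preserving_homeos :: "circle_homeo set" where
  "orientation_preserving_homeos =
    {f. \<exists>g :: real \<Rightarrow> real. continuous_on UNIV g \<and> strict_mono g \<and>
          (\<forall>t. app_homeo f (circle_cis t) = circle_cis (g t))}"

definition measure_support :: "'a::topological_space measure \<Rightarrow> 'a set" where
  "measure_support M = {x. \<forall>U. open U \<and> x \<in> U \<longrightarrow> emeasure M U > 0}"

definition circle_rds :: "circle_homeo set \<Rightarrow> circle_homeo measure \<Rightarrow> bool" where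
  "circle_rds F \<nu> \<longleftrightarrow> prob_space \<nu> \<and> sets \<nu> = sets borel \<and> measure_support \<nu> = F"

inductive_set generated_semigroup :: "circle_homeo set \<Rightarrow> circle_homeo set"
  for F :: "circle_homeo set" where
  base: "f \<in> F \<Longrightarrow> f \<in> generated_semigroup F"
| comp: "f \<in> generated_semigroup F \<Longrightarrow> g \<in> generated_semigroup F \<Longrightarrow>
    comp_homeo f g \<in> generated_semigroup F"

definition without_finite_orbits :: "circle_homeo set \<Rightarrow> bool" where
  "without_finite_orbits F \<longleftrightarrow> (\<forall>x. infinite {app_homeo f x | f. f \<in> generated_semigroup F})"

definition inverse_family :: "circle_homeo set \<Rightarrow> circle_homeo set" where
  "inverse_family F = inv_homeo ` F"

definition inverse_measure :: "circle_homeo measure \<Rightarrow> circle_homeo measure" where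
  "inverse_measure \<nu> = distr \<nu> borel inv_homeo"

text \<open>Sequences are indexed from 0, so \<open>\<omega> 0\<close> is the first map applied.\<close>

definition skew_product ::
  "(nat \<Rightarrow> circle_homeo) \<times> circle \<Rightarrow> (nat \<Rightarrow> circle_homeo) \<times> circle" where
  "skew_product = (\<lambda>(\<omega>, x). (\<lambda>n. \<omega> (Suc n), app_homeo (\<omega> 0) x))"

definition skew_measure ::
  "circle_homeo set \<Rightarrow> circle_homeo measure \<Rightarrow> circle measure
    \<Rightarrow> ((nat \<Rightarrow> circle_homeo) \<times> circle) measure" where
  "skew_measure F \<nu> \<mu> = (\<Pi>\<^sub>M n\<in>(UNIV::nat set). restrict_space \<nu> F) \<Otimes>\<^sub>M \<mu>"

definition invariant_measure :: "'a measure \<Rightarrow> ('a \<Rightarrow> 'a) \<Rightarrow> bool" where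
  "invariant_measure M T \<longleftrightarrow> T \<in> M \<rightarrow>\<^sub>M M \<and> distr M M T = M"

definition ergodic_measure :: "'a measure \<Rightarrow> ('a \<Rightarrow> 'a) \<Rightarrow> bool" where
  "ergodic_measure M T \<longleftrightarrow> invariant_measure M T \<and>
    (\<forall>A\<in>sets M. T -` A \<inter> space M = A \<longrightarrow> emeasure M A = 0 \<or> emeasure M (space M - A) = 0)"

definition stationary :: "circle_homeo set \<Rightarrow> circle_homeo measure \<Rightarrow> circle measure \<Rightarrow> bool" where
  "stationary F \<nu> \<mu> \<longleftrightarrow> prob_space \<mu> \<and> sets \<mu> = sets borel \<and>
    invariant_measure (skew_measure F \<nu> \<mu>) skew_product"

definition ergodic_stationary_measures ::
  "circle_homeo set \<Rightarrow> circle_homeo measure \<Rightarrow> circle measure set" where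
  "ergodic_stationary_measures F \<nu> =
    {\<mu>. stationary F \<nu> \<mu> \<and> ergodic_measure (skew_measure F \<nu> \<mu>) skew_product}"

end

theory Submission
  imports Defs "HOL-Real_Asymp.Real_Asymp"
begin

text \<open>Let \<open>\<mu>\<close>, \<open>\<mu>'\<close> be stationary for the inverse system. Both are atomless, so the difference of
  their distribution functions is a continuous function on the circle, and stationarity says that,
  up to an additive constant, it is harmonic for the system itself, twisted by the sign of the
  orientation. By the maximum principle such a function has constant absolute value on every
  minimal set, and vanishes if it does so on all of them. Linear algebra therefore bounds the
  number of mutually singular stationary measures of one system by one plus the number of minimal
  sets of the other; without orientation reversal the constants are harmonic too and the extra one
  disappears. Every minimal set in turn carries an ergodic stationary measure. That there are only
  finitely many minimal sets comes from the same functions.\<close>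

section \<open>The circle and its homeomorphisms\<close>

text \<open>The two systems are linked because a measure stationary for the inverse system gives an
  arc the mean mass of its images under the maps of \<open>F\<close>, so the endpoints of the arc
  move under \<open>F\<close>. A single distribution function gains 1 per turn; only differences
  live on the circle, so d measures yield d - 1 functions, and this lost dimension is the 1 of the
  theorem. With m and d the numbers of minimal sets and of ergodic stationary measures, the result
  is the chain m(F) \<le> d(F) \<le> m(F^-) + 1 \<le> d(F^-) + 1 together with its mirror image.

  The obstacle is a circularity: evaluating at one point per minimal set yields a bound only if
  there are finitely many minimal sets. The counting lemma is therefore stated for a finite set of
  evaluation points that every minimal set reaches along an arc to which all measures give equal
  mass. A fixed grid of such points proves finiteness; afterwards the points are chosen in the
  minimal sets themselves.

  Ergodicity is defined on sequences of maps; it is exchanged for mutual singularity in one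
  direction and for irreducibility of the Markov chain on the circle in the other.\<close>

lemma countable_dense_imp_second_countable:
  fixes D :: "'a::metric_space set"
  assumes "countable D" and dense: "\<And>x e. e > 0 \<Longrightarrow> \<exists>d\<in>D. dist d x < e"
  shows "\<exists>B::'a set set. countable B \<and> open = generate_topology B"
proof -
  define B where "B = (\<lambda>(d, n). ball d (1 / real (Suc n))) ` (D \<times> (UNIV :: nat set))"
  have "topological_basis B"
  proof (rule topological_basisI)
    show "open U" if "U \<in> B" for U
      using that by (auto simp: B_def)
  next
    fix O' :: "'a set" and x assume "open O'" "x \<in> O'"
    then obtain e where e: "e > 0" "ball x e \<subseteq> O'"
      by (metis open_contains_ball)
    then obtain n where n: "inverse (real (Suc n)) < e / 2"
      using reals_Archimedean[of "e / 2"] by auto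
    obtain d where d: "d \<in> D" "dist d x < 1 / real (Suc n)"
      using dense[of "1 / real (Suc n)" x] by auto
    have "ball d (1 / real (Suc n)) \<subseteq> ball x e"
    proof
      fix y assume y: "y \<in> ball d (1 / real (Suc n))"
      have "dist x y \<le> dist d x + dist d y"
        by (metis dist_commute dist_triangle)
      with y d n show "y \<in> ball x e" by (simp add: inverse_eq_divide)
    qed
    with d e show "\<exists>B'\<in>B. x \<in> B' \<and> B' \<subseteq> O'"
      by (intro bexI[of _ "ball d (1 / real (Suc n))"]) (auto simp: B_def)
  qed
  moreover have "countable B"
    using \<open>countable D\<close> by (auto simp: B_def)
  ultimately show ?thesis
    using topological_basis_imp_subbasis by blast
qed

lemma complex_of_circle_cis [simp]: "complex_of_circle (circle_cis t) = cis t"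
  by transfer simp

lemma norm_complex_of_circle [simp]: "norm (complex_of_circle x) = 1"
  using complex_of_circle[of x] by simp

lemma dist_circle_cis_le: "dist (circle_cis s) (circle_cis t) \<le> \<bar>s - t\<bar>"
proof -
  have "cis s - cis t = cis t * (cis (s - t) - 1)"
    by (simp add: algebra_simps cis_mult)
  then have "dist (circle_cis s) (circle_cis t) = norm (cis (s - t) - 1)"
    by (simp add: dist_circle.rep_eq dist_norm norm_mult)
  also have "\<dots> = 2 * \<bar>sin ((s - t) / 2)\<bar>"
    using dist_exp_i_1[of "s - t"] by (simp add: cis_conv_exp)
  also have "\<dots> \<le> \<bar>s - t\<bar>"
    using abs_sin_x_le_abs_x[of "(s - t) / 2"] by simp
  finally show ?thesis .
qed

lemma continuous_on_circle_cis: "continuous_on A circle_cis"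
  unfolding continuous_on_iff
  by (metis dist_circle_cis_le dist_real_def order_le_less_trans)

lemma circle_cis_eq_iff: "circle_cis s = circle_cis t \<longleftrightarrow> (\<exists>k::int. s = t + 2 * pi * k)"
proof -
  have "circle_cis s = circle_cis t \<longleftrightarrow> cis s = cis t"
    by (simp add: complex_of_circle_inject[symmetric])
  also have "\<dots> \<longleftrightarrow> (\<exists>k::int. s = t + 2 * pi * k)"
    unfolding cis_conv_exp exp_eq by (auto simp: complex_eq_iff algebra_simps)
  finally show ?thesis .
qed

lemma circle_cis_periodic [simp]: "circle_cis (t + 2 * pi * of_int k) = circle_cis t"
  by (metis circle_cis_eq_iff)

lemma circle_cis_add_2pi [simp]: "circle_cis (t + 2 * pi) = circle_cis t"
  using circle_cis_periodic[of t 1] by simp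

lemma circle_cis_inj: "circle_cis s = circle_cis t \<Longrightarrow> \<bar>s - t\<bar> < 2 * pi \<Longrightarrow> s = t"
proof -
  assume "circle_cis s = circle_cis t" and lt: "\<bar>s - t\<bar> < 2 * pi"
  then obtain k :: int where k: "s = t + 2 * pi * k"
    by (auto simp: circle_cis_eq_iff)
  with lt have "2 * pi * \<bar>real_of_int k\<bar> < 2 * pi * 1"
    by (simp add: abs_mult)
  then have "k = 0"
    by (subst (asm) mult_less_cancel_left_pos) auto
  with k show ?thesis by simp
qed

definition circle_angle :: "circle \<Rightarrow> real" where
  "circle_angle x = Arg2pi (complex_of_circle x)"

lemma circle_angle_bounds: "0 \<le> circle_angle x" "circle_angle x < 2 * pi"
  by (simp_all add: circle_angle_def Arg2pi_ge_0 Arg2pi_lt_2pi)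

lemma circle_cis_angle [simp]: "circle_cis (circle_angle x) = x"
proof -
  have "cis (Arg2pi (complex_of_circle x)) = complex_of_circle x"
    using Arg2pi_eq[of "complex_of_circle x"] unfolding cis_conv_exp norm_complex_of_circle by simp
  then show ?thesis
    by (simp add: circle_angle_def complex_of_circle_inject[symmetric])
qed

lemma circle_angle_cis: "0 \<le> t \<Longrightarrow> t < 2 * pi \<Longrightarrow> circle_angle (circle_cis t) = t"
  by (rule circle_cis_inj) (use circle_angle_bounds[of "circle_cis t"] in auto)

lemma circle_cis_image: "circle_cis ` {0..2 * pi} = UNIV" "circle_cis ` {0..<2 * pi} = UNIV"
proof -
  have "x \<in> circle_cis ` {0..<2 * pi}" for x
    by (rule image_eqI[of _ _ "circle_angle x"]) (auto simp: circle_angle_bounds)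
  then show "circle_cis ` {0..<2 * pi} = UNIV" by auto
  then show "circle_cis ` {0..2 * pi} = UNIV"
    using image_mono[OF atLeastLessThan_subseteq_atLeastAtMost_iff[THEN iffD2], of 0 "2 * pi" 0 "2 * pi" circle_cis]
    by auto
qed

lemma compact_UNIV_circle: "compact (UNIV :: circle set)"
  using compact_continuous_image[OF continuous_on_circle_cis, of "{0..2 * pi}"]
  by (simp add: circle_cis_image)

instance circle :: heine_borel
proof
  fix f :: "nat \<Rightarrow> circle"
  show "\<exists>l r. strict_mono r \<and> (f \<circ> r) \<longlonglongrightarrow> l"
    using compact_UNIV_circle[unfolded compact_def, rule_format, of f] by auto
qed

lemma closed_circle_imp_compact: "closed (K :: circle set) \<Longrightarrow> compact K"
  using compact_Int_closed[OF compact_UNIV_circle] by simp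

lemma compact_circle_arc: "compact (circle_cis ` {s..t})"
  by (intro compact_continuous_image continuous_on_circle_cis) simp

lemma closed_circle_arc: "closed (circle_cis ` {s..t})"
  by (simp add: compact_circle_arc compact_imp_closed)

text \<open>\<open>circle_cis\<close> is a quotient map: a closed set of parameters, cut down to one
  compact period, has a compact image.\<close>

lemma continuous_on_circle_if_lift:
  fixes h :: "circle \<Rightarrow> 'b::topological_space"
  assumes "continuous_on UNIV (\<lambda>t. h (circle_cis t))"
  shows "continuous_on UNIV h"
  unfolding continuous_on_closed_vimage[OF closed_UNIV]
proof (intro allI impI)
  fix C :: "'b set" assume "closed C"
  then have "closed ((\<lambda>t. h (circle_cis t)) -` C)"
    using assms continuous_on_closed_vimage[of UNIV] by auto
  then have "compact ({0..2 * pi} \<inter> (\<lambda>t. h (circle_cis t)) -` C)"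
    by (intro compact_Int_closed) auto
  then have "compact (circle_cis ` ({0..2 * pi} \<inter> (\<lambda>t. h (circle_cis t)) -` C))"
    by (intro compact_continuous_image continuous_on_circle_cis)
  moreover have "circle_cis ` ({0..2 * pi} \<inter> (\<lambda>t. h (circle_cis t)) -` C) = h -` C"
  proof -
    have "x \<in> circle_cis ` ({0..2 * pi} \<inter> (\<lambda>t. h (circle_cis t)) -` C)" if "x \<in> h -` C" for x
      using that circle_angle_bounds[of x]
      by (intro image_eqI[of _ _ "circle_angle x"]) auto
    then show ?thesis by auto
  qed
  ultimately show "closed (h -` C \<inter> UNIV)"
    by (simp add: compact_imp_closed)
qed

instance circle :: second_countable_topology
proof
  have "\<exists>d\<in>circle_cis ` \<rat>. dist d x < e" if "e > 0" for x :: circle and e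
  proof -
    obtain q where "q \<in> \<rat>" "circle_angle x - e < q" "q < circle_angle x"
      using Rats_dense_in_real[of "circle_angle x - e" "circle_angle x"] \<open>e > 0\<close> by auto
    then show ?thesis
      using dist_circle_cis_le[of q "circle_angle x"] by (intro bexI[of _ "circle_cis q"]) auto
  qed
  then show "\<exists>B::circle set set. countable B \<and> open = generate_topology B"
    by (intro countable_dense_imp_second_countable[of "circle_cis ` \<rat>"])
      (auto simp: countable_rat)
qed

section \<open>Homeomorphisms of the circle in the uniform metric\<close>

lemma homeomorphism_app_homeo: "homeomorphism UNIV UNIV (app_homeo g) (app_homeo (inv_homeo g))"
proof -
  obtain h where h: "homeomorphism UNIV UNIV (app_homeo g) h"
    using app_homeo[of g] by auto
  then have "inv (app_homeo g) = h"
    by (intro inv_equality) (auto simp: homeomorphism_def)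
  with h show ?thesis by (simp add: inv_homeo.rep_eq)
qed

lemma app_inv_homeo [simp]:
  "app_homeo g (app_homeo (inv_homeo g) x) = x" "app_homeo (inv_homeo g) (app_homeo g x) = x"
  using homeomorphism_app_homeo[of g] by (auto simp: homeomorphism_def)

lemma app_homeo_ext: "(\<And>x. app_homeo g x = app_homeo h x) \<Longrightarrow> g = h"
  by (simp add: app_homeo_inject[symmetric] fun_eq_iff)

lemma inv_inv_homeo [simp]: "inv_homeo (inv_homeo g) = g"
  by (rule app_homeo_ext) (metis app_inv_homeo)

lemma app_homeo_eq_iff [simp]: "app_homeo g x = app_homeo g y \<longleftrightarrow> x = y"
  by (metis app_inv_homeo(2))

lemma app_homeo_vimage: "app_homeo g -` A = app_homeo (inv_homeo g) ` A"
proof (intro set_eqI iffI)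
  fix x assume "x \<in> app_homeo g -` A"
  then show "x \<in> app_homeo (inv_homeo g) ` A"
    by (intro image_eqI[of _ _ "app_homeo g x"]) auto
qed auto

lemma continuous_on_app_homeo: "continuous_on A (app_homeo g)"
  using homeomorphism_app_homeo[of g] continuous_on_subset unfolding homeomorphism_def by blast

lemma dist_app_homeo_le: "dist (app_homeo f x) (app_homeo g x) \<le> dist f g"
  unfolding dist_circle_homeo_def
  by (rule cSUP_upper[OF UNIV_I], rule bdd_aboveI[of _ 2]) (auto simp: dist_circle_le_2)

lemma dist_circle_homeo_le: "(\<And>x. dist (app_homeo f x) (app_homeo g x) \<le> e) \<Longrightarrow> dist f g \<le> e"
  unfolding dist_circle_homeo_def by (rule cSUP_least) auto

lemma uniformly_continuous_on_app_homeo: "uniformly_continuous_on UNIV (app_homeo g)"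
  by (rule compact_uniformly_continuous[OF continuous_on_app_homeo compact_UNIV_circle])

text \<open>By uniform continuity a homeomorphism is described, up to a small error, by finitely
  many points of a countable dense set; one representative for each description gives a dense set.
  Second countability makes the Borel sets of products product-measurable, hence evaluation jointly
  measurable, and allows the Lindelof argument for supports.\<close>

instance circle_homeo :: second_countable_topology
proof
  obtain D :: "circle set" where D: "countable D"
    and dense: "\<And>X. open X \<Longrightarrow> X \<noteq> {} \<Longrightarrow> \<exists>d\<in>D. d \<in> X"
    using countable_dense_setE[where 'a = circle] by blast
  define S :: "nat \<Rightarrow> nat \<Rightarrow> circle list \<Rightarrow> circle_homeo set" where
    "S m n L = {g. \<forall>j<m. \<forall>t\<in>{2 * pi * j / m..2 * pi * Suc j / m}.
        dist (app_homeo g (circle_cis t)) (L ! j) < 1 / real (Suc n)}" for m n L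
  \<comment> \<open>Where \<open>S m n L\<close> is empty the choice is arbitrary; this only adds
    points to \<open>E\<close>.\<close>
  define E where "E = (\<lambda>(m, n, L). SOME g. g \<in> S m n L) ` (UNIV \<times> UNIV \<times> lists D)"
  have "countable E"
    unfolding E_def using D by (intro countable_image countable_SIGMA countable_lists) auto
  moreover have "\<exists>d\<in>E. dist d g < e" if "e > 0" for g e
  proof -
    obtain n where n: "inverse (real (Suc n)) < e / 3"
      using reals_Archimedean[of "e / 3"] \<open>e > 0\<close> by auto
    define \<epsilon> where "\<epsilon> = 1 / real (Suc n)"
    have \<epsilon>: "\<epsilon> > 0" "3 * \<epsilon> < e"
      using n by (auto simp: \<epsilon>_def inverse_eq_divide)
    obtain \<delta> where \<delta>: "\<delta> > 0"
      "\<And>x y. dist x y < \<delta> \<Longrightarrow> dist (app_homeo g x) (app_homeo g y) < \<epsilon> / 2"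
      using uniformly_continuous_on_app_homeo[of g] \<epsilon>(1)
      unfolding uniformly_continuous_on_def by (metis UNIV_I half_gt_zero)
    obtain m :: nat where m: "2 * pi / \<delta> < real m"
      using reals_Archimedean2 by blast
    moreover have "0 < 2 * pi / \<delta>"
      using \<delta>(1) by simp
    ultimately have "m > 0"
      by (metis gr0I of_nat_0 order_less_asym)
    have m': "2 * pi / m < \<delta>"
      using m \<delta>(1) \<open>m > 0\<close> by (simp add: field_simps)
    have "\<exists>d\<in>D. dist (app_homeo g (circle_cis (2 * pi * j / m))) d < \<epsilon> / 2" for j :: nat
      using dense[of "ball (app_homeo g (circle_cis (2 * pi * j / m))) (\<epsilon> / 2)"] \<epsilon> by auto
    then obtain d where d: "\<And>j::nat. d j \<in> D"
      "\<And>j::nat. dist (app_homeo g (circle_cis (2 * pi * j / m))) (d j) < \<epsilon> / 2"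
      by metis
    define L where "L = map d [0..<m]"
    have "g \<in> S m n L"
      unfolding S_def
    proof (intro CollectI allI impI ballI)
      fix j t assume j: "j < m" and t: "t \<in> {2 * pi * j / m..2 * pi * Suc j / m}"
      have "\<bar>t - 2 * pi * j / m\<bar> \<le> 2 * pi / m"
        using t by (simp add: add_divide_distrib field_simps)
      then have "dist (circle_cis t) (circle_cis (2 * pi * j / m)) < \<delta>"
        using dist_circle_cis_le[of t "2 * pi * j / m"] m' by linarith
      from \<delta>(2)[OF this] d(2)[of j] have "dist (app_homeo g (circle_cis t)) (d j) < \<epsilon>"
        using dist_triangle[of "app_homeo g (circle_cis t)" "d j"
            "app_homeo g (circle_cis (2 * pi * j / m))"] by linarith
      then show "dist (app_homeo g (circle_cis t)) (L ! j) < 1 / real (Suc n)"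
        using j by (simp add: L_def \<epsilon>_def)
    qed
    then have h: "(SOME g. g \<in> S m n L) \<in> S m n L" (is "?h \<in> _")
      by (metis someI)
    have "dist ?h g \<le> 2 * \<epsilon>"
    proof (rule dist_circle_homeo_le)
      fix x
      define j where "j = nat \<lfloor>circle_angle x * m / (2 * pi)\<rfloor>"
      have j: "real j = of_int \<lfloor>circle_angle x * m / (2 * pi)\<rfloor>"
        using circle_angle_bounds[of x] by (simp add: j_def)
      have "circle_angle x * m / (2 * pi) < m"
        using circle_angle_bounds[of x] \<open>m > 0\<close> by (simp add: field_simps)
      then have "real j < real m" unfolding j by linarith
      then have "j < m" by simp
      have "real j \<le> circle_angle x * m / (2 * pi)" "circle_angle x * m / (2 * pi) < real j + 1"
        unfolding j by linarith+
      then have "circle_angle x \<in> {2 * pi * j / m..2 * pi * Suc j / m}"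
        using \<open>m > 0\<close> by (simp add: field_simps)
      then have "dist (app_homeo f x) (L ! j) < \<epsilon>" if "f \<in> S m n L" for f
        using that \<open>j < m\<close> by (force simp: S_def \<epsilon>_def)
      from this[OF h] this[OF \<open>g \<in> S m n L\<close>]
      show "dist (app_homeo ?h x) (app_homeo g x) \<le> 2 * \<epsilon>"
        using dist_triangle2[of "app_homeo ?h x" "app_homeo g x" "L ! j"] by linarith
    qed
    moreover have "?h \<in> E"
    proof -
      have "(m, n, L) \<in> UNIV \<times> UNIV \<times> lists D"
        using d by (auto simp: L_def)
      then show ?thesis unfolding E_def by (force intro: image_eqI[of _ _ "(m, n, L)"])
    qed
    ultimately show ?thesis
      using \<epsilon> by (intro bexI[of _ ?h]) auto
  qed
  ultimately show "\<exists>B::circle_homeo set set. countable B \<and> open = generate_topology B"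
    by (rule countable_dense_imp_second_countable)
qed

lemma continuous_on_eval: "continuous_on UNIV (\<lambda>(g, x). app_homeo g x)"
  unfolding continuous_on_iff
proof (intro ballI allI impI)
  fix p :: "circle_homeo \<times> circle" and e :: real assume "e > 0"
  obtain g x where p: "p = (g, x)" by (cases p)
  obtain d where d: "d > 0" "\<And>y. dist y x < d \<Longrightarrow> dist (app_homeo g y) (app_homeo g x) < e / 2"
    using continuous_on_app_homeo[of UNIV g] \<open>e > 0\<close> unfolding continuous_on_iff
    by (metis UNIV_I half_gt_zero)
  show "\<exists>d>0. \<forall>q\<in>UNIV. dist q p < d \<longrightarrow>
      dist (case q of (g, x) \<Rightarrow> app_homeo g x) (case p of (g, x) \<Rightarrow> app_homeo g x) < e"
  proof (intro exI[of _ "min d (e / 2)"] conjI ballI impI)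
    fix q assume q: "dist q p < min d (e / 2)"
    obtain h y where q': "q = (h, y)" by (cases q)
    have "dist h g < e / 2" "dist y x < d"
      using q dist_fst_le[of q p] dist_snd_le[of q p] by (auto simp: p q')
    with d(2)[of y] dist_app_homeo_le[of h y g]
    show "dist (case q of (g, x) \<Rightarrow> app_homeo g x) (case p of (g, x) \<Rightarrow> app_homeo g x) < e"
      using dist_triangle[of "app_homeo h y" "app_homeo g x" "app_homeo g y"] by (simp add: p q')
  qed (use d \<open>e > 0\<close> in auto)
qed

lemma continuous_on_eval_left: "continuous_on A (\<lambda>g. app_homeo g x)"
  unfolding continuous_on_iff by (metis dist_app_homeo_le order_le_less_trans)

text \<open>If \<open>h\<close> is close to \<open>g\<close>, then \<open>g\<close> sends the
  \<open>h\<close>-preimage of \<open>y\<close> close to \<open>y\<close>; uniform continuity of the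
  inverse of \<open>g\<close> alone, with no control on the inverse of \<open>h\<close>, then brings
  the two preimages together.\<close>

lemma continuous_on_inv_homeo: "continuous_on UNIV inv_homeo"
  unfolding continuous_on_iff
proof (intro ballI allI impI)
  fix g :: circle_homeo and e :: real assume "e > 0"
  then obtain d where d: "d > 0" "\<And>x y. dist x y < d \<Longrightarrow>
      dist (app_homeo (inv_homeo g) x) (app_homeo (inv_homeo g) y) < e / 2"
    using uniformly_continuous_on_app_homeo[of "inv_homeo g"]
    unfolding uniformly_continuous_on_def by (metis UNIV_I half_gt_zero)
  show "\<exists>d>0. \<forall>h\<in>UNIV. dist h g < d \<longrightarrow> dist (inv_homeo h) (inv_homeo g) < e"
  proof (intro exI[of _ d] conjI ballI impI)
    fix h assume h: "dist h g < d"
    have "dist (inv_homeo h) (inv_homeo g) \<le> e / 2"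
    proof (rule dist_circle_homeo_le)
      fix y
      have "dist (app_homeo g (app_homeo (inv_homeo h) y)) y < d"
        using dist_app_homeo_le[of g "app_homeo (inv_homeo h) y" h] h by (simp add: dist_commute)
      from d(2)[OF this]
      show "dist (app_homeo (inv_homeo h) y) (app_homeo (inv_homeo g) y) \<le> e / 2"
        by simp
    qed
    with \<open>e > 0\<close> show "dist (inv_homeo h) (inv_homeo g) < e" by simp
  qed (use d in auto)
qed

lemma measurable_eval [measurable]:
  "(\<lambda>(g, x). app_homeo g x) \<in> borel \<Otimes>\<^sub>M borel \<rightarrow>\<^sub>M borel"
  unfolding borel_prod by (rule borel_measurable_continuous_onI[OF continuous_on_eval])

lemma measurable_app_homeo [measurable]: "app_homeo g \<in> borel \<rightarrow>\<^sub>M borel"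
  by (rule borel_measurable_continuous_onI[OF continuous_on_app_homeo])

lemma measurable_app_homeo_left [measurable]: "(\<lambda>g. app_homeo g x) \<in> borel \<rightarrow>\<^sub>M borel"
  by (rule borel_measurable_continuous_onI[OF continuous_on_eval_left])

lemma measurable_inv_homeo [measurable]: "inv_homeo \<in> borel \<rightarrow>\<^sub>M borel"
  by (rule borel_measurable_continuous_onI[OF continuous_on_inv_homeo])

lemma measurable_circle_cis [measurable]: "circle_cis \<in> borel \<rightarrow>\<^sub>M borel"
  by (rule borel_measurable_continuous_onI[OF continuous_on_circle_cis])

lemma circle_angle_le_eq: "t < 2 * pi \<Longrightarrow> {x. circle_angle x \<le> t} = circle_cis ` {0..t}"
proof (intro set_eqI iffI)
  fix x assume "x \<in> {x. circle_angle x \<le> t}"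
  then show "x \<in> circle_cis ` {0..t}"
    by (intro image_eqI[of _ _ "circle_angle x"]) (auto simp: circle_angle_bounds)
next
  fix x assume "t < 2 * pi" "x \<in> circle_cis ` {0..t}"
  then show "x \<in> {x. circle_angle x \<le> t}"
    by (auto simp: circle_angle_cis)
qed

lemma borel_circle_arc [measurable]: "circle_cis ` {s..t} \<in> sets borel"
  by (simp add: closed_circle_arc)

text \<open>The angle jumps at the base point, but its sublevel sets are closed arcs.\<close>

lemma measurable_circle_angle [measurable]: "circle_angle \<in> borel_measurable borel"
proof (rule borel_measurableI_le)
  fix t
  show "{x \<in> space borel. circle_angle x \<le> t} \<in> sets borel"
  proof (cases "t < 2 * pi")
    case True
    then show ?thesis by (simp add: circle_angle_le_eq)
  next
    case False
    then have "{x. circle_angle x \<le> t} = UNIV"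
      using circle_angle_bounds(2) by (smt (verit) Collect_cong UNIV_def)
    then show ?thesis by simp
  qed
qed

section \<open>Lifts and orientation\<close>

lemma continuous_inj_imp_strict_mono_or_antimono:
  fixes G :: "real \<Rightarrow> real"
  assumes cont: "continuous_on UNIV G" and inj: "inj G"
  shows "strict_mono G \<or> strict_mono (\<lambda>t. - G t)"
proof -
  have main: "strict_mono H" if H: "continuous_on UNIV H" "inj H" "H 0 < H 1" for H :: "real \<Rightarrow> real"
  proof (rule strict_monoI)
    fix x y :: real assume "x < y"
    \<comment> \<open>All of 0, 1, \<open>x\<close>, \<open>y\<close> lie strictly between
      \<open>a\<close> and \<open>b\<close>, so that monotonicity on triples carries the order of 0
      and 1 over to \<open>x\<close> and \<open>y\<close>.\<close>
    define a b where "a = min x 0 - 1" and "b = max y 1 + 1"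
    have m: "(H p < H q \<and> H q < H r) \<or> (H r < H q \<and> H q < H p)" if "p < q" "q < r" for p q r
      using continuous_inj_imp_mono[of p q r H] that H(1,2)
      by (meson continuous_on_subset inj_on_subset subset_UNIV)
    have ab: "a < 0" "a < x" "1 < b" "0 < b" "x < b" "y < b"
      using \<open>x < y\<close> by (auto simp: a_def b_def)
    have "H a < H 0" using m[of a 0 1] H(3) ab by auto
    then have "H a < H b" using m[of a 0 b] ab by auto
    then have "H x < H b" using m[of a x b] ab by auto
    then show "H x < H y" using m[of x y b] ab \<open>x < y\<close> by auto
  qed
  have "G 0 \<noteq> G 1"
    using inj by (metis injD zero_neq_one)
  then consider "G 0 < G 1" | "- G 0 < - G 1" by linarith
  then show ?thesis
  proof cases
    case 2
    moreover have "inj (\<lambda>t. - G t)" using inj by (auto simp: inj_def)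
    ultimately show ?thesis
      using main[of "\<lambda>t. - G t"] cont by (auto intro: continuous_intros)
  qed (use main assms in auto)
qed

text \<open>Monotonicity and injectivity are left out on purpose: they are consequences, and
  existence is easier without them.\<close>

definition is_lift :: "(real \<Rightarrow> real) \<Rightarrow> circle_homeo \<Rightarrow> bool" where
  "is_lift G g \<longleftrightarrow> continuous_on UNIV G \<and> (\<forall>t. app_homeo g (circle_cis t) = circle_cis (G t))"

text \<open>The real line is contractible, so the circle-valued map has a continuous logarithm,
  whose imaginary part is the lift.\<close>

lemma is_lift_exists: "\<exists>G. is_lift G g"
proof -
  define f where "f t = complex_of_circle (app_homeo g (circle_cis t))" for t
  have "continuous_on UNIV f"
    unfolding f_def continuous_on_iff
  proof (intro ballI allI impI)
    fix x e :: real assume "e > 0"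
    have "continuous_on UNIV (\<lambda>t. app_homeo g (circle_cis t))"
      by (rule continuous_on_compose2[OF continuous_on_app_homeo continuous_on_circle_cis]) auto
    then show "\<exists>d>0. \<forall>x'\<in>UNIV. dist x' x < d \<longrightarrow>
        dist (complex_of_circle (app_homeo g (circle_cis x')))
          (complex_of_circle (app_homeo g (circle_cis x))) < e"
      using \<open>e > 0\<close> unfolding continuous_on_iff dist_circle.rep_eq by blast
  qed
  moreover have "contractible (UNIV :: real set)"
    by (simp add: convex_imp_contractible)
  moreover have "f t \<noteq> 0" for t
    by (metis f_def norm_complex_of_circle norm_zero zero_neq_one)
  ultimately obtain k where k: "continuous_on UNIV k" "\<And>t. f t = exp (k t)"
    using continuous_logarithm_on_contractible[of UNIV f] by auto
  have "f t = cis (Im (k t))" for t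
  proof -
    have "norm (f t) = 1" by (simp add: f_def)
    then have "exp (Re (k t)) = 1" by (metis k(2) norm_exp_eq_Re)
    then show ?thesis
      using exp_eq_polar[of "k t"] by (simp add: k(2))
  qed
  then have "is_lift (\<lambda>t. Im (k t)) g"
    unfolding is_lift_def using k(1)
    by (auto simp: f_def complex_of_circle_inject[symmetric] intro: continuous_intros)
  then show ?thesis by blast
qed

lemma is_lift_inj_local:
  assumes "is_lift G g" "\<bar>s - t\<bar> < 2 * pi" "circle_cis (G s) = circle_cis (G t)"
  shows "s = t"
  using assms circle_cis_inj[of s t] unfolding is_lift_def by (metis app_homeo_eq_iff)

text \<open>Otherwise the intermediate value theorem finds a point, less than one turn away, where
  the lift has moved by exactly \<open>2 * pi\<close>; there the homeomorphism would repeat a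
  value.\<close>

lemma is_lift_dist_less:
  assumes G: "is_lift G g" and st: "\<bar>t - s\<bar> < 2 * pi"
  shows "\<bar>G t - G s\<bar> < 2 * pi"
proof (rule ccontr)
  have cont: "continuous_on A G" for A
    using G continuous_on_subset unfolding is_lift_def by blast
  have less: "\<bar>G t - G s\<bar> < 2 * pi" if "s < t" "t - s < 2 * pi" for s t
  proof (rule ccontr)
    assume "\<not> \<bar>G t - G s\<bar> < 2 * pi"
    moreover have "continuous_on {s..t} (\<lambda>u. \<bar>G u - G s\<bar>)"
      by (intro continuous_intros cont)
    ultimately obtain u where u: "s \<le> u" "u \<le> t" "\<bar>G u - G s\<bar> = 2 * pi"
      using IVT'[of "\<lambda>u. \<bar>G u - G s\<bar>" s "2 * pi" t] \<open>s < t\<close> by auto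
    then have "G u = G s + 2 * pi * of_int 1 \<or> G u = G s + 2 * pi * of_int (-1)"
      by (auto simp: abs_if split: if_splits)
    then have "circle_cis (G u) = circle_cis (G s)"
      by (metis circle_cis_periodic)
    then have "u = s"
      by (rule is_lift_inj_local[OF G, rotated]) (use u that in auto)
    with u show False by simp
  qed
  assume "\<not> \<bar>G t - G s\<bar> < 2 * pi"
  with less[of s t] less[of t s] st show False by (cases s t rule: linorder_cases) auto
qed

text \<open>A limit of the strict version, along points that approach \<open>t\<close> from the side
  of \<open>s\<close> and stay less than a turn from \<open>s\<close>. Full turns matter because
  arcs up to the whole circle are used later.\<close>

lemma is_lift_dist_le:
  assumes G: "is_lift G g" and st: "\<bar>t - s\<bar> \<le> 2 * pi"
  shows "\<bar>G t - G s\<bar> \<le> 2 * pi"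
proof -
  have "isCont G t"
    using G by (simp add: is_lift_def continuous_on_eq_continuous_at)
  moreover define u where "u n = t + (s - t) / real (n + 2)" for n
  have "u \<longlonglongrightarrow> t" unfolding u_def by real_asymp
  ultimately have "(\<lambda>n. \<bar>G (u n) - G s\<bar>) \<longlonglongrightarrow> \<bar>G t - G s\<bar>"
    by (intro tendsto_intros) (simp add: isCont_tendsto_compose)
  moreover have "\<bar>G (u n) - G s\<bar> \<le> 2 * pi" for n
  proof -
    have "u n - s = (t - s) * (1 - 1 / real (n + 2))"
      by (simp add: u_def algebra_simps add_divide_distrib diff_divide_distrib)
    then have "\<bar>u n - s\<bar> = \<bar>t - s\<bar> * (1 - 1 / real (n + 2))"
      by (simp add: abs_mult)
    also have "\<dots> \<le> 2 * pi * (1 - 1 / real (n + 2))"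
      using st by (intro mult_right_mono) auto
    also have "\<dots> < 2 * pi" by (simp add: field_simps)
    finally show ?thesis using is_lift_dist_less[OF G] by (simp add: less_imp_le)
  qed
  ultimately show ?thesis by (intro LIMSEQ_le_const2) auto
qed

text \<open>The gain of the lift over one turn, divided by \<open>2 * pi\<close>, is a continuous
  integer, hence a constant degree \<open>k\<close>. Two parameters with equal lifts differ by whole
  turns, and a nonzero degree separates those.\<close>

lemma is_lift_inj:
  assumes G: "is_lift G g"
  shows "inj G"
proof -
  have cont: "continuous_on A G" for A
    using G continuous_on_subset unfolding is_lift_def by blast
  have neq: "G s \<noteq> G t" if "s \<noteq> t" "\<bar>s - t\<bar> < 2 * pi" for s t
    using is_lift_inj_local[OF G, of s t] that by auto
  define D where "D t = (G (t + 2 * pi) - G t) / (2 * pi)" for t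
  have D_int: "\<exists>k::int. D t = k" for t
  proof -
    have "circle_cis (G (t + 2 * pi)) = circle_cis (G t)"
      using G unfolding is_lift_def by (metis circle_cis_add_2pi)
    then show ?thesis by (auto simp: circle_cis_eq_iff D_def)
  qed
  have contD: "continuous_on UNIV D"
    unfolding D_def
    by (intro continuous_intros cont continuous_on_compose2[OF cont[of UNIV], of _ "\<lambda>t. t + 2 * pi"]) auto
  have "D constant_on UNIV"
  proof (rule continuous_discrete_range_constant[OF _ contD])
    fix t
    have "1 \<le> norm (D u - D t)" if "D u \<noteq> D t" for u
    proof -
      obtain k l :: int where "D u = k" "D t = l" using D_int by metis
      with that have "1 \<le> \<bar>k - l\<bar>" by auto
      then have "1 \<le> \<bar>real_of_int (k - l)\<bar>" by linarith
      with \<open>D u = k\<close> \<open>D t = l\<close> show ?thesis by simp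
    qed
    then show "\<exists>e>0. \<forall>u. u \<in> UNIV \<and> D u \<noteq> D t \<longrightarrow> e \<le> norm (D u - D t)"
      by (intro exI[of _ 1]) auto
  qed simp
  then obtain k :: int where k: "\<And>t. D t = k"
    using D_int unfolding constant_on_def by (metis UNIV_I)
  have shift1: "G (t + 2 * pi) = G t + 2 * pi * k" for t
    using k[of t] by (simp add: D_def field_simps)
  have "k \<noteq> 0"
  proof
    assume "k = 0"
    then have G2: "G (2 * pi) = G 0" using shift1[of 0] by simp
    \<comment> \<open>Degree 0 makes the lift periodic, so it takes the midpoint of
      \<open>G 0\<close> and \<open>G pi\<close> once on the way out and once on the way back,
      within a single turn.\<close>
    have "\<exists>s t. 0 < s \<and> s < pi \<and> pi < t \<and> t < 2 * pi \<and> G s = G t"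
    proof -
      define v where "v = (G 0 + G pi) / 2"
      have n: "G 0 \<noteq> G pi" using neq[of 0 pi] by simp
      have "\<exists>s\<ge>0. s \<le> pi \<and> G s = v"
        using n IVT'[of G 0 v pi] IVT2'[of G pi v 0] cont
        by (cases "G 0 \<le> G pi") (auto simp: v_def)
      moreover have "\<exists>t\<ge>pi. t \<le> 2 * pi \<and> G t = v"
        using n IVT'[of G pi v "2 * pi"] IVT2'[of G "2 * pi" v pi] cont
        by (cases "G 0 \<le> G pi") (auto simp: v_def G2)
      ultimately obtain s t where "0 \<le> s" "s \<le> pi" "G s = v" "pi \<le> t" "t \<le> 2 * pi" "G t = v"
        by blast
      moreover have "v \<noteq> G 0" "v \<noteq> G pi" "v \<noteq> G (2 * pi)"
        using n by (auto simp: v_def G2)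
      ultimately show ?thesis
        by (intro exI[of _ s] exI[of _ t]) (auto simp: less_le)
    qed
    then obtain s t where "0 < s" "s < pi" "pi < t" "t < 2 * pi" "G s = G t" by blast
    with neq[of s t] show False by auto
  qed
  have shift_nat: "G (t + 2 * pi * real n) = G t + 2 * pi * k * real n" for t n
  proof (induction n)
    case (Suc n)
    have "G (t + 2 * pi * real (Suc n)) = G ((t + 2 * pi * real n) + 2 * pi)"
      by (simp add: algebra_simps)
    also have "\<dots> = G t + 2 * pi * k * real (Suc n)"
      unfolding shift1 Suc by (simp add: algebra_simps)
    finally show ?case .
  qed simp
  show ?thesis
  proof (rule injI)
    have imp: "s = t" if eq: "G s = G t" and "s \<le> t" for s t
    proof -
      have "circle_cis s = circle_cis t"
        using G eq unfolding is_lift_def by (metis app_homeo_eq_iff)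
      then obtain j :: int where j: "t = s + 2 * pi * j"
        by (metis circle_cis_eq_iff)
      with \<open>s \<le> t\<close> have "0 \<le> 2 * pi * real_of_int j" by linarith
      then have "j \<ge> 0"
        using pi_gt_zero by (auto simp: zero_le_mult_iff)
      then have "G t = G s + 2 * pi * k * j"
        using shift_nat[of s "nat j"] by (simp add: j)
      with eq \<open>k \<noteq> 0\<close> have "j = 0" by simp
      with j show ?thesis by simp
    qed
    show "s = t" if "G s = G t" for s t
      using imp[of s t] imp[of t s] that by (cases "s \<le> t") auto
  qed
qed

text \<open>A signed area of the triangle spanned by the images of \<open>1\<close>, \<open>\<i>\<close> and \<open>-1\<close>: a continuous
  function of the homeomorphism whose sign is the orientation.\<close>

definition triangle_area :: "circle_homeo \<Rightarrow> real" where
  "triangle_area g =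
    (let a = complex_of_circle (app_homeo g (circle_cis 0));
         b = complex_of_circle (app_homeo g (circle_cis (pi / 2)));
         c = complex_of_circle (app_homeo g (circle_cis pi))
     in Im (cnj (b - a) * (c - a)))"

text \<open>The area never vanishes, since three distinct points of the circle are not collinear;
  the second branch is the negative case.\<close>

definition orientation_sign :: "circle_homeo \<Rightarrow> real" where
  "orientation_sign g = (if triangle_area g > 0 then 1 else - 1)"

lemma orientation_sign_cases: "orientation_sign g = 1 \<or> orientation_sign g = - 1"
  by (simp add: orientation_sign_def)

lemma abs_orientation_sign [simp]: "\<bar>orientation_sign g\<bar> = 1"
  by (simp add: orientation_sign_def)

lemma borel_measurable_orientation_sign [measurable]: "orientation_sign \<in> borel_measurable borel"
proof -
  have "continuous_on UNIV (\<lambda>g. complex_of_circle (app_homeo g x))" for x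
    using continuous_on_eval_left[of UNIV x] unfolding continuous_on_iff dist_circle.rep_eq .
  then have "continuous_on UNIV triangle_area"
    unfolding triangle_area_def Let_def by (intro continuous_intros)
  then have "triangle_area \<in> borel_measurable borel"
    by (rule borel_measurable_continuous_onI)
  then show ?thesis
    unfolding orientation_sign_def[abs_def] by measurable
qed

text \<open>The quantity is twice the area of the triangle inscribed in the unit circle with
  consecutive arcs \<open>u\<close> and \<open>v\<close>; it factors as 4 sin(u/2) sin(v/2)
  sin((u+v)/2).\<close>

lemma sin_triangle_pos:
  assumes "0 < u" "0 < v" "u + v < 2 * pi"
  shows "sin u + sin v - sin (u + v) > 0"
proof -
  define x y where "x = u / 2" and "y = v / 2"
  have pos: "sin x > 0" "sin y > 0" "sin (x + y) > 0"
    using assms by (auto simp: x_def y_def intro!: sin_gt_zero)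
  have "sin u + sin v - sin (u + v) = 4 * sin x * sin y * sin (x + y)"
  proof -
    have u: "u = 2 * x" "v = 2 * y" by (simp_all add: x_def y_def)
    have c: "(cos x)\<^sup>2 = 1 - (sin x)\<^sup>2" "(cos y)\<^sup>2 = 1 - (sin y)\<^sup>2"
      by (simp_all add: cos_squared_eq)
    have "sin (2 * x) + sin (2 * y) - sin (2 * x + 2 * y) =
        sin (2 * x) * (1 - cos (2 * y)) + sin (2 * y) * (1 - cos (2 * x))"
      by (simp add: sin_add algebra_simps)
    also have "\<dots> = 2 * sin x * cos x * (2 * (sin y)\<^sup>2) + 2 * sin y * cos y * (2 * (sin x)\<^sup>2)"
      by (simp add: cos_double sin_double c)
    also have "\<dots> = 4 * sin x * sin y * sin (x + y)"
      by (simp add: sin_add power2_eq_square algebra_simps)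
    finally show ?thesis by (simp add: u)
  qed
  with pos show ?thesis by simp
qed

lemma triangle_area_lift:
  assumes "is_lift G g"
  shows "triangle_area g = sin (G (pi / 2) - G 0) + sin (G pi - G (pi / 2)) - sin (G pi - G 0)"
  using assms unfolding triangle_area_def is_lift_def Let_def
  by (simp add: sin_diff algebra_simps)

text \<open>A monotone lift takes 0, \<open>pi / 2\<close>, \<open>pi\<close> to parameters in
  increasing or decreasing order that span less than one turn, so the inscribed triangle is
  positively or negatively oriented accordingly.\<close>

lemma lift_of_orientation_sign:
  "orientation_sign g = 1 \<Longrightarrow> \<exists>G. is_lift G g \<and> strict_mono G"
  "orientation_sign g = - 1 \<Longrightarrow> \<exists>G. is_lift G g \<and> strict_mono (\<lambda>t. - G t)"
  and orientation_sign_of_lift: "is_lift G' g \<Longrightarrow> strict_mono G' \<Longrightarrow> orientation_sign g = 1"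
proof -
  have pos: "triangle_area g > 0" if "is_lift G g" "strict_mono G" for G
  proof -
    have "G 0 < G (pi / 2)" "G (pi / 2) < G pi"
      using that(2) by (auto simp: strict_mono_less)
    moreover have "\<bar>G pi - G 0\<bar> < 2 * pi"
      by (rule is_lift_dist_less[OF that(1)]) simp
    ultimately show ?thesis
      using sin_triangle_pos[of "G (pi / 2) - G 0" "G pi - G (pi / 2)"]
      by (simp add: triangle_area_lift[OF that(1)])
  qed
  have neg: "triangle_area g < 0" if "is_lift G g" "strict_mono (\<lambda>t. - G t)" for G
  proof -
    have "- G 0 < - G (pi / 2)" "- G (pi / 2) < - G pi"
      using strict_monoD[OF that(2), of 0 "pi / 2"] strict_monoD[OF that(2), of "pi / 2" pi] by auto
    moreover have "\<bar>G pi - G 0\<bar> < 2 * pi"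
      by (rule is_lift_dist_less[OF that(1)]) simp
    ultimately have "sin (G 0 - G (pi / 2)) + sin (G (pi / 2) - G pi)
        - sin (G 0 - G pi) > 0"
      using sin_triangle_pos[of "G 0 - G (pi / 2)" "G (pi / 2) - G pi"] by simp
    moreover have "sin (a - b) = - sin (b - a)" for a b :: real
      by (metis minus_diff_eq sin_minus)
    ultimately show ?thesis
      using triangle_area_lift[OF that(1)] by (smt (verit))
  qed
  obtain G where G: "is_lift G g" using is_lift_exists by blast
  have G2: "strict_mono G \<or> strict_mono (\<lambda>t. - G t)"
    using continuous_inj_imp_strict_mono_or_antimono is_lift_inj[OF G] G is_lift_def by blast
  show "orientation_sign g = 1 \<Longrightarrow> \<exists>G. is_lift G g \<and> strict_mono G"
    using G G2 neg[OF G] unfolding orientation_sign_def by (metis less_asym' one_neq_neg_one)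
  show "orientation_sign g = - 1 \<Longrightarrow> \<exists>G. is_lift G g \<and> strict_mono (\<lambda>t. - G t)"
    using G G2 pos[OF G] unfolding orientation_sign_def by (metis one_neq_neg_one)
  show "orientation_sign g = 1" if "is_lift G' g" "strict_mono G'"
    using pos[OF that] by (simp add: orientation_sign_def)
qed

lemma orientation_preserving_iff:
  "g \<in> orientation_preserving_homeos \<longleftrightarrow> orientation_sign g = 1"
  using lift_of_orientation_sign(1)[of g] orientation_sign_of_lift[of _ g]
  unfolding orientation_preserving_homeos_def is_lift_def by blast

text \<open>A decreasing lift of the inverse, composed with an increasing lift of \<open>g\<close>,
  would decrease; but the composite lifts the identity and is therefore a translation.\<close>

lemma inv_homeo_orientation_preserving:
  assumes "g \<in> orientation_preserving_homeos"
  shows "inv_homeo g \<in> orientation_preserving_homeos"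
proof (rule ccontr)
  assume "inv_homeo g \<notin> orientation_preserving_homeos"
  then have "orientation_sign (inv_homeo g) = - 1"
    using orientation_sign_cases by (auto simp: orientation_preserving_iff)
  then obtain H where H: "is_lift H (inv_homeo g)" "strict_mono (\<lambda>t. - H t)"
    using lift_of_orientation_sign(2) by blast
  obtain G where G: "is_lift G g" "strict_mono G"
    using assms lift_of_orientation_sign(1) by (auto simp: orientation_preserving_iff)
  define D where "D t = (H (G t) - t) / (2 * pi)" for t
  have D_int: "\<exists>k::int. D t = k" for t
  proof -
    have "circle_cis (H (G t)) = circle_cis t"
      using G H unfolding is_lift_def by (metis app_inv_homeo(2))
    then show ?thesis by (auto simp: circle_cis_eq_iff D_def)
  qed
  have "continuous_on UNIV D"
    using G H unfolding D_def is_lift_def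
    by (intro continuous_intros continuous_on_compose2[of UNIV H _ G]) auto
  then have "D constant_on UNIV"
  proof (rule continuous_discrete_range_constant[rotated])
    fix t
    have "1 \<le> norm (D u - D t)" if "D u \<noteq> D t" for u
    proof -
      obtain k l :: int where "D u = k" "D t = l" using D_int by metis
      with that have "1 \<le> \<bar>k - l\<bar>" by auto
      then have "1 \<le> \<bar>real_of_int (k - l)\<bar>" by linarith
      with \<open>D u = k\<close> \<open>D t = l\<close> show ?thesis by simp
    qed
    then show "\<exists>e>0. \<forall>u. u \<in> UNIV \<and> D u \<noteq> D t \<longrightarrow> e \<le> norm (D u - D t)"
      by (intro exI[of _ 1]) auto
  qed simp
  then have "D 0 = D 1" unfolding constant_on_def by auto
  moreover have "- H (G 0) < - H (G 1)"
    using strict_monoD[OF H(2) strict_monoD[OF G(2), of 0 1]] by simp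
  ultimately show False by (simp add: D_def)
qed

text \<open>A monotone lift maps an interval onto an interval, and \<open>is_lift_dist_le\<close>
  keeps it within one turn, so the increment formula for arcs of at most one turn applies to the
  image as well.\<close>

lemma image_circle_arc:
  assumes "s \<le> t" "t \<le> s + 2 * pi"
  shows "orientation_sign g = 1 \<Longrightarrow> \<exists>s' t'. s' \<le> t' \<and> t' \<le> s' + 2 * pi \<and>
      circle_cis s' = app_homeo g (circle_cis s) \<and> circle_cis t' = app_homeo g (circle_cis t) \<and>
      app_homeo g ` circle_cis ` {s..t} = circle_cis ` {s'..t'}"
    and "orientation_sign g = - 1 \<Longrightarrow> \<exists>s' t'. s' \<le> t' \<and> t' \<le> s' + 2 * pi \<and>
      circle_cis s' = app_homeo g (circle_cis t) \<and> circle_cis t' = app_homeo g (circle_cis s) \<and>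
      app_homeo g ` circle_cis ` {s..t} = circle_cis ` {s'..t'}"
proof -
  have img: "app_homeo g ` circle_cis ` {s..t} = circle_cis ` (G ` {s..t})" if "is_lift G g" for G
    using that by (auto simp: is_lift_def image_image)
  {
    assume "orientation_sign g = 1"
    then obtain G where G: "is_lift G g" "strict_mono G"
      using lift_of_orientation_sign(1) by blast
    then have cont: "continuous_on {s..t} G"
      using continuous_on_subset unfolding is_lift_def by blast
    have "G ` {s..t} = {G s..G t}"
    proof (intro set_eqI iffI)
      fix y assume "y \<in> {G s..G t}"
      then show "y \<in> G ` {s..t}" using IVT'[of G s y t] cont assms by auto
    qed (use G(2) in \<open>auto simp: strict_mono_less_eq\<close>)
    moreover have "G s \<le> G t" using G(2) assms by (simp add: strict_mono_less_eq)
    moreover have "G t \<le> G s + 2 * pi" using is_lift_dist_le[OF G(1), of t s] assms by auto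
    ultimately show "\<exists>s' t'. s' \<le> t' \<and> t' \<le> s' + 2 * pi \<and>
      circle_cis s' = app_homeo g (circle_cis s) \<and> circle_cis t' = app_homeo g (circle_cis t) \<and>
      app_homeo g ` circle_cis ` {s..t} = circle_cis ` {s'..t'}"
      using G(1) img[OF G(1)] unfolding is_lift_def
      by (intro exI[of _ "G s"] exI[of _ "G t"]) auto
  }
  {
    assume "orientation_sign g = - 1"
    then obtain G where G: "is_lift G g" "strict_mono (\<lambda>t. - G t)"
      using lift_of_orientation_sign(2) by blast
    then have cont: "continuous_on {s..t} G"
      using continuous_on_subset unfolding is_lift_def by blast
    have le: "G y \<le> G x" if "x \<le> y" for x y
      using strict_mono_less_eq[OF G(2), of x y] that by simp
    have "G ` {s..t} = {G t..G s}"
    proof (intro set_eqI iffI)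
      fix y assume "y \<in> {G t..G s}"
      then show "y \<in> G ` {s..t}" using IVT2'[of G t y s] cont assms by auto
    qed (use le in auto)
    moreover have "G s \<le> G t + 2 * pi" using is_lift_dist_le[OF G(1), of t s] assms by auto
    ultimately show "\<exists>s' t'. s' \<le> t' \<and> t' \<le> s' + 2 * pi \<and>
      circle_cis s' = app_homeo g (circle_cis t) \<and> circle_cis t' = app_homeo g (circle_cis s) \<and>
      app_homeo g ` circle_cis ` {s..t} = circle_cis ` {s'..t'}"
      using G(1) img[OF G(1)] le[OF assms(1)] unfolding is_lift_def
      by (intro exI[of _ "G t"] exI[of _ "G s"]) auto
  }
qed

section \<open>Atomless measures and arcs\<close>

lemma measure_small_cball:
  fixes \<mu> :: "'a::metric_space measure"
  assumes "finite_measure \<mu>" and sets: "sets \<mu> = sets borel" and "measure \<mu> {x} = 0" "e > 0"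
  shows "\<exists>r>0. measure \<mu> (cball x r) < e"
proof -
  interpret finite_measure \<mu> by fact
  have "(\<Inter>n. cball x (1 / real (Suc n))) = {x}"
  proof (intro set_eqI iffI)
    fix y assume y: "y \<in> (\<Inter>n. cball x (1 / real (Suc n)))"
    have "\<not> dist x y > 0"
    proof
      assume "dist x y > 0"
      then obtain n where "inverse (real (Suc n)) < dist x y"
        using reals_Archimedean by blast
      moreover have "dist x y \<le> 1 / real (Suc n)" using y by auto
      ultimately show False by (simp add: inverse_eq_divide)
    qed
    then show "y \<in> {x}" by simp
  qed auto
  moreover have "(\<lambda>n. measure \<mu> (cball x (1 / real (Suc n)))) \<longlonglongrightarrow>
      measure \<mu> (\<Inter>n. cball x (1 / real (Suc n)))"
  proof (rule finite_Lim_measure_decseq)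
    show "decseq (\<lambda>n. cball x (1 / real (Suc n)))"
      by (intro antimonoI cball_subset_cball_iff[THEN iffD2] subset_cball) (simp add: frac_le)
  qed (simp add: sets image_subset_iff)
  ultimately have "(\<lambda>n. measure \<mu> (cball x (1 / real (Suc n)))) \<longlonglongrightarrow> 0"
    using assms by simp
  then have "\<forall>\<^sub>F n in sequentially. measure \<mu> (cball x (1 / real (Suc n))) < e"
    using \<open>e > 0\<close> by (rule order_tendstoD(2))
  then obtain n where "measure \<mu> (cball x (1 / real (Suc n))) < e"
    by (auto simp: eventually_sequentially)
  then show ?thesis by (intro exI[of _ "1 / real (Suc n)"]) auto
qed

lemma measure_circle_arc_add:
  assumes "finite_measure \<mu>" and sets: "sets \<mu> = sets borel"
    and atomless: "\<And>x. measure \<mu> {x} = 0"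
    and le: "s \<le> u" "u \<le> t" "t \<le> s + 2 * pi"
  shows "measure \<mu> (circle_cis ` {s..t}) =
    measure \<mu> (circle_cis ` {s..u}) + measure \<mu> (circle_cis ` {u..t})"
proof -
  interpret finite_measure \<mu> by fact
  \<comment> \<open>Besides the cut point, the two pieces can meet at the starting point, when the
    arc is a full turn.\<close>
  have "circle_cis ` {s..u} \<inter> circle_cis ` {u..t} \<subseteq> {circle_cis s, circle_cis u}"
  proof
    fix x assume "x \<in> circle_cis ` {s..u} \<inter> circle_cis ` {u..t}"
    then obtain p q where pq: "x = circle_cis p" "x = circle_cis q" "s \<le> p" "p \<le> u" "u \<le> q" "q \<le> t"
      by (elim IntE imageE) (metis atLeastAtMost_iff)
    show "x \<in> {circle_cis s, circle_cis u}"
    proof (cases "\<bar>p - q\<bar> < 2 * pi")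
      case True
      then have "p = q" using pq circle_cis_inj[of p q] by simp
      with pq show ?thesis by auto
    next
      case False
      then have "p = s" using pq le by linarith
      with pq show ?thesis by auto
    qed
  qed
  moreover have "measure \<mu> {circle_cis s, circle_cis u} = 0"
  proof -
    have "measure \<mu> ({circle_cis s} \<union> {circle_cis u}) \<le> 0"
      using measure_Un_le[of "{circle_cis s}" \<mu> "{circle_cis u}"]
      by (simp add: sets atomless)
    then show ?thesis by (simp add: measure_le_0_iff insert_commute)
  qed
  ultimately have "measure \<mu> (circle_cis ` {s..u} \<inter> circle_cis ` {u..t}) = 0"
    using finite_measure_mono[of "circle_cis ` {s..u} \<inter> circle_cis ` {u..t}" "{circle_cis s, circle_cis u}"]
    by (simp add: sets measure_le_0_iff)
  moreover have "{s..t} = {s..u} \<union> {u..t}" using le by auto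
  then have "circle_cis ` {s..t} = circle_cis ` {s..u} \<union> circle_cis ` {u..t}"
    by (simp add: image_Un)
  ultimately show ?thesis
    using measure_Un3[of "circle_cis ` {s..u}" \<mu> "circle_cis ` {u..t}"]
    by (simp add: sets fmeasurable_eq_sets)
qed

lemma circle_arc_periodic:
  "circle_cis ` {s + 2 * pi * of_int k..t + 2 * pi * of_int k} = circle_cis ` {s..t}"
proof -
  have "{s + 2 * pi * of_int k..t + 2 * pi * of_int k} = (\<lambda>u. u + 2 * pi * of_int k) ` {s..t}"
    by simp
  then show ?thesis by (simp add: image_image del: image_add_atLeastAtMost' image_add_atLeastAtMost)
qed

lemma circle_full_arc: "circle_cis ` {s..s + 2 * pi} = UNIV"
proof -
  have "x \<in> circle_cis ` {s..s + 2 * pi}" for x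
  proof -
    define k where "k = \<lceil>(s - circle_angle x) / (2 * pi)\<rceil>"
    have "(s - circle_angle x) / (2 * pi) \<le> k" "k < (s - circle_angle x) / (2 * pi) + 1"
      unfolding k_def by linarith+
    then have "s - circle_angle x \<le> 2 * pi * k" "2 * pi * k < s - circle_angle x + 2 * pi"
      by (simp_all add: field_simps)
    then show ?thesis
      by (intro image_eqI[of _ _ "circle_angle x + 2 * pi * k"]) auto
  qed
  then show ?thesis by auto
qed

text \<open>The difference of the distribution functions of two atomless probability measures is a
  well-defined function on the circle, because the total masses cancel.\<close>

lemma circle_cdf_difference:
  fixes \<mu> \<mu>' :: "circle measure"
  assumes prob: "prob_space \<mu>" "prob_space \<mu>'"
    and sets: "sets \<mu> = sets borel" "sets \<mu>' = sets borel"
    and atomless: "\<And>x. measure \<mu> {x} = 0" "\<And>x. measure \<mu>' {x} = 0"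
  shows "\<exists>h. continuous_on UNIV h \<and> (\<forall>s t. s \<le> t \<longrightarrow> t \<le> s + 2 * pi \<longrightarrow>
    h (circle_cis t) - h (circle_cis s) =
      measure \<mu> (circle_cis ` {s..t}) - measure \<mu>' (circle_cis ` {s..t}))"
proof -
  have fin: "finite_measure \<mu>" "finite_measure \<mu>'"
    using prob by (simp_all add: prob_space.finite_measure)
  define D where "D s t = measure \<mu> (circle_cis ` {s..t}) - measure \<mu>' (circle_cis ` {s..t})" for s t
  define h where "h x = D 0 (circle_angle x)" for x
  have D_add: "D s t = D s u + D u t" if "s \<le> u" "u \<le> t" "t \<le> s + 2 * pi" for s u t
    using measure_circle_arc_add[OF fin(1) sets(1) atomless(1) that]
      measure_circle_arc_add[OF fin(2) sets(2) atomless(2) that] by (simp add: D_def)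
  have D_per: "D (s + 2 * pi * of_int k) (t + 2 * pi * of_int k) = D s t" for s t and k :: int
    by (simp add: D_def circle_arc_periodic)
  have "measure \<mu> UNIV = 1" "measure \<mu>' UNIV = 1"
    using prob_space.prob_space[OF prob(1)] prob_space.prob_space[OF prob(2)]
      sets_eq_imp_space_eq[OF sets(1)] sets_eq_imp_space_eq[OF sets(2)] by simp_all
  then have D_full: "D s (s + 2 * pi) = 0" for s
    by (simp add: D_def circle_full_arc)
  have D0: "h (circle_cis t) - h (circle_cis s) = D s t"
    if "0 \<le> s" "s < 2 * pi" "s \<le> t" "t \<le> s + 2 * pi" for s t
  proof (cases "t < 2 * pi")
    case True
    then show ?thesis
      using that D_add[of 0 s t] by (simp add: h_def circle_angle_cis)
  next
    case False
    \<comment> \<open>The arc passes the base point, where the angle restarts from 0; as a full turn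
      contributes \<open>D 0 (2 * pi) = 0\<close>, \<open>h\<close> has no jump there.\<close>
    have "circle_cis t = circle_cis (t - 2 * pi)"
      using circle_cis_add_2pi[of "t - 2 * pi"] by simp
    then have "h (circle_cis t) = D 0 (t - 2 * pi)"
      using False that by (simp add: h_def circle_angle_cis)
    also have "\<dots> = D (2 * pi) t" using D_per[of 0 1 "t - 2 * pi"] by simp
    finally have "h (circle_cis t) = D (2 * pi) t" .
    moreover have "h (circle_cis s) = D 0 s" using that by (simp add: h_def circle_angle_cis)
    moreover have "D 0 s + D s (2 * pi) = 0"
      using D_add[of 0 s "2 * pi"] D_full[of 0] that by simp
    ultimately show ?thesis using D_add[of s "2 * pi" t] that False by simp
  qed
  have D: "h (circle_cis t) - h (circle_cis s) = D s t" if "s \<le> t" "t \<le> s + 2 * pi" for s t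
  proof -
    obtain k :: int where k: "s = circle_angle (circle_cis s) + 2 * pi * k"
      using circle_cis_eq_iff[of s "circle_angle (circle_cis s)"] by auto
    define s' t' where "s' = circle_angle (circle_cis s)" and "t' = t - 2 * pi * k"
    have st: "s = s' + 2 * pi * k" "t = t' + 2 * pi * k"
      using k by (simp_all add: s'_def t'_def)
    have "0 \<le> s'" "s' < 2 * pi" by (simp_all add: s'_def circle_angle_bounds)
    then have "h (circle_cis t') - h (circle_cis s') = D s' t'"
      using that st by (intro D0) auto
    then show ?thesis unfolding st by (simp add: D_per)
  qed
  have "isCont (\<lambda>t. h (circle_cis t)) t" for t
    unfolding isCont_def LIM_def
  proof (intro allI impI)
    fix e :: real assume "e > 0"
    obtain r1 where r1: "r1 > 0" "measure \<mu> (cball (circle_cis t) r1) < e / 2"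
      using measure_small_cball[OF fin(1) sets(1) atomless(1), of "e / 2" "circle_cis t"] \<open>e > 0\<close> by auto
    obtain r2 where r2: "r2 > 0" "measure \<mu>' (cball (circle_cis t) r2) < e / 2"
      using measure_small_cball[OF fin(2) sets(2) atomless(2), of "e / 2" "circle_cis t"] \<open>e > 0\<close> by auto
    have key: "\<bar>D a b\<bar> < e" if "t - r1 \<le> a" "b \<le> t + r1" "t - r2 \<le> a" "b \<le> t + r2" for a b
    proof -
      have "circle_cis ` {a..b} \<subseteq> cball (circle_cis t) r1" "circle_cis ` {a..b} \<subseteq> cball (circle_cis t) r2"
        using that by (auto intro!: order_trans[OF dist_circle_cis_le])
      then have "measure \<mu> (circle_cis ` {a..b}) < e / 2" "measure \<mu>' (circle_cis ` {a..b}) < e / 2"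
        using r1 r2 finite_measure.finite_measure_mono[OF fin(1), of "circle_cis ` {a..b}" "cball (circle_cis t) r1"]
          finite_measure.finite_measure_mono[OF fin(2), of "circle_cis ` {a..b}" "cball (circle_cis t) r2"]
        by (auto simp: sets)
      then show ?thesis
        using measure_nonneg[of \<mu> "circle_cis ` {a..b}"] measure_nonneg[of \<mu>' "circle_cis ` {a..b}"]
        unfolding D_def by linarith
    qed
    show "\<exists>d>0. \<forall>u. u \<noteq> t \<and> dist u t < d \<longrightarrow> dist (h (circle_cis u)) (h (circle_cis t)) < e"
    \<comment> \<open>The bound \<open>pi\<close> keeps the two points within one turn, where
      \<open>h\<close> has increments \<open>D\<close>; the radii bound the two masses.\<close>
    proof (intro exI[of _ "min pi (min r1 r2)"] conjI allI impI)
      fix u assume "u \<noteq> t \<and> dist u t < min pi (min r1 r2)"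
      then show "dist (h (circle_cis u)) (h (circle_cis t)) < e"
        using key[of t u] key[of u t] D[of t u] D[of u t] r1(1) r2(1)
        by (cases "u \<le> t") (auto simp: dist_real_def abs_minus_commute)
    qed (use r1 r2 in auto)
  qed
  then have "continuous_on UNIV (\<lambda>t. h (circle_cis t))"
    by (simp add: continuous_on_eq_continuous_at)
  then have "continuous_on UNIV h" by (rule continuous_on_circle_if_lift)
  with D show ?thesis unfolding D_def by blast
qed

text \<open>Under \<open>circle_angle\<close> the arcs starting at the base point become half-lines,
  an intersection-stable generator. The induction runs on the signed combination as a whole; its
  complement step is where the vanishing total is used.\<close>

lemma circle_arcs_determine_combination:
  fixes \<mu> :: "'i \<Rightarrow> circle measure"
  assumes prob: "\<And>i. i \<in> I \<Longrightarrow> prob_space (\<mu> i)" and sets: "\<And>i. i \<in> I \<Longrightarrow> sets (\<mu> i) = sets borel"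
    and total: "(\<Sum>i\<in>I. c i) = 0"
    and arcs: "\<And>t. 0 \<le> t \<Longrightarrow> t < 2 * pi \<Longrightarrow> (\<Sum>i\<in>I. c i * measure (\<mu> i) (circle_cis ` {0..t})) = 0"
    and A: "A \<in> sets borel"
  shows "(\<Sum>i\<in>I. c i * measure (\<mu> i) A) = 0"
proof -
  have space: "space (\<mu> i) = UNIV" if "i \<in> I" for i
    using sets_eq_imp_space_eq[OF sets[OF that]] by simp
  have fin: "finite_measure (\<mu> i)" if "i \<in> I" for i
    using prob[OF that] by (simp add: prob_space.finite_measure)
  have one: "measure (\<mu> i) UNIV = 1" if "i \<in> I" for i
    using prob_space.prob_space[OF prob[OF that]] space[OF that] by simp
  have vimage: "circle_angle -` X \<in> sets borel" if "X \<in> sets borel" for X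
    using measurable_sets[OF measurable_circle_angle that] by simp
  have borel: "sigma_sets UNIV (range (\<lambda>a. {..a})) = sets (borel :: real measure)"
    by (metis borel_eq_atMost sets_measure_of top_greatest Pow_UNIV)
  have stable: "Int_stable (range (\<lambda>a :: real. {..a}))"
    by (auto simp: Int_stable_def)
  have main: "(\<Sum>i\<in>I. c i * measure (\<mu> i) (circle_angle -` X)) = 0"
    if "X \<in> sigma_sets UNIV (range (\<lambda>a. {..a}))" for X :: "real set"
    using stable subset_UNIV[of "range (\<lambda>a. {..a})", folded Pow_UNIV] that
  proof (induction rule: sigma_sets_induct_disjoint)
    case (basic X)
    then obtain a where X: "X = {..a}" by auto
    consider "a < 0" | "0 \<le> a" "a < 2 * pi" | "2 * pi \<le> a" by linarith
    then show ?case
    proof cases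
      case 1
      have "circle_angle -` X = {}"
      proof -
        have "\<not> circle_angle x \<le> a" for x
          using circle_angle_bounds(1)[of x] 1 by linarith
        then show ?thesis by (auto simp: X)
      qed
      then show ?thesis by simp
    next
      case 2
      then have "circle_angle -` X = circle_cis ` {0..a}"
        using circle_angle_le_eq[of a] by (auto simp: X vimage_def)
      with arcs 2 show ?thesis by simp
    next
      case 3
      have "circle_angle -` X = UNIV"
      proof -
        have "circle_angle x \<le> a" for x
          using circle_angle_bounds(2)[of x] 3 by linarith
        then show ?thesis by (auto simp: X)
      qed
      then show ?thesis using total by (simp add: one)
    qed
  next
    case (compl X)
    have "measure (\<mu> i) (circle_angle -` (UNIV - X)) = 1 - measure (\<mu> i) (circle_angle -` X)"
      if "i \<in> I" for i
      using finite_measure.finite_measure_compl[OF fin[OF that], of "circle_angle -` X"]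
        vimage[of X] compl(1) one[OF that] space[OF that] sets[OF that] borel
      by (simp add: vimage_Diff)
    then have "(\<Sum>i\<in>I. c i * measure (\<mu> i) (circle_angle -` (UNIV - X))) =
        (\<Sum>i\<in>I. c i - c i * measure (\<mu> i) (circle_angle -` X))"
      by (intro sum.cong) (auto simp: right_diff_distrib)
    then show ?case using compl total by (simp add: sum_subtractf)
  next
    case (union X)
    have "(\<lambda>n. measure (\<mu> i) (circle_angle -` X n)) sums
        measure (\<mu> i) (circle_angle -` (\<Union>n. X n))" if "i \<in> I" for i
    proof -
      have "disjoint_family (\<lambda>n. circle_angle -` X n)"
        using union(1) by (auto simp: disjoint_family_on_def)
      moreover have "range (\<lambda>n. circle_angle -` X n) \<subseteq> sets (\<mu> i)"
        using union(2) vimage borel sets[OF that] by auto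
      ultimately show ?thesis
        using finite_measure.finite_measure_UNION[OF fin[OF that], of "\<lambda>n. circle_angle -` X n"]
        by (simp add: vimage_UN)
    qed
    then have "(\<lambda>n. \<Sum>i\<in>I. c i * measure (\<mu> i) (circle_angle -` X n)) sums
        (\<Sum>i\<in>I. c i * measure (\<mu> i) (circle_angle -` (\<Union>n. X n)))"
      by (intro sums_sum sums_mult)
    then have "(\<lambda>n. 0) sums (\<Sum>i\<in>I. c i * measure (\<mu> i) (circle_angle -` (\<Union>n. X n)))"
      using union(3) by simp
    then show ?case using sums_unique2[OF _ sums_zero] by blast
  qed simp
  have "circle_cis -` A \<in> sets borel"
    using measurable_sets[OF measurable_circle_cis A] by simp
  moreover have "circle_angle -` circle_cis -` A = A" by auto
  ultimately show ?thesis using main[of "circle_cis -` A"] borel by simp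
qed

section \<open>Stationary measures and minimal sets\<close>

text \<open>The convolution of \<nu> and \<mu>: the law of the position after one random
  step.\<close>

definition transport :: "circle_homeo measure \<Rightarrow> circle measure \<Rightarrow> circle measure" where
  "transport \<nu> \<mu> = distr (\<nu> \<Otimes>\<^sub>M \<mu>) borel (\<lambda>(g, x). app_homeo g x)"

definition markov_stationary :: "circle_homeo measure \<Rightarrow> circle measure \<Rightarrow> bool" where
  "markov_stationary \<nu> \<mu> \<longleftrightarrow> prob_space \<mu> \<and> sets \<mu> = sets borel \<and> transport \<nu> \<mu> = \<mu>"

definition invariant_set :: "circle_homeo set \<Rightarrow> circle set \<Rightarrow> bool" where
  "invariant_set F K \<longleftrightarrow> closed K \<and> K \<noteq> {} \<and> (\<forall>g\<in>F. app_homeo g ` K \<subseteq> K)"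

definition minimal_sets :: "circle_homeo set \<Rightarrow> circle set set" where
  "minimal_sets F = {K. invariant_set F K \<and> (\<forall>K'. invariant_set F K' \<longrightarrow> K' \<subseteq> K \<longrightarrow> K' = K)}"

text \<open>Truncated multiples of the distance approximate the indicator of a closed set, and
  closed sets form an intersection-stable generator. The empty set is treated apart, since
  \<open>infdist\<close> to it is 0 by convention.\<close>

lemma measure_eqI_continuous:
  fixes M N :: "'a::metric_space measure"
  assumes "prob_space M" "prob_space N" and sets: "sets M = sets borel" "sets N = sets borel"
    and eq: "\<And>f :: 'a \<Rightarrow> real. continuous_on UNIV f \<Longrightarrow> (\<And>x. 0 \<le> f x \<and> f x \<le> 1) \<Longrightarrow>
      (\<integral>x. f x \<partial>M) = (\<integral>x. f x \<partial>N)"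
  shows "M = N"
proof -
  interpret M: prob_space M by fact
  interpret N: prob_space N by fact
  have space: "space M = UNIV" "space N = UNIV"
    using sets_eq_imp_space_eq[OF sets(1)] sets_eq_imp_space_eq[OF sets(2)] by simp_all
  have closed: "measure M K = measure N K" if "closed K" "K \<noteq> {}" for K
  proof -
    define f where "f n x = max 0 (1 - real n * infdist x K)" for n x
    have f: "continuous_on UNIV (f n)" "0 \<le> f n x" "f n x \<le> 1" for n x
      unfolding f_def by (intro continuous_intros) (auto simp: infdist_nonneg)
    have lim: "(\<lambda>n. f n x) \<longlonglongrightarrow> indicator K x" for x
    proof (cases "x \<in> K")
      case True
      then show ?thesis by (simp add: f_def)
    next
      case False
      then have pos: "infdist x K > 0"
        using that by (simp add: infdist_pos_not_in_closed)
      obtain n0 where n0: "1 / infdist x K < real n0"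
        using reals_Archimedean2 by blast
      have "f n x = 0" if "n \<ge> n0" for n
      proof -
        have "1 / infdist x K < real n" using n0 that by linarith
        then show ?thesis using pos by (simp add: f_def field_simps)
      qed
      then have "\<forall>\<^sub>F n in sequentially. f n x = indicator K x"
        using False unfolding eventually_sequentially by (intro exI[of _ n0]) auto
      then show ?thesis by (rule tendsto_eventually)
    qed
    have int: "(\<lambda>n. \<integral>x. f n x \<partial>P) \<longlonglongrightarrow> measure P K"
      if P: "prob_space P" "sets P = sets borel" for P
    proof -
      interpret P: prob_space P by fact
      have [measurable_cong]: "sets P = sets borel" by fact
      have [measurable]: "f n \<in> borel_measurable borel" for n
        using f(1) by (rule borel_measurable_continuous_onI)
      have [measurable]: "K \<in> sets borel" using \<open>closed K\<close> by simp
      have "(\<lambda>n. \<integral>x. f n x \<partial>P) \<longlonglongrightarrow> (\<integral>x. indicator K x \<partial>P)"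
        by (rule integral_dominated_convergence[where w = "\<lambda>_. 1"])
          (use lim f in \<open>auto\<close>)
      moreover have "(\<integral>x. indicator K x \<partial>P) = measure P K"
        using sets_eq_imp_space_eq[OF P(2)] by simp
      ultimately show ?thesis by simp
    qed
    have eqn: "(\<integral>x. f n x \<partial>M) = (\<integral>x. f n x \<partial>N)" for n
      by (rule eq) (use f in auto)
    show ?thesis
      using LIMSEQ_unique[OF int[OF \<open>prob_space M\<close> sets(1)]
          int[OF \<open>prob_space N\<close> sets(2), folded eqn]] .
  qed
  show ?thesis
  proof (rule measure_eqI_generator_eq)
    show "Int_stable (Collect closed :: 'a set set)" by (auto simp: Int_stable_def)
    show "Collect closed \<subseteq> Pow (UNIV :: 'a set)" by simp
    show "emeasure M X = emeasure N X" if "X \<in> Collect closed" for X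
      using that closed[of X] by (cases "X = {}") (auto simp: M.emeasure_eq_measure N.emeasure_eq_measure)
    show "sets M = sigma_sets UNIV (Collect closed)" "sets N = sigma_sets UNIV (Collect closed)"
      using sets by (simp_all add: borel_eq_closed)
    show "range (\<lambda>_::nat. UNIV :: 'a set) \<subseteq> Collect closed" by auto
  qed (auto simp: space)
qed

text \<open>Cutting the circle open at the base point gives measures on a bounded interval, hence a
  tight sequence on the line; its weak limit is wrapped back by \<open>circle_cis\<close>. The jump
  of the angle does no harm, because only the continuous functions \<open>f (circle_cis t)\<close>
  are integrated on the line.\<close>

lemma circle_measures_subsequence:
  fixes m :: "nat \<Rightarrow> circle measure"
  assumes prob: "\<And>n. prob_space (m n)" and sets: "\<And>n. sets (m n) = sets borel"
  shows "\<exists>r M. strict_mono (r :: nat \<Rightarrow> nat) \<and> prob_space M \<and> sets M = sets borel \<and>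
    (\<forall>f :: circle \<Rightarrow> real. continuous_on UNIV f \<longrightarrow>
      (\<lambda>n. \<integral>x. f x \<partial>m (r n)) \<longlonglongrightarrow> (\<integral>x. f x \<partial>M))"
proof -
  have [measurable_cong]: "sets (m n) = sets borel" for n by (rule sets)
  define M' where "M' n = distr (m n) borel circle_angle" for n
  have M'_dist: "real_distribution (M' n)" for n
    unfolding M'_def by (rule prob_space.real_distribution_distr[OF prob]) measurable
  have "measure (M' n) {- 1<..2 * pi} = 1" for n
  proof -
    have "- 1 < circle_angle x \<and> circle_angle x \<le> 2 * pi" for x
      using circle_angle_bounds[of x] by linarith
    then have "circle_angle -` {- 1<..2 * pi} = UNIV" by auto
    moreover have "measure (m n) (space (m n)) = 1"
      using prob by (rule prob_space.prob_space)
    ultimately show ?thesis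
      unfolding M'_def by (subst measure_distr) auto
  qed
  with M'_dist have "tight M'"
    unfolding tight_def
    by (intro conjI allI impI exI[of _ "-1"] exI[of _ "2 * pi"]) (use less_trans[of "-1" 0 "2 * pi"] in simp_all)
  from tight_imp_convergent_subsubsequence[OF this strict_mono_id]
  obtain r M0 where r: "strict_mono r" "real_distribution M0" "weak_conv_m (M' \<circ> id \<circ> r) M0"
    by blast
  interpret M0: real_distribution M0 by fact
  define M where "M = distr M0 borel circle_cis"
  have "prob_space M" unfolding M_def by (rule M0.prob_space_distr) measurable
  moreover have "(\<lambda>n. \<integral>x. f x \<partial>m (r n)) \<longlonglongrightarrow> (\<integral>x. f x \<partial>M)"
    if f: "continuous_on UNIV f" for f :: "circle \<Rightarrow> real"
  proof -
    have [measurable]: "f \<in> borel_measurable borel"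
      using f by (rule borel_measurable_continuous_onI)
    have "compact (f ` UNIV)"
      by (rule compact_continuous_image[OF f compact_UNIV_circle])
    then obtain B where B: "\<And>x. norm (f x) \<le> B"
      using compact_imp_bounded[of "range f"] by (auto simp: bounded_iff)
    have "isCont (\<lambda>t. f (circle_cis t)) t" for t
      using continuous_on_compose2[OF f continuous_on_circle_cis[of UNIV]]
      by (simp add: continuous_on_eq_continuous_at)
    moreover have "real_distribution ((M' \<circ> id \<circ> r) n)" for n
      by (simp add: M'_dist)
    ultimately have "(\<lambda>n. \<integral>t. f (circle_cis t) \<partial>((M' \<circ> id \<circ> r) n)) \<longlonglongrightarrow> (\<integral>t. f (circle_cis t) \<partial>M0)"
      using B r by (intro weak_conv_imp_integral_bdd_continuous_conv[where B = B])
    then show ?thesis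
      unfolding M_def M'_def by (simp add: integral_distr)
  qed
  ultimately show ?thesis
    using r(1) by (intro exI[of _ r] exI[of _ M]) (auto simp: M_def)
qed

text \<open>Absence of finite orbits enters as absence of finite invariant sets. This form passes to
  the inverse system, because a bijection mapping a finite set into itself permutes it.\<close>

locale random_homeo =
  fixes F :: "circle_homeo set" and \<nu> :: "circle_homeo measure"
  assumes prob_\<nu>: "prob_space \<nu>" and sets_\<nu> [measurable_cong]: "sets \<nu> = sets borel"
    and support_\<nu>: "measure_support \<nu> = F"
    and no_finite_invariant: "finite A \<Longrightarrow> A \<noteq> {} \<Longrightarrow> \<exists>g\<in>F. \<not> app_homeo g ` A \<subseteq> A"
begin

sublocale \<nu>: prob_space \<nu> by (rule prob_\<nu>)

lemma space_\<nu>: "space \<nu> = UNIV"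
  using sets_eq_imp_space_eq[OF sets_\<nu>] by simp

text \<open>Off the support every point has a null open neighbourhood; by the Lindelof property
  countably many of these cover the complement.\<close>

lemma AE_in_F: "AE g in \<nu>. g \<in> F"
proof -
  define \<U> where "\<U> = {U :: circle_homeo set. open U \<and> emeasure \<nu> U = 0}"
  obtain \<V> where V: "\<V> \<subseteq> \<U>" "countable \<V>" "\<Union>\<V> = \<Union>\<U>"
    by (rule Lindelof[of \<U>]) (auto simp: \<U>_def)
  have "- F \<subseteq> \<Union>\<V>"
    unfolding V(3) support_\<nu>[symmetric] measure_support_def \<U>_def
    by (auto simp: zero_less_iff_neq_zero)
  moreover have "(\<Union>V\<in>\<V>. V) \<in> null_sets \<nu>"
    using V by (intro null_sets_UN') (auto simp: \<U>_def null_sets_def sets_\<nu>)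
  ultimately show ?thesis
    by (intro AE_I'[of "\<Union>\<V>"]) auto
qed

lemma F_subset_if_AE:
  assumes "closed C" "AE g in \<nu>. g \<in> C"
  shows "F \<subseteq> C"
proof
  fix g assume "g \<in> F"
  show "g \<in> C"
  proof (rule ccontr)
    assume "g \<notin> C"
    with \<open>g \<in> F\<close> have "emeasure \<nu> (- C) > 0"
      using \<open>closed C\<close> unfolding support_\<nu>[symmetric] measure_support_def by auto
    moreover have "emeasure \<nu> (- C) = 0"
      using assms AE_iff_measurable[of "- C" \<nu> "\<lambda>g. g \<in> C"] by (auto simp: space_\<nu> sets_\<nu>)
    ultimately show False by simp
  qed
qed

text \<open>Mapping a closed set into itself is a closed condition on the homeomorphism, so it
  spreads from almost every map to the whole support.\<close>

lemma invariant_if_AE: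
  assumes "closed K" "AE g in \<nu>. app_homeo g ` K \<subseteq> K" "g \<in> F"
  shows "app_homeo g ` K \<subseteq> K"
proof -
  have "{g. app_homeo g ` K \<subseteq> K} = (\<Inter>x\<in>K. (\<lambda>g. app_homeo g x) -` K)" by auto
  moreover have "closed ((\<lambda>g. app_homeo g x) -` K)" for x
    using continuous_on_eval_left[of UNIV x] \<open>closed K\<close> by (simp add: continuous_on_closed_vimage)
  ultimately have "closed {g. app_homeo g ` K \<subseteq> K}" by auto
  from F_subset_if_AE[OF this] assms show ?thesis by auto
qed

lemma
  assumes sets: "sets \<mu> = sets borel" and "prob_space \<mu>"
  shows sets_transport: "sets (transport \<nu> \<mu>) = sets borel"
    and prob_space_transport: "prob_space (transport \<nu> \<mu>)"
    and nn_integral_transport: "f \<in> borel_measurable borel \<Longrightarrow>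
      (\<integral>\<^sup>+x. f x \<partial>transport \<nu> \<mu>) = (\<integral>\<^sup>+x. \<integral>\<^sup>+g. f (app_homeo g x) \<partial>\<nu> \<partial>\<mu>)"
    and nn_integral_transport': "f \<in> borel_measurable borel \<Longrightarrow>
      (\<integral>\<^sup>+x. f x \<partial>transport \<nu> \<mu>) = (\<integral>\<^sup>+g. \<integral>\<^sup>+x. f (app_homeo g x) \<partial>\<mu> \<partial>\<nu>)"
    and integral_transport: "h \<in> borel_measurable borel \<Longrightarrow> (\<And>x. \<bar>h x\<bar> \<le> B) \<Longrightarrow>
      (\<integral>x. h x \<partial>transport \<nu> \<mu>) = (\<integral>x. \<integral>g. h (app_homeo g x) \<partial>\<nu> \<partial>\<mu> :: real)"
proof -
  note sets[measurable_cong]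
  interpret \<mu>: prob_space \<mu> by fact
  interpret P: pair_prob_space \<nu> \<mu> ..
  have eval: "(\<lambda>(g, x). app_homeo g x) \<in> \<nu> \<Otimes>\<^sub>M \<mu> \<rightarrow>\<^sub>M borel" by measurable
  show "sets (transport \<nu> \<mu>) = sets borel" by (simp add: transport_def)
  show "prob_space (transport \<nu> \<mu>)" unfolding transport_def by (rule P.prob_space_distr[OF eval])
  {
    assume [measurable]: "f \<in> borel_measurable borel"
    have "(\<integral>\<^sup>+x. f x \<partial>transport \<nu> \<mu>) = (\<integral>\<^sup>+p. f (app_homeo (fst p) (snd p)) \<partial>(\<nu> \<Otimes>\<^sub>M \<mu>))"
      unfolding transport_def by (subst nn_integral_distr[OF eval]) (auto simp: split_beta)
    moreover have m: "(\<lambda>p. f (app_homeo (fst p) (snd p))) \<in> borel_measurable (\<nu> \<Otimes>\<^sub>M \<mu>)"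
      using measurable_compose[OF eval \<open>f \<in> _\<close>] by (simp add: split_beta)
    ultimately show "(\<integral>\<^sup>+x. f x \<partial>transport \<nu> \<mu>) = (\<integral>\<^sup>+x. \<integral>\<^sup>+g. f (app_homeo g x) \<partial>\<nu> \<partial>\<mu>)"
      "(\<integral>\<^sup>+x. f x \<partial>transport \<nu> \<mu>) = (\<integral>\<^sup>+g. \<integral>\<^sup>+x. f (app_homeo g x) \<partial>\<mu> \<partial>\<nu>)"
      using P.nn_integral_snd[OF m] \<mu>.nn_integral_fst[OF m] by simp_all
  }
  {
    assume h [measurable]: "h \<in> borel_measurable borel" and B: "\<And>x. \<bar>h x\<bar> \<le> B"
    have "(\<integral>x. h x \<partial>transport \<nu> \<mu>) = (\<integral>p. h (app_homeo (fst p) (snd p)) \<partial>(\<nu> \<Otimes>\<^sub>M \<mu>))"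
      unfolding transport_def by (subst integral_distr[OF eval]) (auto simp: split_beta)
    moreover have m: "(\<lambda>p. h (app_homeo (fst p) (snd p))) \<in> borel_measurable (\<nu> \<Otimes>\<^sub>M \<mu>)"
      using measurable_compose[OF eval h] by (simp add: split_beta)
    then have "integrable (\<nu> \<Otimes>\<^sub>M \<mu>) (\<lambda>p. h (app_homeo (fst p) (snd p)))"
      by (intro P.integrable_const_bound[of _ B]) (use B in auto)
    ultimately show "(\<integral>x. h x \<partial>transport \<nu> \<mu>) = (\<integral>x. \<integral>g. h (app_homeo g x) \<partial>\<nu> \<partial>\<mu>)"
      using P.integral_snd[of "\<lambda>g x. h (app_homeo g x)"] by (simp add: case_prod_beta')
  }
qed

lemma measure_transport:
  assumes sets: "sets \<mu> = sets borel" and "prob_space \<mu>" and A: "A \<in> sets borel"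
  shows "measure (transport \<nu> \<mu>) A = (\<integral>g. measure \<mu> (app_homeo g -` A) \<partial>\<nu>)"
    and "(\<lambda>g. measure \<mu> (app_homeo g -` A)) \<in> borel_measurable \<nu>"
proof -
  note sets[measurable_cong]
  interpret \<mu>: prob_space \<mu> by fact
  have space: "space \<mu> = UNIV" using sets_eq_imp_space_eq[OF sets] by simp
  have eval: "(\<lambda>(g, x). app_homeo g x) \<in> \<nu> \<Otimes>\<^sub>M \<mu> \<rightarrow>\<^sub>M borel" by measurable
  have S: "(\<lambda>(g, x). app_homeo g x) -` A \<inter> space (\<nu> \<Otimes>\<^sub>M \<mu>) \<in> sets (\<nu> \<Otimes>\<^sub>M \<mu>)"
    using eval A by (rule measurable_sets)
  have slice: "Pair g -` ((\<lambda>(g, x). app_homeo g x) -` A \<inter> space (\<nu> \<Otimes>\<^sub>M \<mu>)) = app_homeo g -` A" for g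
    by (auto simp: space_pair_measure space space_\<nu>)
  show m: "(\<lambda>g. measure \<mu> (app_homeo g -` A)) \<in> borel_measurable \<nu>"
    using \<mu>.measurable_emeasure_Pair[OF S] unfolding slice measure_def by measurable
  have "emeasure (transport \<nu> \<mu>) A = (\<integral>\<^sup>+g. emeasure \<mu> (app_homeo g -` A) \<partial>\<nu>)"
    using \<mu>.emeasure_pair_measure_alt[OF S] unfolding slice transport_def
    by (simp add: emeasure_distr[OF eval A])
  also have "\<dots> = (\<integral>\<^sup>+g. ennreal (measure \<mu> (app_homeo g -` A)) \<partial>\<nu>)"
    by (simp add: \<mu>.emeasure_eq_measure)
  also have "\<dots> = ennreal (\<integral>g. measure \<mu> (app_homeo g -` A) \<partial>\<nu>)"
    using m by (intro nn_integral_eq_integral \<nu>.integrable_const_bound[of _ 1]) auto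
  finally show "measure (transport \<nu> \<mu>) A = (\<integral>g. measure \<mu> (app_homeo g -` A) \<partial>\<nu>)"
    by (simp add: measure_def integral_nonneg)
qed

lemma markov_stationaryD:
  assumes "markov_stationary \<nu> \<mu>"
  shows "prob_space \<mu>" "sets \<mu> = sets borel" "transport \<nu> \<mu> = \<mu>" "space \<mu> = UNIV"
    "finite_measure \<mu>"
  using assms sets_eq_imp_space_eq[of \<mu> borel]
  by (auto simp: markov_stationary_def prob_space.finite_measure)

lemma markov_stationary_measure:
  assumes "markov_stationary \<nu> \<mu>" "A \<in> sets borel"
  shows "measure \<mu> A = (\<integral>g. measure \<mu> (app_homeo g -` A) \<partial>\<nu>)"
  using measure_transport(1)[of \<mu> A] markov_stationaryD[OF assms(1)] assms(2) by simp

text \<open>The atoms of maximal mass form a finite set which is invariant under almost every inverse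
  map, hence under every map of the support.\<close>

lemma markov_stationary_atomless:
  assumes \<mu>: "markov_stationary \<nu> \<mu>"
  shows "measure \<mu> {x} = 0"
proof (rule ccontr)
  interpret prob_space \<mu> using markov_stationaryD[OF \<mu>] by simp
  have sets: "sets \<mu> = sets borel" using markov_stationaryD[OF \<mu>] by simp
  define a where "a = measure \<mu> {x}"
  assume "measure \<mu> {x} \<noteq> 0"
  then have "a > 0" by (simp add: a_def zero_less_measure_iff)
  define S where "S = {y. a \<le> measure \<mu> {y}}"
  have "finite S \<and> card S \<le> nat \<lceil>1 / a\<rceil>"
  proof (rule finite_if_finite_subsets_card_bdd)
    fix T assume T: "T \<subseteq> S" "finite T"
    have "real (card T) * a = (\<Sum>y\<in>T. a)" by simp
    also have "\<dots> \<le> (\<Sum>y\<in>T. measure \<mu> {y})" using T by (intro sum_mono) (auto simp: S_def)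
    also have "\<dots> = measure \<mu> T"
      using T by (intro finite_measure_eq_sum_singleton[symmetric]) (auto simp: sets)
    also have "\<dots> \<le> 1" by simp
    finally have "real (card T) \<le> 1 / a" using \<open>a > 0\<close> by (simp add: field_simps)
    then show "card T \<le> nat \<lceil>1 / a\<rceil>" by linarith
  qed
  then have "finite S" ..
  have "x \<in> S" by (simp add: S_def a_def)
  define c where "c = Max ((\<lambda>y. measure \<mu> {y}) ` S)"
  define A where "A = {y \<in> S. measure \<mu> {y} = c}"
  have c_ge: "measure \<mu> {y} \<le> c" if "y \<in> S" for y
    using \<open>finite S\<close> that unfolding c_def by (intro Max_ge) auto
  have "c \<ge> a" using c_ge[OF \<open>x \<in> S\<close>] by (simp add: a_def)
  have c_max: "measure \<mu> {y} \<le> c" for y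
    using c_ge[of y] \<open>c \<ge> a\<close> by (cases "y \<in> S") (auto simp: S_def)
  have A_eq: "A = {y. measure \<mu> {y} = c}" using \<open>c \<ge> a\<close> by (auto simp: A_def S_def)
  have "c \<in> (\<lambda>y. measure \<mu> {y}) ` S"
    unfolding c_def using \<open>finite S\<close> \<open>x \<in> S\<close> by (intro Max_in) auto
  then have "A \<noteq> {}" by (auto simp: A_def)
  have "finite A" using \<open>finite S\<close> by (simp add: A_def)
  have "AE g in \<nu>. app_homeo (inv_homeo g) y \<in> A" if "y \<in> A" for y
  proof -
    have vim: "app_homeo g -` {y} = {app_homeo (inv_homeo g) y}" for g
      by (simp add: app_homeo_vimage)
    have m: "(\<lambda>g. measure \<mu> {app_homeo (inv_homeo g) y}) \<in> borel_measurable \<nu>"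
      using measure_transport(2)[of \<mu> "{y}"] markov_stationaryD[OF \<mu>] by (simp add: vim)
    have int: "integrable \<nu> (\<lambda>g. measure \<mu> {app_homeo (inv_homeo g) y})"
      using m by (intro \<nu>.integrable_const_bound[of _ 1]) auto
    \<comment> \<open>The maximal mass \<open>c\<close> is the mean of the masses of the preimages
      of \<open>y\<close>, none of which exceeds \<open>c\<close>; hence almost all of them equal
      \<open>c\<close>.\<close>
    have "(\<integral>g. c - measure \<mu> {app_homeo (inv_homeo g) y} \<partial>\<nu>) = 0"
      using markov_stationary_measure[OF \<mu>, of "{y}"] that int \<nu>.prob_space
      by (simp add: vim A_eq)
    then have "AE g in \<nu>. c - measure \<mu> {app_homeo (inv_homeo g) y} = 0"
      using int c_max by (subst (asm) integral_nonneg_eq_0_iff_AE) auto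
    then show ?thesis by eventually_elim (simp add: A_eq)
  qed
  then have "AE g in \<nu>. \<forall>y\<in>A. app_homeo (inv_homeo g) y \<in> A"
    using \<open>finite A\<close> by (simp add: AE_finite_all)
  then have "AE g in \<nu>. app_homeo g ` A \<subseteq> A"
  proof eventually_elim
    case (elim g)
    have "app_homeo (inv_homeo g) ` A = A"
      using \<open>finite A\<close> elim by (intro card_subset_eq) (auto simp: card_image inj_on_def)
    then have "app_homeo g ` A = app_homeo g ` app_homeo (inv_homeo g) ` A" by simp
    also have "\<dots> = A" by (simp add: image_image)
    finally show ?case by simp
  qed
  then have "\<forall>g\<in>F. app_homeo g ` A \<subseteq> A"
    using invariant_if_AE[OF finite_imp_closed[OF \<open>finite A\<close>]] by blast
  with no_finite_invariant[OF \<open>finite A\<close> \<open>A \<noteq> {}\<close>] show False by blast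
qed

text \<open>The Feller property, by dominated convergence along sequences.\<close>

lemma continuous_on_markov_operator:
  fixes f :: "circle \<Rightarrow> real"
  assumes f: "continuous_on UNIV f"
  shows "continuous_on UNIV (\<lambda>x. \<integral>g. f (app_homeo g x) \<partial>\<nu>)"
proof (rule continuous_on_sequentiallyI)
  fix u :: "nat \<Rightarrow> circle" and a assume u: "u \<longlonglongrightarrow> a"
  have [measurable]: "f \<in> borel_measurable borel"
    using f by (rule borel_measurable_continuous_onI)
  obtain B where B: "\<And>x. norm (f x) \<le> B"
    using compact_imp_bounded[OF compact_continuous_image[OF f compact_UNIV_circle]]
    by (auto simp: bounded_iff)
  have "(\<lambda>n. f (app_homeo g (u n))) \<longlonglongrightarrow> f (app_homeo g a)" for g
    using continuous_on_tendsto_compose[OF f continuous_on_tendsto_compose[OF continuous_on_app_homeo[of UNIV g] u]]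
    by simp
  then show "(\<lambda>n. \<integral>g. f (app_homeo g (u n)) \<partial>\<nu>) \<longlonglongrightarrow> (\<integral>g. f (app_homeo g a) \<partial>\<nu>)"
    using B by (intro integral_dominated_convergence[where w = "\<lambda>_. B"]) auto
qed

text \<open>The Feller property lets \<open>transport\<close> pass to weak limits. Asking only for
  asymptotic invariance in \<open>asymp\<close> covers both limits of stationary measures and limits
  of Cesaro averages.\<close>

lemma markov_stationary_limit:
  assumes m: "\<And>n. prob_space (m n)" "\<And>n. sets (m n) = sets borel"
    and M: "prob_space M" "sets M = sets borel"
    and conv: "\<And>f :: circle \<Rightarrow> real. continuous_on UNIV f \<Longrightarrow>
      (\<lambda>n. \<integral>x. f x \<partial>m n) \<longlonglongrightarrow> (\<integral>x. f x \<partial>M)"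
    and asymp: "\<And>f :: circle \<Rightarrow> real. continuous_on UNIV f \<Longrightarrow> (\<And>x. \<bar>f x\<bar> \<le> 1) \<Longrightarrow>
      (\<lambda>n. (\<integral>x. f x \<partial>transport \<nu> (m n)) - (\<integral>x. f x \<partial>m n)) \<longlonglongrightarrow> 0"
  shows "markov_stationary \<nu> M"
proof -
  have "transport \<nu> M = M"
  proof (rule measure_eqI_continuous)
    fix f :: "circle \<Rightarrow> real" assume f: "continuous_on UNIV f" "\<And>x. 0 \<le> f x \<and> f x \<le> 1"
    have [measurable]: "f \<in> borel_measurable borel"
      using f(1) by (rule borel_measurable_continuous_onI)
    have bd: "\<bar>f x\<bar> \<le> 1" for x using f(2)[of x] by simp
    have "(\<lambda>n. \<integral>x. f x \<partial>transport \<nu> (m n)) \<longlonglongrightarrow> (\<integral>x. f x \<partial>transport \<nu> M)"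
      using conv[OF continuous_on_markov_operator[OF f(1)]]
      by (simp add: integral_transport[OF m(2) m(1) _ bd] integral_transport[OF M(2) M(1) _ bd])
    from tendsto_diff[OF this conv[OF f(1)]] asymp[OF f(1) bd]
    show "(\<integral>x. f x \<partial>transport \<nu> M) = (\<integral>x. f x \<partial>M)"
      using LIMSEQ_unique by fastforce
  qed (use M prob_space_transport sets_transport in auto)
  with M show ?thesis by (simp add: markov_stationary_def)
qed

text \<open>Compactness: violations on balls shrinking to points would, along a subsequence, produce
  a stationary limit measure giving mass at least \<open>c\<close> to every closed ball around the
  limit of the centres, against atomlessness.\<close>

lemma uniformly_small_cballs:
  assumes "c > 0"
  shows "\<exists>\<eta>>0. \<forall>\<mu> x. markov_stationary \<nu> \<mu> \<longrightarrow> measure \<mu> (cball x \<eta>) < c"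
proof (rule ccontr)
  assume "\<not> ?thesis"
  then have "\<exists>\<mu> x. markov_stationary \<nu> \<mu> \<and> c \<le> measure \<mu> (cball x (1 / real (Suc n)))" for n
    by (meson of_nat_0_less_iff zero_less_Suc zero_less_divide_1_iff not_le)
  then obtain m x where m: "\<And>n. markov_stationary \<nu> (m n)"
    and ge: "\<And>n. c \<le> measure (m n) (cball (x n) (1 / real (Suc n)))"
    by metis
  note mD = markov_stationaryD[OF m]
  obtain r M where r: "strict_mono (r :: nat \<Rightarrow> nat)" and M: "prob_space M" "sets M = sets borel"
    and conv: "\<And>f :: circle \<Rightarrow> real. continuous_on UNIV f \<Longrightarrow>
      (\<lambda>n. \<integral>x. f x \<partial>m (r n)) \<longlonglongrightarrow> (\<integral>x. f x \<partial>M)"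
    using circle_measures_subsequence[of m] mD by blast
  have stat: "markov_stationary \<nu> M"
    by (rule markov_stationary_limit[of "\<lambda>n. m (r n)"]) (use mD M conv in auto)
  obtain l r' where r': "strict_mono (r' :: nat \<Rightarrow> nat)" and l: "(\<lambda>n. x (r (r' n))) \<longlonglongrightarrow> l"
    using compact_UNIV_circle[unfolded compact_def, rule_format, of "\<lambda>n. x (r n)"]
    by (auto simp: o_def)
  obtain \<rho> where \<rho>: "\<rho> > 0" "measure M (cball l \<rho>) < c"
    using measure_small_cball[of M l c] M markov_stationary_atomless[OF stat] \<open>c > 0\<close>
      prob_space.finite_measure[OF M(1)] by auto
  \<comment> \<open>A continuous bump, equal to 1 on the ball of radius \<rho>/2 around
    \<open>l\<close> and to 0 outside that of radius \<rho>. A small ball with centre within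
    \<rho>/4 of \<open>l\<close> and radius below \<rho>/4 lies in the inner one.\<close>
  define f where "f y = max 0 (min 1 (2 - 2 * dist l y / \<rho>))" for y
  have f_cont: "continuous_on UNIV f"
    unfolding f_def using \<rho> by (intro continuous_intros) auto
  then have [measurable]: "f \<in> borel_measurable borel" by (rule borel_measurable_continuous_onI)
  have f01: "0 \<le> f y" "f y \<le> 1" for y by (auto simp: f_def)
  have integrable: "integrable P f" if "prob_space P" "sets P = sets borel" for P
  proof -
    interpret P: prob_space P by fact
    have [measurable_cong]: "sets P = sets borel" by fact
    show ?thesis by (intro P.integrable_const_bound[of _ 1]) (auto simp: f01)
  qed
  have "(\<integral>y. f y \<partial>M) \<le> (\<integral>y. indicator (cball l \<rho>) y \<partial>M)"
  proof (rule integral_mono)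
    interpret M: prob_space M by fact
    show "integrable M (indicator (cball l \<rho>) :: _ \<Rightarrow> real)"
      by (intro integrable_real_indicator) (auto simp: M M.emeasure_eq_measure)
    show "f y \<le> indicator (cball l \<rho>) y" for y
    proof (cases "y \<in> cball l \<rho>")
      case False
      then have "2 - 2 * dist l y / \<rho> \<le> 0" using \<rho> by (simp add: field_simps)
      then show ?thesis by (simp add: f_def)
    qed (simp add: f01)
  qed (use integrable M in auto)
  also have "\<dots> = measure M (cball l \<rho>)"
    using sets_eq_imp_space_eq[OF M(2)] by simp
  finally have "(\<integral>y. f y \<partial>M) < c" using \<rho> by simp
  moreover have "c \<le> (\<integral>y. f y \<partial>M)"
  proof (rule LIMSEQ_le_const)
    show "(\<lambda>n. \<integral>y. f y \<partial>m (r (r' n))) \<longlonglongrightarrow> (\<integral>y. f y \<partial>M)"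
      using LIMSEQ_subseq_LIMSEQ[OF conv[OF f_cont] r'] by (simp add: o_def)
    have "\<forall>\<^sub>F n in sequentially. dist (x (r (r' n))) l < \<rho> / 4"
      using tendstoD[OF l, of "\<rho> / 4"] \<rho> by simp
    moreover have "(\<lambda>n. 1 / real (Suc n)) \<longlonglongrightarrow> 0" by real_asymp
    then have "(\<lambda>n. 1 / real (Suc (r (r' n)))) \<longlonglongrightarrow> 0"
      using LIMSEQ_subseq_LIMSEQ[OF _ strict_mono_o[OF r r']] by (force simp: o_def)
    then have "\<forall>\<^sub>F n in sequentially. 1 / real (Suc (r (r' n))) < \<rho> / 4"
      using \<rho> by (intro order_tendstoD(2)) auto
    ultimately have "\<forall>\<^sub>F n in sequentially. c \<le> (\<integral>y. f y \<partial>m (r (r' n)))"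
    proof eventually_elim
      case (elim n)
      define k where "k = r (r' n)"
      have "c \<le> measure (m k) (cball (x k) (1 / real (Suc k)))" by (rule ge)
      also have "\<dots> = (\<integral>y. indicator (cball (x k) (1 / real (Suc k))) y \<partial>m k)"
        by (simp add: mD)
      also have "\<dots> \<le> (\<integral>y. f y \<partial>m k)"
      proof (rule integral_mono)
        interpret mk: prob_space "m k" by (rule mD)
        show "integrable (m k) (indicator (cball (x k) (1 / real (Suc k))) :: _ \<Rightarrow> real)"
          by (intro integrable_real_indicator) (auto simp: mD mk.emeasure_eq_measure)
        show "indicator (cball (x k) (1 / real (Suc k))) y \<le> f y" for y
        proof (cases "y \<in> cball (x k) (1 / real (Suc k))")
          case True
          then have "dist l y \<le> \<rho> / 2"
            using elim dist_triangle[of l y "x k"] by (simp add: k_def dist_commute)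
          then have "1 \<le> 2 - 2 * dist l y / \<rho>" using \<rho> by (simp add: field_simps)
          then have "f y = 1" by (simp add: f_def)
          then show ?thesis by (simp add: indicator_def)
        qed (simp add: f01)
      qed (use integrable mD in auto)
      finally show ?case by (simp add: k_def)
    qed
    then show "\<exists>N. \<forall>n\<ge>N. c \<le> (\<integral>y. f y \<partial>m (r (r' n)))"
      by (simp add: eventually_sequentially)
  qed
  ultimately show False by simp
qed

end

text \<open>Zorn's lemma on complements, which turns shrinking closed sets into growing open ones;
  compactness prevents the union of a chain from being the whole circle.\<close>

lemma minimal_set_exists:
  assumes "invariant_set F K"
  shows "\<exists>N\<in>minimal_sets F. N \<subseteq> K"
proof -
  define \<A> where "\<A> = {U. - U \<subseteq> K \<and> invariant_set F (- U)}"
  have "\<A> \<noteq> {}" using assms by (auto simp: \<A>_def intro: exI[of _ "- K"])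
  moreover have "\<Union>\<C> \<in> \<A>" if C: "\<C> \<noteq> {}" "subset.chain \<A> \<C>" for \<C>
  proof -
    have sub: "\<C> \<subseteq> \<A>" using C(2) by (simp add: subset.chain_def)
    have op: "open U" if "U \<in> \<C>" for U
      using that sub by (auto simp: \<A>_def invariant_set_def closed_def)
    have "\<Union>\<C> \<noteq> UNIV"
    proof
      assume "\<Union>\<C> = UNIV"
      then obtain \<D> where D: "\<D> \<subseteq> \<C>" "finite \<D>" "UNIV \<subseteq> \<Union>\<D>"
        using compactE[OF compact_UNIV_circle, of \<C>] op by auto
      have "\<D> \<noteq> {}" using D(3) by auto
      moreover have "subset.chain \<A> \<D>" using D(1) C(2) sub unfolding subset_chain_def
        by (meson order_trans subsetD)
      ultimately have "\<Union>\<D> \<in> \<D>" using D(2) by (intro Union_in_chain)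
      moreover have "\<Union>\<D> = UNIV" using D(3) by auto
      ultimately have "UNIV \<in> \<A>" using D(1) sub by auto
      then show False by (simp add: \<A>_def invariant_set_def)
    qed
    moreover have "closed (- \<Union>\<C>)" using op by (simp add: closed_def open_Union)
    moreover have "app_homeo g ` (- \<Union>\<C>) \<subseteq> - \<Union>\<C>" if "g \<in> F" for g
    proof
      fix y assume "y \<in> app_homeo g ` (- \<Union>\<C>)"
      then obtain x where x: "y = app_homeo g x" "\<And>U. U \<in> \<C> \<Longrightarrow> x \<notin> U" by auto
      have "y \<notin> U" if "U \<in> \<C>" for U
      proof -
        have "app_homeo g ` (- U) \<subseteq> - U"
          using that sub \<open>g \<in> F\<close> by (auto simp: \<A>_def invariant_set_def)
        then show ?thesis using x that by auto
      qed
      then show "y \<in> - \<Union>\<C>" by auto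
    qed
    moreover have "- \<Union>\<C> \<subseteq> K" using C(1) sub by (auto simp: \<A>_def)
    ultimately show ?thesis by (auto simp: \<A>_def invariant_set_def)
  qed
  ultimately obtain U where U: "U \<in> \<A>" "\<And>V. V \<in> \<A> \<Longrightarrow> U \<subseteq> V \<Longrightarrow> V = U"
    using subset_Zorn_nonempty[of \<A>] by metis
  have "- U \<in> minimal_sets F"
    unfolding minimal_sets_def
  proof (intro CollectI conjI allI impI)
    show "invariant_set F (- U)" using U by (simp add: \<A>_def)
    fix K' assume "invariant_set F K'" "K' \<subseteq> - U"
    then have "- K' \<in> \<A>" "U \<subseteq> - K'" using U(1) by (auto simp: \<A>_def)
    from U(2)[OF this] show "K' = - U" by auto
  qed
  with U(1) show ?thesis by (auto simp: \<A>_def)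
qed

lemma minimal_setsD:
  assumes "N \<in> minimal_sets F"
  shows "invariant_set F N" "closed N" "N \<noteq> {}"
    and "\<And>K. invariant_set F K \<Longrightarrow> K \<subseteq> N \<Longrightarrow> K = N"
  using assms by (auto simp: minimal_sets_def invariant_set_def)

lemma minimal_sets_disjoint:
  assumes "M \<in> minimal_sets F" "N \<in> minimal_sets F" "M \<noteq> N"
  shows "M \<inter> N = {}"
proof (rule ccontr)
  assume "M \<inter> N \<noteq> {}"
  then have "invariant_set F (M \<inter> N)"
    using minimal_setsD(1)[OF assms(1)] minimal_setsD(1)[OF assms(2)]
    unfolding invariant_set_def by (auto simp: image_subset_iff)
  then have "M \<inter> N = M" "M \<inter> N = N"
    using minimal_setsD(4)[OF assms(1)] minimal_setsD(4)[OF assms(2)] by auto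
  with assms(3) show False by simp
qed

section \<open>Passing to the inverse system, and stationary measures on invariant sets\<close>

context random_homeo
begin

lemma random_homeo_inverse: "random_homeo (inverse_family F) (inverse_measure \<nu>)"
proof (rule random_homeo.intro)
  have inv: "inv_homeo \<in> \<nu> \<rightarrow>\<^sub>M borel" by measurable
  show "prob_space (inverse_measure \<nu>)"
    unfolding inverse_measure_def by (rule \<nu>.prob_space_distr[OF inv])
  show "sets (inverse_measure \<nu>) = sets borel" by (simp add: inverse_measure_def)
  have em: "emeasure (inverse_measure \<nu>) U = emeasure \<nu> (inv_homeo -` U)" if "open U" for U
    using that unfolding inverse_measure_def by (subst emeasure_distr[OF inv]) (auto simp: space_\<nu>)
  have op: "open (inv_homeo -` U)" if "open U" for U
    using continuous_on_inv_homeo that by (simp add: continuous_on_open_vimage)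
  have vv: "inv_homeo -` inv_homeo -` U = U" for U by auto
  have "g \<in> measure_support (inverse_measure \<nu>) \<longleftrightarrow> inv_homeo g \<in> measure_support \<nu>" for g
    unfolding measure_support_def mem_Collect_eq
  proof (intro iffI allI impI)
    fix U assume "\<forall>U. open U \<and> g \<in> U \<longrightarrow> 0 < emeasure (inverse_measure \<nu>) U"
      and U: "open U \<and> inv_homeo g \<in> U"
    then have "0 < emeasure (inverse_measure \<nu>) (inv_homeo -` U)" using op by auto
    with em[OF op] U show "0 < emeasure \<nu> U" by (simp add: vv)
  next
    fix U assume "\<forall>U. open U \<and> inv_homeo g \<in> U \<longrightarrow> 0 < emeasure \<nu> U"
      and U: "open U \<and> g \<in> U"
    then have "0 < emeasure \<nu> (inv_homeo -` U)" using op by auto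
    with em U show "0 < emeasure (inverse_measure \<nu>) U" by simp
  qed
  moreover have "g \<in> inv_homeo ` F \<longleftrightarrow> inv_homeo g \<in> F" for g
    by (metis image_iff inv_inv_homeo)
  ultimately show "measure_support (inverse_measure \<nu>) = inverse_family F"
    unfolding inverse_family_def support_\<nu> by blast
  fix A :: "circle set" assume A: "finite A" "A \<noteq> {}"
  then obtain g where g: "g \<in> F" "\<not> app_homeo g ` A \<subseteq> A" using no_finite_invariant by blast
  have "\<not> app_homeo (inv_homeo g) ` A \<subseteq> A"
  proof
    assume sub: "app_homeo (inv_homeo g) ` A \<subseteq> A"
    have "app_homeo (inv_homeo g) ` A = A"
      using A(1) sub by (intro card_subset_eq) (auto simp: card_image inj_on_def)
    then have "app_homeo g ` A = app_homeo g ` app_homeo (inv_homeo g) ` A" by simp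
    also have "\<dots> = A" by (simp add: image_image)
    finally show False using g by simp
  qed
  with g show "\<exists>g\<in>inverse_family F. \<not> app_homeo g ` A \<subseteq> A"
    by (auto simp: inverse_family_def)
qed

text \<open>Krylov-Bogolyubov: \<open>m k\<close> is the law after \<open>k\<close> steps from a
  point of \<open>K\<close>, and a weak limit of Cesaro averages of these laws is stationary. Almost
  every map preserves \<open>K\<close>, so all of them live on \<open>K\<close>.\<close>

lemma markov_stationary_exists:
  assumes K: "invariant_set F K"
  shows "\<exists>\<mu>. markov_stationary \<nu> \<mu> \<and> measure \<mu> K = 1"
proof -
  obtain x0 where "x0 \<in> K" using K by (auto simp: invariant_set_def)
  have closed: "closed K" using K by (simp add: invariant_set_def)
  then have Kb: "K \<in> sets borel" by simp
  define m where "m k = (transport \<nu> ^^ k) (return borel x0)" for k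
  have m_Suc: "m (Suc k) = transport \<nu> (m k)" for k by (simp add: m_def)
  have m: "sets (m k) = sets borel \<and> prob_space (m k)" for k
  proof (induction k)
    case 0
    show ?case by (simp add: m_def prob_space_return)
  next
    case (Suc k)
    then show ?case by (simp add: m_Suc sets_transport prob_space_transport)
  qed
  then have sets_m: "sets (m k) = sets borel" and prob_m: "prob_space (m k)" for k by auto
  have space_m: "space (m k) = UNIV" for k using sets_eq_imp_space_eq[OF sets_m] by simp
  have mK: "measure (m k) K = 1" for k
  proof (induction k)
    case 0
    show ?case using \<open>x0 \<in> K\<close> Kb by (simp add: m_def measure_return)
  next
    case (Suc k)
    interpret mk: prob_space "m k" by (rule prob_m)
    have "AE g in \<nu>. measure (m k) (app_homeo g -` K) = 1"
      using AE_in_F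
    proof eventually_elim
      case (elim g)
      then have "K \<subseteq> app_homeo g -` K" using K by (auto simp: invariant_set_def)
      moreover have "app_homeo g -` K \<in> sets (m k)"
        using measurable_sets[OF measurable_app_homeo Kb, of g] by (simp add: sets_m)
      ultimately have "1 \<le> measure (m k) (app_homeo g -` K)"
        using mk.finite_measure_mono[of K "app_homeo g -` K"] Suc by simp
      then show ?case using mk.prob_le_1[of "app_homeo g -` K"] by linarith
    qed
    then have "(\<integral>g. measure (m k) (app_homeo g -` K) \<partial>\<nu>) = (\<integral>g. 1 \<partial>\<nu>)"
      by (intro integral_cong_AE measure_transport(2)[OF sets_m prob_m Kb]) auto
    then show ?case
      by (simp add: m_Suc measure_transport(1)[OF sets_m prob_m Kb] \<nu>.prob_space)
  qed
  \<comment> \<open>The Cesaro average of \<open>m 0\<close>, ..., \<open>m n\<close>, written as a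
    mixture over a uniformly chosen time; hence the denominator \<open>Suc n\<close>.\<close>
  define A where "A n = measure_pmf (pmf_of_set {..n}) \<bind> m" for n
  have kernel: "m \<in> measure_pmf (pmf_of_set {..n}) \<rightarrow>\<^sub>M subprob_algebra borel" for n :: nat
    using m by (auto simp: space_subprob_algebra prob_space_imp_subprob_space)
  have A: "sets (A n) = sets borel" "prob_space (A n)" for n
    unfolding A_def
    by (rule sets_bind_measurable[OF kernel], simp)
      (rule measure_pmf.prob_space_bind[OF _ kernel], simp add: prob_m)
  have A_int: "(\<integral>x. f x \<partial>A n) = (\<Sum>k\<le>n. \<integral>x. f x \<partial>m k) / real (Suc n)"
    if "f \<in> borel_measurable borel" "\<And>x. \<bar>f x\<bar> \<le> B" for f :: "circle \<Rightarrow> real" and B n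
  proof -
    have "(\<integral>x. f x \<partial>A n) = (\<integral>k. \<integral>x. f x \<partial>m k \<partial>measure_pmf (pmf_of_set {..n}))"
      unfolding A_def
      by (rule integral_bind[where B = B and B' = 1, OF that(1) _ kernel])
        (use that prob_space.emeasure_space_1[OF prob_m] in \<open>auto intro: measure_pmf.finite_measure_axioms\<close>)
    then show ?thesis by (simp add: integral_pmf_of_set)
  qed
  obtain r M where r: "strict_mono (r :: nat \<Rightarrow> nat)" and M: "prob_space M" "sets M = sets borel"
    and conv: "\<And>f :: circle \<Rightarrow> real. continuous_on UNIV f \<Longrightarrow>
      (\<lambda>n. \<integral>x. f x \<partial>A (r n)) \<longlonglongrightarrow> (\<integral>x. f x \<partial>M)"
    using circle_measures_subsequence[of A] A by blast
  have "markov_stationary \<nu> M"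
  proof (rule markov_stationary_limit[of "\<lambda>n. A (r n)"])
    fix f :: "circle \<Rightarrow> real" assume f: "continuous_on UNIV f" "\<And>x. \<bar>f x\<bar> \<le> 1"
    have fm [measurable]: "f \<in> borel_measurable borel"
      using f(1) by (rule borel_measurable_continuous_onI)
    have Pfm: "(\<lambda>x. \<integral>g. f (app_homeo g x) \<partial>\<nu>) \<in> borel_measurable borel"
      using continuous_on_markov_operator[OF f(1)] by (rule borel_measurable_continuous_onI)
    have bound: "\<bar>\<integral>x. h x \<partial>P\<bar> \<le> 1" if "prob_space P" "\<And>x. \<bar>h x\<bar> \<le> 1" for P and h :: "_ \<Rightarrow> real"
    proof -
      interpret P: prob_space P by fact
      show ?thesis
      proof (cases "integrable P h")
        case True
        have "\<bar>\<integral>x. h x \<partial>P\<bar> \<le> (\<integral>x. \<bar>h x\<bar> \<partial>P)" by (rule integral_abs_bound)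
        also have "\<dots> \<le> (\<integral>x. 1 \<partial>P)" using True that by (intro integral_mono) auto
        finally show ?thesis by (simp add: P.prob_space)
      qed (simp add: not_integrable_integral_eq)
    qed
    have Pbd: "\<bar>\<integral>g. f (app_homeo g x) \<partial>\<nu>\<bar> \<le> 1" for x
      by (rule bound[OF prob_\<nu>]) (rule f)
    \<comment> \<open>One step shifts the averaged times by one, so all but the first and last terms
      cancel.\<close>
    have diff: "(\<integral>x. f x \<partial>transport \<nu> (A n)) - (\<integral>x. f x \<partial>A n) =
        ((\<integral>x. f x \<partial>m (Suc n)) - (\<integral>x. f x \<partial>m 0)) / real (Suc n)" for n
    proof -
      have "(\<integral>x. f x \<partial>transport \<nu> (A n)) =
          (\<Sum>k\<le>n. \<integral>x. f x \<partial>m (Suc k)) / real (Suc n)"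
        by (simp add: integral_transport[OF A fm f(2)] A_int[OF Pfm Pbd] m_Suc
            integral_transport[OF sets_m prob_m fm f(2)])
      then have "(\<integral>x. f x \<partial>transport \<nu> (A n)) - (\<integral>x. f x \<partial>A n) =
          (\<Sum>k\<le>n. (\<integral>x. f x \<partial>m (Suc k)) - (\<integral>x. f x \<partial>m k)) / real (Suc n)"
        by (simp add: A_int[OF fm f(2)] sum_subtractf diff_divide_distrib)
      then show ?thesis
        using sum_telescope[of "\<lambda>k. - (\<integral>x. f x \<partial>m k)" n] by simp
    qed
    have "(\<lambda>n. (\<integral>x. f x \<partial>transport \<nu> (A n)) - (\<integral>x. f x \<partial>A n)) \<longlonglongrightarrow> 0"
    proof (rule Lim_null_comparison)
      show "\<forall>\<^sub>F n in sequentially. norm ((\<integral>x. f x \<partial>transport \<nu> (A n)) - (\<integral>x. f x \<partial>A n))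
          \<le> 2 / real (Suc n)"
      proof (intro always_eventually allI)
        fix n
        have "\<bar>(\<integral>x. f x \<partial>m (Suc n)) - (\<integral>x. f x \<partial>m 0)\<bar> \<le> 2"
          using bound[OF prob_m[of "Suc n"], of f, OF f(2)] bound[OF prob_m[of 0], of f, OF f(2)]
          by linarith
        then show "norm ((\<integral>x. f x \<partial>transport \<nu> (A n)) - (\<integral>x. f x \<partial>A n)) \<le> 2 / real (Suc n)"
          unfolding diff by (simp add: divide_right_mono)
      qed
      show "(\<lambda>n. 2 / real (Suc n)) \<longlonglongrightarrow> 0" by real_asymp
    qed
    from LIMSEQ_subseq_LIMSEQ[OF this r]
    show "(\<lambda>n. (\<integral>x. f x \<partial>transport \<nu> (A (r n))) - (\<integral>x. f x \<partial>A (r n))) \<longlonglongrightarrow> 0"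
      by (simp add: o_def)
  qed (use A M conv in auto)
  moreover have "measure M K = 1"
  proof -
    interpret M: prob_space M by fact
    have [measurable_cong]: "sets M = sets borel" by (rule M)
    \<comment> \<open>The distance to \<open>K\<close> is a continuous test function that vanishes
      exactly on \<open>K\<close>, so living on \<open>K\<close> survives the weak limit.\<close>
    have cont: "continuous_on UNIV (\<lambda>x. infdist x K)" by (intro continuous_intros)
    then have im [measurable]: "(\<lambda>x. infdist x K) \<in> borel_measurable borel"
      by (rule borel_measurable_continuous_onI)
    have bd: "\<bar>infdist x K\<bar> \<le> 2" for x
      using infdist_le[OF \<open>x0 \<in> K\<close>, of x] dist_circle_le_2[of x x0] infdist_nonneg[of x K] by simp
    have "(\<integral>x. infdist x K \<partial>m k) = 0" for k
    proof -
      interpret mk: prob_space "m k" by (rule prob_m)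
      have "AE x in m k. x \<in> K" using mK[of k] by (intro mk.AE_prob_1)
      then have "AE x in m k. infdist x K = 0" by eventually_elim simp
      then show ?thesis by (rule integral_eq_zero_AE)
    qed
    then have "(\<integral>x. infdist x K \<partial>A n) = 0" for n
      by (simp add: A_int[OF im bd])
    with conv[OF cont] have "(\<lambda>n. 0 :: real) \<longlonglongrightarrow> (\<integral>x. infdist x K \<partial>M)" by simp
    then have "(\<integral>x. infdist x K \<partial>M) = 0"
      by (rule LIMSEQ_unique[OF _ tendsto_const])
    moreover have "integrable M (\<lambda>x. infdist x K)"
      using bd by (intro M.integrable_const_bound[of _ 2]) auto
    ultimately have "AE x in M. infdist x K = 0"
      by (subst (asm) integral_nonneg_eq_0_iff_AE) (auto simp: infdist_nonneg)
    then have "AE x in M. x \<in> K"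
    proof eventually_elim
      case (elim x)
      then show ?case using in_closed_iff_infdist_zero[OF closed] \<open>x0 \<in> K\<close> by auto
    qed
    then show ?thesis using Kb M(2) by (subst M.prob_eq_1) auto
  qed
  ultimately show ?thesis by blast
qed

section \<open>Twisted harmonic functions\<close>

text \<open>The exceptional null set may depend on the point: for each fixed point the condition is
  closed in the homeomorphism and thus holds on all of the support.\<close>

lemma invariant_if_pointwise_AE:
  assumes "closed C" and AE: "\<And>x. x \<in> C \<Longrightarrow> AE g in \<nu>. app_homeo g x \<in> C" and "g \<in> F"
  shows "app_homeo g ` C \<subseteq> C"
proof -
  have "F \<subseteq> (\<lambda>g. app_homeo g x) -` C" if "x \<in> C" for x
    by (rule F_subset_if_AE)
      (use continuous_on_eval_left[of UNIV x] \<open>closed C\<close> AE[OF that] in \<open>auto simp: continuous_on_closed_vimage\<close>)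
  with \<open>g \<in> F\<close> show ?thesis by auto
qed

text \<open>Fixed points of the Markov operator twisted by the orientation character; ordinary
  continuous harmonic functions if almost every map preserves orientation.\<close>

definition twisted_harmonic :: "(circle \<Rightarrow> real) \<Rightarrow> bool" where
  "twisted_harmonic f \<longleftrightarrow> continuous_on UNIV f \<and>
    (\<forall>x. f x = (\<integral>g. orientation_sign g * f (app_homeo g x) \<partial>\<nu>))"

lemma twisted_harmonic_continuous: "twisted_harmonic f \<Longrightarrow> continuous_on UNIV f"
  unfolding twisted_harmonic_def by (rule conjunct1)

lemma twisted_harmonic_eq:
  "twisted_harmonic f \<Longrightarrow> (\<integral>g. orientation_sign g * f (app_homeo g x) \<partial>\<nu>) = f x"
  unfolding twisted_harmonic_def by (rule sym) (erule conjE, erule spec)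

lemma continuous_circle_bounded:
  fixes f :: "circle \<Rightarrow> real"
  assumes "continuous_on UNIV f"
  obtains B where "\<And>x. \<bar>f x\<bar> \<le> B"
  using compact_imp_bounded[OF compact_continuous_image[OF assms compact_UNIV_circle]]
  by (auto simp: bounded_iff)

lemma integrable_twisted:
  fixes f :: "circle \<Rightarrow> real"
  assumes "continuous_on UNIV f"
  shows "integrable \<nu> (\<lambda>g. orientation_sign g * f (app_homeo g x))"
    and "integrable \<nu> (\<lambda>g. f (app_homeo g x))"
proof -
  have [measurable]: "f \<in> borel_measurable borel"
    using assms by (rule borel_measurable_continuous_onI)
  obtain B where "\<And>x. \<bar>f x\<bar> \<le> B" using continuous_circle_bounded[OF assms] by blast
  then show "integrable \<nu> (\<lambda>g. orientation_sign g * f (app_homeo g x))"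
    and "integrable \<nu> (\<lambda>g. f (app_homeo g x))"
    by (auto intro!: \<nu>.integrable_const_bound[of _ B] simp: abs_mult)
qed

lemma integrable_orientation_sign: "integrable \<nu> orientation_sign"
  by (intro \<nu>.integrable_const_bound[of _ 1]) auto

lemma twisted_harmonic_sum:
  assumes "\<And>i. i \<in> I \<Longrightarrow> twisted_harmonic (f i)"
  shows "twisted_harmonic (\<lambda>x. \<Sum>i\<in>I. c i * f i x)"
proof -
  have cont: "continuous_on UNIV (f i)" if "i \<in> I" for i
    using assms[OF that] by (rule twisted_harmonic_continuous)
  have "(\<Sum>i\<in>I. c i * f i x) =
      (\<integral>g. orientation_sign g * (\<Sum>i\<in>I. c i * f i (app_homeo g x)) \<partial>\<nu>)" for x
  proof -
    have "(\<integral>g. orientation_sign g * (\<Sum>i\<in>I. c i * f i (app_homeo g x)) \<partial>\<nu>) =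
        (\<integral>g. (\<Sum>i\<in>I. c i * (orientation_sign g * f i (app_homeo g x))) \<partial>\<nu>)"
      by (simp add: sum_distrib_left mult.left_commute)
    also have "\<dots> = (\<Sum>i\<in>I. c i * (\<integral>g. orientation_sign g * f i (app_homeo g x) \<partial>\<nu>))"
      by (subst Bochner_Integration.integral_sum) (auto intro!: integrable_twisted cont)
    also have "\<dots> = (\<Sum>i\<in>I. c i * f i x)"
      using assms by (intro sum.cong) (auto simp: twisted_harmonic_eq)
    finally show ?thesis by simp
  qed
  moreover have "continuous_on UNIV (\<lambda>x. \<Sum>i\<in>I. c i * f i x)"
    by (intro continuous_intros cont)
  ultimately show ?thesis unfolding twisted_harmonic_def by blast
qed

text \<open>The value at \<open>x\<close> is a mean of numbers whose absolute values do not exceed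
  its own, so almost all of them coincide with it. This is the maximum principle in its pointwise
  form.\<close>

lemma twisted_harmonic_AE_at_maximum:
  assumes f: "twisted_harmonic f" and K: "invariant_set F K" and x: "x \<in> K"
    and max: "\<And>y. y \<in> K \<Longrightarrow> \<bar>f y\<bar> \<le> \<bar>f x\<bar>"
  shows "AE g in \<nu>. app_homeo g x \<in> K \<and> f (app_homeo g x) = orientation_sign g * f x"
proof -
  define s :: real where "s = (if f x \<ge> 0 then 1 else - 1)"
  have s: "s * f x = \<bar>f x\<bar>" "s * s = 1" "\<bar>s\<bar> = 1" by (auto simp: s_def)
  have cont: "continuous_on UNIV f" using f by (rule twisted_harmonic_continuous)
  have int: "integrable \<nu> (\<lambda>g. s * (orientation_sign g * f (app_homeo g x)))"
    using integrable_twisted(1)[OF cont] by simp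
  have in_K: "AE g in \<nu>. app_homeo g x \<in> K"
    using AE_in_F by eventually_elim (use K x in \<open>auto simp: invariant_set_def\<close>)
  have "(\<integral>g. \<bar>f x\<bar> - s * (orientation_sign g * f (app_homeo g x)) \<partial>\<nu>) =
      \<bar>f x\<bar> - s * f x"
    using twisted_harmonic_eq[OF f, of x] int \<nu>.prob_space by simp
  then have zero: "(\<integral>g. \<bar>f x\<bar> - s * (orientation_sign g * f (app_homeo g x)) \<partial>\<nu>) = 0"
    by (simp add: s)
  have "AE g in \<nu>. 0 \<le> \<bar>f x\<bar> - s * (orientation_sign g * f (app_homeo g x))"
    using in_K
  proof eventually_elim
    case (elim g)
    have "s * (orientation_sign g * f (app_homeo g x)) \<le> \<bar>s * (orientation_sign g * f (app_homeo g x))\<bar>"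
      by (rule abs_ge_self)
    also have "\<dots> = \<bar>f (app_homeo g x)\<bar>" by (simp add: abs_mult s)
    finally show ?case using max[OF elim] by simp
  qed
  from integral_nonneg_eq_0_iff_AE[THEN iffD1, OF _ this zero] int
  have "AE g in \<nu>. \<bar>f x\<bar> - s * (orientation_sign g * f (app_homeo g x)) = 0" by simp
  with in_K show ?thesis
  proof eventually_elim
    case (elim g)
    then have "s * f x = s * (orientation_sign g * f (app_homeo g x))" by (simp add: s)
    then have "f x = orientation_sign g * f (app_homeo g x)" using s(3) by auto
    then show ?case using orientation_sign_cases[of g] elim by auto
  qed
qed

lemma continuous_abs_attains_max:
  fixes f :: "circle \<Rightarrow> real"
  assumes "continuous_on UNIV f" "closed K" "K \<noteq> {}"
  obtains x where "x \<in> K" "\<And>y. y \<in> K \<Longrightarrow> \<bar>f y\<bar> \<le> \<bar>f x\<bar>"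
proof -
  have "continuous_on K (\<lambda>x. \<bar>f x\<bar>)"
    using assms(1) by (intro continuous_intros) (rule continuous_on_subset, auto)
  then show ?thesis
    using continuous_attains_sup[of K "\<lambda>x. \<bar>f x\<bar>"] closed_circle_imp_compact[OF assms(2)] assms(3) that
    by blast
qed

lemma twisted_harmonic_max_set_invariant:
  assumes f: "twisted_harmonic f" and K: "invariant_set F K" and x: "x \<in> K"
    and max: "\<And>y. y \<in> K \<Longrightarrow> \<bar>f y\<bar> \<le> \<bar>f x\<bar>"
  shows "invariant_set F {y \<in> K. \<bar>f y\<bar> = \<bar>f x\<bar>}"
  unfolding invariant_set_def
proof (intro conjI ballI)
  have cont: "continuous_on UNIV (\<lambda>y. \<bar>f y\<bar>)"
    using twisted_harmonic_continuous[OF f] by (rule continuous_on_rabs)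
  have "closed K" using K by (simp add: invariant_set_def)
  moreover have "{y \<in> K. \<bar>f y\<bar> = \<bar>f x\<bar>} = K \<inter> (\<lambda>y. \<bar>f y\<bar>) -` {\<bar>f x\<bar>}" by auto
  ultimately show closed: "closed {y \<in> K. \<bar>f y\<bar> = \<bar>f x\<bar>}"
    using cont by (simp add: continuous_on_closed_vimage closed_Int)
  show "{y \<in> K. \<bar>f y\<bar> = \<bar>f x\<bar>} \<noteq> {}" using x by auto
  show "app_homeo g ` {y \<in> K. \<bar>f y\<bar> = \<bar>f x\<bar>} \<subseteq> {y \<in> K. \<bar>f y\<bar> = \<bar>f x\<bar>}" if "g \<in> F" for g
  proof (rule invariant_if_pointwise_AE[OF closed _ that])
    fix y assume y: "y \<in> {y \<in> K. \<bar>f y\<bar> = \<bar>f x\<bar>}"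
    then have "AE g in \<nu>. app_homeo g y \<in> K \<and> f (app_homeo g y) = orientation_sign g * f y"
      using max by (intro twisted_harmonic_AE_at_maximum[OF f K]) auto
    then show "AE g in \<nu>. app_homeo g y \<in> {y \<in> K. \<bar>f y\<bar> = \<bar>f x\<bar>}"
      by eventually_elim (use y in \<open>auto simp: abs_mult\<close>)
  qed
qed

lemma twisted_harmonic_abs_const:
  assumes f: "twisted_harmonic f" and N: "N \<in> minimal_sets F" and "x \<in> N" "y \<in> N"
  shows "\<bar>f x\<bar> = \<bar>f y\<bar>"
proof -
  obtain z where z: "z \<in> N" "\<And>y. y \<in> N \<Longrightarrow> \<bar>f y\<bar> \<le> \<bar>f z\<bar>"
    using continuous_abs_attains_max[OF twisted_harmonic_continuous[OF f] minimal_setsD(2,3)[OF N]]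
    by blast
  have "{y \<in> N. \<bar>f y\<bar> = \<bar>f z\<bar>} = N"
    using twisted_harmonic_max_set_invariant[OF f minimal_setsD(1)[OF N] z]
    by (rule minimal_setsD(4)[OF N]) auto
  then have "\<bar>f u\<bar> = \<bar>f z\<bar>" if "u \<in> N" for u using that by blast
  with assms(3,4) show ?thesis by simp
qed

text \<open>The set where the absolute value is largest is invariant, so it contains a minimal set,
  and a zero there makes the maximum 0.\<close>

lemma twisted_harmonic_eq_zero:
  assumes f: "twisted_harmonic f" and zero: "\<And>N. N \<in> minimal_sets F \<Longrightarrow> \<exists>y\<in>N. f y = 0"
  shows "f x = 0"
proof -
  have "invariant_set F UNIV" by (simp add: invariant_set_def)
  moreover obtain z where z: "\<And>y. \<bar>f y\<bar> \<le> \<bar>f z\<bar>"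
    using continuous_abs_attains_max[OF twisted_harmonic_continuous[OF f], of UNIV] by auto
  ultimately have "invariant_set F {y \<in> UNIV. \<bar>f y\<bar> = \<bar>f z\<bar>}"
    by (intro twisted_harmonic_max_set_invariant[OF f]) auto
  from minimal_set_exists[OF this]
  obtain N where N: "N \<in> minimal_sets F" "N \<subseteq> {y \<in> UNIV. \<bar>f y\<bar> = \<bar>f z\<bar>}" by blast
  then obtain y where "y \<in> N" "f y = 0" using zero by blast
  with N have "\<bar>f z\<bar> = 0" by auto
  with z[of x] show ?thesis by simp
qed

text \<open>The sign acquired under a map is its orientation, the same for every member of the
  family. So the points of \<open>N\<close> reached with one common sign form a closed invariant
  set, which by minimality is \<open>N\<close>.\<close>

lemma twisted_harmonic_family_on_minimal:
  assumes f: "\<And>i. i \<in> I \<Longrightarrow> twisted_harmonic (f i)" and "finite I"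
    and N: "N \<in> minimal_sets F" and x: "x0 \<in> N" "x \<in> N"
  shows "(\<forall>i\<in>I. f i x = f i x0) \<or> (\<forall>i\<in>I. f i x = - f i x0)"
proof -
  define C where "C = N \<inter> ((\<Inter>i\<in>I. f i -` {f i x0}) \<union> (\<Inter>i\<in>I. f i -` {- f i x0}))"
  have cl: "closed (f i -` {a})" if "i \<in> I" for i a
    using twisted_harmonic_continuous[OF f[OF that]] by (simp add: continuous_on_closed_vimage)
  have closed: "closed C"
    unfolding C_def using cl minimal_setsD(2)[OF N]
    by (intro closed_Int closed_Un closed_INT) auto
  have "invariant_set F C"
    unfolding invariant_set_def
  proof (intro conjI ballI)
    show "C \<noteq> {}" using x(1) by (auto simp: C_def)
    show "app_homeo g ` C \<subseteq> C" if "g \<in> F" for g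
    proof (rule invariant_if_pointwise_AE[OF closed _ that])
      fix y assume y: "y \<in> C"
      then have yN: "y \<in> N" by (simp add: C_def)
      have "AE g in \<nu>. app_homeo g y \<in> N \<and> f i (app_homeo g y) = orientation_sign g * f i y" if "i \<in> I" for i
      proof (rule twisted_harmonic_AE_at_maximum[OF f[OF that] minimal_setsD(1)[OF N] yN])
        show "\<bar>f i u\<bar> \<le> \<bar>f i y\<bar>" if "u \<in> N" for u
          using twisted_harmonic_abs_const[OF f[OF \<open>i \<in> I\<close>] N that yN] by simp
      qed
      then have "AE g in \<nu>. \<forall>i\<in>I. f i (app_homeo g y) = orientation_sign g * f i y"
        using \<open>finite I\<close> by (subst AE_finite_all) auto
      moreover have "AE g in \<nu>. app_homeo g y \<in> N"
        using AE_in_F by eventually_elim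
          (use y minimal_setsD(1)[OF N] in \<open>auto simp: invariant_set_def C_def\<close>)
      ultimately show "AE g in \<nu>. app_homeo g y \<in> C"
      proof eventually_elim
        case (elim g)
        with y orientation_sign_cases[of g] show ?case by (auto simp: C_def)
      qed
    qed
  qed (rule closed)
  then have "C = N" by (rule minimal_setsD(4)[OF N]) (auto simp: C_def)
  with x(2) show ?thesis by (auto simp: C_def)
qed

text \<open>Stationarity averages preimages; for the inverse maps these are images under the maps
  themselves.\<close>

lemma inverse_stationary_arc:
  assumes \<mu>: "markov_stationary (inverse_measure \<nu>) \<mu>"
  shows "measure \<mu> (circle_cis ` {s..t}) = (\<integral>g. measure \<mu> (app_homeo g ` circle_cis ` {s..t}) \<partial>\<nu>)"
    and "integrable \<nu> (\<lambda>g. measure \<mu> (app_homeo g ` circle_cis ` {s..t}))"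
proof -
  note inv_loc = random_homeo_inverse
  interpret \<mu>: prob_space \<mu> using random_homeo.markov_stationaryD[OF inv_loc, OF \<mu>] by simp
  have eq: "app_homeo (inv_homeo g) -` circle_cis ` {s..t} = app_homeo g ` circle_cis ` {s..t}" for g
    by (simp add: app_homeo_vimage)
  have inv: "inv_homeo \<in> \<nu> \<rightarrow>\<^sub>M borel" by measurable
  have m: "(\<lambda>g. measure \<mu> (app_homeo g -` circle_cis ` {s..t})) \<in> borel_measurable borel"
    using random_homeo.measure_transport(2)[OF inv_loc, of \<mu> "circle_cis ` {s..t}"] random_homeo.markov_stationaryD[OF inv_loc, OF \<mu>]
    by (simp add: inverse_measure_def)
  have "measure \<mu> (circle_cis ` {s..t}) =
      (\<integral>g. measure \<mu> (app_homeo g -` circle_cis ` {s..t}) \<partial>inverse_measure \<nu>)"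
    by (rule random_homeo.markov_stationary_measure[OF inv_loc, OF \<mu>]) simp
  also have "\<dots> = (\<integral>g. measure \<mu> (app_homeo g ` circle_cis ` {s..t}) \<partial>\<nu>)"
    unfolding inverse_measure_def by (subst integral_distr[OF inv m]) (simp add: eq)
  finally show "measure \<mu> (circle_cis ` {s..t}) = \<dots>" .
  show "integrable \<nu> (\<lambda>g. measure \<mu> (app_homeo g ` circle_cis ` {s..t}))"
    using measurable_compose[OF inv m] by (intro \<nu>.integrable_const_bound[of _ 1]) (auto simp: eq)
qed

text \<open>An orientation-reversing map exchanges the endpoints of an arc, which is where the sign comes
  from. The additive constant left over from passing to endpoints is absorbed by adding a constant
  to the function, or vanishes by the maximum principle when almost every map preserves
  orientation.\<close>

lemma twisted_harmonic_of_stationary: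
  assumes \<mu>: "markov_stationary (inverse_measure \<nu>) \<mu>"
    and \<mu>': "markov_stationary (inverse_measure \<nu>) \<mu>'"
  shows "\<exists>f. twisted_harmonic f \<and> (\<forall>s t. s \<le> t \<longrightarrow> t \<le> s + 2 * pi \<longrightarrow>
    f (circle_cis t) - f (circle_cis s) =
      measure \<mu> (circle_cis ` {s..t}) - measure \<mu>' (circle_cis ` {s..t}))"
proof -
  note inv_loc = random_homeo_inverse
  obtain h where cont: "continuous_on UNIV h" and
    h: "\<And>s t. s \<le> t \<Longrightarrow> t \<le> s + 2 * pi \<Longrightarrow> h (circle_cis t) - h (circle_cis s) =
      measure \<mu> (circle_cis ` {s..t}) - measure \<mu>' (circle_cis ` {s..t})"
    using circle_cdf_difference[of \<mu> \<mu>'] random_homeo.markov_stationaryD[OF inv_loc, OF \<mu>] random_homeo.markov_stationaryD[OF inv_loc, OF \<mu>']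
      random_homeo.markov_stationary_atomless[OF inv_loc, OF \<mu>] random_homeo.markov_stationary_atomless[OF inv_loc, OF \<mu>'] by blast
  have arc: "h (circle_cis t) - h (circle_cis s) =
      (\<integral>g. orientation_sign g * h (app_homeo g (circle_cis t)) \<partial>\<nu>) -
      (\<integral>g. orientation_sign g * h (app_homeo g (circle_cis s)) \<partial>\<nu>)"
    if st: "s \<le> t" "t \<le> s + 2 * pi" for s t
  proof -
    have pt: "measure \<mu> (app_homeo g ` circle_cis ` {s..t}) - measure \<mu>' (app_homeo g ` circle_cis ` {s..t}) =
        orientation_sign g * h (app_homeo g (circle_cis t)) -
        orientation_sign g * h (app_homeo g (circle_cis s))" for g
    proof (cases "orientation_sign g = 1")
      case True
      from image_circle_arc(1)[OF st True] obtain s' t' where "s' \<le> t'" "t' \<le> s' + 2 * pi"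
        "circle_cis s' = app_homeo g (circle_cis s)" "circle_cis t' = app_homeo g (circle_cis t)"
        "app_homeo g ` circle_cis ` {s..t} = circle_cis ` {s'..t'}" by blast
      with h[of s' t'] True show ?thesis by simp
    next
      case False
      then have neg: "orientation_sign g = - 1" using orientation_sign_cases by blast
      from image_circle_arc(2)[OF st neg] obtain s' t' where "s' \<le> t'" "t' \<le> s' + 2 * pi"
        "circle_cis s' = app_homeo g (circle_cis t)" "circle_cis t' = app_homeo g (circle_cis s)"
        "app_homeo g ` circle_cis ` {s..t} = circle_cis ` {s'..t'}" by blast
      with h[of s' t'] neg show ?thesis by simp
    qed
    have "h (circle_cis t) - h (circle_cis s) =
        (\<integral>g. measure \<mu> (app_homeo g ` circle_cis ` {s..t}) -
          measure \<mu>' (app_homeo g ` circle_cis ` {s..t}) \<partial>\<nu>)"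
      using inverse_stationary_arc[OF \<mu>, of s t] inverse_stationary_arc[OF \<mu>', of s t] h[OF st] by simp
    also have "\<dots> = (\<integral>g. orientation_sign g * h (app_homeo g (circle_cis t)) -
        orientation_sign g * h (app_homeo g (circle_cis s)) \<partial>\<nu>)"
      by (simp only: pt)
    also have "\<dots> = (\<integral>g. orientation_sign g * h (app_homeo g (circle_cis t)) \<partial>\<nu>) -
      (\<integral>g. orientation_sign g * h (app_homeo g (circle_cis s)) \<partial>\<nu>)"
      by (intro Bochner_Integration.integral_diff integrable_twisted cont)
    finally show ?thesis .
  qed
  \<comment> \<open>By \<open>arc\<close>, \<open>h\<close> and its twisted average have equal
    increments, so their difference is this constant.\<close>
  define c where "c = h (circle_cis 0) - (\<integral>g. orientation_sign g * h (app_homeo g (circle_cis 0)) \<partial>\<nu>)"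
  have c: "h x - (\<integral>g. orientation_sign g * h (app_homeo g x) \<partial>\<nu>) = c" for x
    using arc[of 0 "circle_angle x"] circle_angle_bounds[of x] by (simp add: c_def)
  define p where "p = (\<integral>g. orientation_sign g \<partial>\<nu>)"
  have shift: "(\<integral>g. orientation_sign g * (h (app_homeo g x) + k) \<partial>\<nu>) =
      (\<integral>g. orientation_sign g * h (app_homeo g x) \<partial>\<nu>) + p * k" for x k
    unfolding p_def distrib_left using integrable_twisted(1)[OF cont] integrable_orientation_sign
    by simp
  \<comment> \<open>Adding \<open>k\<close> to \<open>h\<close> changes the defect from
    \<open>c\<close> to \<open>c + k - p * k\<close>, which can be made 0 unless \<open>p\<close> is
    1.\<close>
  have "\<exists>k. c + k - p * k = 0"
  proof (cases "p = 1")
    case False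
    then show ?thesis by (intro exI[of _ "- c / (1 - p)"]) (simp add: field_simps)
  next
    case True
    have "(\<integral>g. 1 - orientation_sign g \<partial>\<nu>) = 0"
      using True integrable_orientation_sign \<nu>.prob_space by (simp add: p_def)
    moreover have "0 \<le> 1 - orientation_sign g" for g using orientation_sign_cases[of g] by auto
    ultimately have AE1: "AE g in \<nu>. 1 - orientation_sign g = 0"
      using integrable_orientation_sign by (subst (asm) integral_nonneg_eq_0_iff_AE) auto
    have avg: "h x - (\<integral>g. h (app_homeo g x) \<partial>\<nu>) = c" for x
    proof -
      have [measurable]: "h \<in> borel_measurable borel"
        using cont by (rule borel_measurable_continuous_onI)
      have "(\<integral>g. orientation_sign g * h (app_homeo g x) \<partial>\<nu>) = (\<integral>g. h (app_homeo g x) \<partial>\<nu>)"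
        by (rule integral_cong_AE) (use AE1 in auto)
      with c[of x] show ?thesis by simp
    qed
    have const: "(\<integral>g. a \<partial>\<nu>) = a" for a :: real by (simp add: \<nu>.prob_space)
    \<comment> \<open>At a maximum of \<open>h\<close> the average cannot exceed the value, so the
      defect is nonnegative; a minimum gives the other sign.\<close>
    obtain u where u: "\<And>y. h y \<le> h u"
      using continuous_attains_sup[OF compact_UNIV_circle _ cont] by auto
    have "(\<integral>g. h (app_homeo g u) \<partial>\<nu>) \<le> (\<integral>g. h u \<partial>\<nu>)"
      by (intro integral_mono integrable_twisted cont) (auto simp: u)
    then have "c \<ge> 0" using avg[of u] const[of "h u"] by linarith
    moreover obtain v where v: "\<And>y. h v \<le> h y"
      using continuous_attains_inf[OF compact_UNIV_circle _ cont] by auto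
    have "(\<integral>g. h v \<partial>\<nu>) \<le> (\<integral>g. h (app_homeo g v) \<partial>\<nu>)"
      by (intro integral_mono integrable_twisted cont) (auto simp: v)
    then have "c \<le> 0" using avg[of v] const[of "h v"] by linarith
    ultimately show ?thesis by (intro exI[of _ 0]) simp
  qed
  then obtain k where k: "c + k - p * k = 0" ..
  have "twisted_harmonic (\<lambda>x. h x + k)"
    unfolding twisted_harmonic_def
  proof (intro conjI allI)
    show "continuous_on UNIV (\<lambda>x. h x + k)" by (intro continuous_intros cont)
    show "h x + k = (\<integral>g. orientation_sign g * (h (app_homeo g x) + k) \<partial>\<nu>)" for x
      unfolding shift using c[of x] k by linarith
  qed
  with h show ?thesis by (intro exI[of _ "\<lambda>x. h x + k"]) simp
qed

end

section \<open>Counting stationary measures\<close>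

text \<open>Gaussian elimination, one point at a time: a function \<open>a i0\<close> not vanishing
  at \<open>z\<close> serves as pivot, and \<open>b\<close> is the family with the point
  \<open>z\<close> eliminated.\<close>

lemma linear_dependence_on_finite_set:
  fixes a :: "'i \<Rightarrow> 'z \<Rightarrow> real"
  assumes "finite Z" "finite I" "card Z < card I"
  shows "\<exists>c. (\<exists>i\<in>I. c i \<noteq> 0) \<and> (\<forall>z\<in>Z. (\<Sum>i\<in>I. c i * a i z) = 0)"
  using assms
proof (induction Z arbitrary: I a rule: finite_induct)
  case empty
  then obtain i where "i \<in> I" by (metis card.empty card_gt_0_iff ex_in_conv)
  then show ?case by (intro exI[of _ "\<lambda>_. 1"]) auto
next
  case (insert z Z)
  show ?case
  proof (cases "\<forall>i\<in>I. a i z = 0")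
    case True
    have "card Z < card I" using insert by simp
    then obtain c where c: "\<exists>i\<in>I. c i \<noteq> 0" "\<forall>w\<in>Z. (\<Sum>i\<in>I. c i * a i w) = 0"
      using insert.IH[of I a] insert.prems by blast
    moreover have "(\<Sum>i\<in>I. c i * a i z) = 0" using True by simp
    ultimately show ?thesis by (intro exI[of _ c]) auto
  next
    case False
    then obtain i0 where i0: "i0 \<in> I" "a i0 z \<noteq> 0" by blast
    define J where "J = I - {i0}"
    have J: "finite J" "card Z < card J" "i0 \<notin> J" "I = insert i0 J"
      using insert i0 by (auto simp: J_def)
    define b where "b i w = a i w - a i z / a i0 z * a i0 w" for i w
    obtain c where c: "\<exists>i\<in>J. c i \<noteq> 0" "\<forall>w\<in>Z. (\<Sum>i\<in>J. c i * b i w) = 0"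
      using insert.IH[OF J(1,2), of b] by blast
    define k where "k = - (\<Sum>i\<in>J. c i * (a i z / a i0 z))"
    define c' where "c' i = (if i = i0 then k else c i)" for i
    have sum: "(\<Sum>i\<in>I. c' i * a i w) = (\<Sum>i\<in>J. c i * b i w)" for w
    proof -
      have "(\<Sum>i\<in>I. c' i * a i w) = k * a i0 w + (\<Sum>i\<in>J. c' i * a i w)"
        using J by (simp add: c'_def)
      also have "(\<Sum>i\<in>J. c' i * a i w) = (\<Sum>i\<in>J. c i * a i w)"
        using J(3) by (intro sum.cong) (auto simp: c'_def)
      also have "k * a i0 w + \<dots> = (\<Sum>i\<in>J. c i * b i w)"
        by (simp add: k_def b_def sum_distrib_right right_diff_distrib sum_subtractf mult.assoc)
      finally show ?thesis .
    qed
    have "(\<Sum>i\<in>J. c i * b i z) = 0" using i0(2) by (simp add: b_def)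
    with c(2) sum have "\<forall>w\<in>insert z Z. (\<Sum>i\<in>I. c' i * a i w) = 0" by simp
    moreover have "\<exists>i\<in>I. c' i \<noteq> 0" using c(1) J by (auto simp: c'_def)
    ultimately show ?thesis by blast
  qed
qed

text \<open>Pairwise mutual singularity.\<close>

definition separated :: "circle measure set \<Rightarrow> bool" where
  "separated S \<longleftrightarrow> (\<forall>\<mu>\<in>S. \<forall>\<mu>'\<in>S. \<mu> \<noteq> \<mu>' \<longrightarrow> (\<exists>A\<in>sets borel. measure \<mu> A = 1 \<and> measure \<mu>' A = 0))"

text \<open>The intersection of the finitely many separating sets has full mass for one measure and
  none for the others, which isolates its coefficient.\<close>

lemma separated_independent:
  assumes S: "separated S" "finite S" "\<And>\<mu>. \<mu> \<in> S \<Longrightarrow> prob_space \<mu> \<and> sets \<mu> = sets borel"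
    and zero: "\<And>A. A \<in> sets borel \<Longrightarrow> (\<Sum>\<mu>\<in>S. c \<mu> * measure \<mu> A) = 0" and "\<mu> \<in> S"
  shows "c \<mu> = 0"
proof -
  interpret prob_space \<mu> using S(3)[OF \<open>\<mu> \<in> S\<close>] by simp
  have sets: "sets \<mu> = sets borel" using S(3)[OF \<open>\<mu> \<in> S\<close>] by simp
  obtain A where A: "\<And>\<mu>'. \<mu>' \<in> S - {\<mu>} \<Longrightarrow> A \<mu>' \<in> sets borel \<and> measure \<mu> (A \<mu>') = 1 \<and> measure \<mu>' (A \<mu>') = 0"
    using S(1) \<open>\<mu> \<in> S\<close> unfolding separated_def by (metis DiffE insertI1)
  define E where "E = {x. \<forall>\<mu>'\<in>S - {\<mu>}. x \<in> A \<mu>'}"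
  have E: "E \<in> sets borel"
  proof -
    have "E = UNIV - (\<Union>\<mu>'\<in>S - {\<mu>}. UNIV - A \<mu>')" by (auto simp: E_def)
    moreover have "(\<Union>\<mu>'\<in>S - {\<mu>}. UNIV - A \<mu>') \<in> sets borel"
      using A S(2) by (intro sets.finite_UN) auto
    ultimately show ?thesis by auto
  qed
  have "AE x in \<mu>. x \<in> A \<mu>'" if "\<mu>' \<in> S - {\<mu>}" for \<mu>'
    using A[OF that] by (intro AE_prob_1) auto
  then have "AE x in \<mu>. \<forall>\<mu>'\<in>S - {\<mu>}. x \<in> A \<mu>'"
    using S(2) by (subst AE_finite_all) auto
  then have "AE x in \<mu>. x \<in> E" by (simp add: E_def)
  then have one: "measure \<mu> E = 1" using E sets by (subst prob_eq_1) auto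
  have null: "measure \<mu>' E = 0" if "\<mu>' \<in> S - {\<mu>}" for \<mu>'
  proof -
    have "measure \<mu>' E \<le> measure \<mu>' (A \<mu>')"
      using A[OF that] S(3)[of \<mu>'] that
      by (intro finite_measure.finite_measure_mono) (auto simp: E_def prob_space.finite_measure)
    then show ?thesis using A[OF that] by (simp add: measure_le_0_iff)
  qed
  have "(\<Sum>\<mu>'\<in>S. c \<mu>' * measure \<mu>' E) = c \<mu> * measure \<mu> E + (\<Sum>\<mu>'\<in>S - {\<mu>}. c \<mu>' * measure \<mu>' E)"
    using S(2) \<open>\<mu> \<in> S\<close> by (rule sum.remove)
  then show ?thesis using zero[OF E] one null by simp
qed

context random_homeo
begin

lemma inverse_stationaryD:
  assumes "markov_stationary (inverse_measure \<nu>) \<mu>"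
  shows "prob_space \<mu>" "sets \<mu> = sets borel" "space \<mu> = UNIV" "finite_measure \<mu>"
  using random_homeo.markov_stationaryD[OF random_homeo_inverse assms] by auto

text \<open>A nontrivial combination of the harmonic functions attached to a separated family cannot
  vanish identically, but it does so as soon as it vanishes at one point of each minimal set. The
  second hypothesis makes its values on the minimal sets be those on \<open>Z\<close>. When all maps preserve
  orientation the constant function is one more harmonic function.\<close>

lemma card_separated_le:
  assumes S: "finite S" "separated S" "\<And>\<mu>. \<mu> \<in> S \<Longrightarrow> markov_stationary (inverse_measure \<nu>) \<mu>"
    and "finite Z"
    and Z: "\<And>N. N \<in> minimal_sets F \<Longrightarrow> \<exists>s t. s \<le> t \<and> t \<le> s + 2 * pi \<and>
      circle_cis s \<in> N \<and> circle_cis t \<in> Z \<and> (\<forall>\<mu>\<in>S. \<forall>\<mu>'\<in>S.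
        measure \<mu> (circle_cis ` {s..t}) = measure \<mu>' (circle_cis ` {s..t}))"
  shows "card S \<le> Suc (card Z)"
    and "F \<subseteq> orientation_preserving_homeos \<Longrightarrow> card S \<le> card Z"
proof -
  have *: "card S \<le> Suc (card Z) \<and> (F \<subseteq> orientation_preserving_homeos \<longrightarrow> card S \<le> card Z)"
  proof (cases "S = {}")
    case False
    then obtain \<mu>0 where \<mu>0: "\<mu>0 \<in> S" by blast
    define I where "I = S - {\<mu>0}"
    have I: "finite I" "S = insert \<mu>0 I" "\<mu>0 \<notin> I" "card S = Suc (card I)"
      using S(1) \<mu>0 card.remove[OF S(1) \<mu>0] by (auto simp: I_def)
    have "\<forall>\<mu>\<in>S. \<exists>f. twisted_harmonic f \<and> (\<forall>s t. s \<le> t \<longrightarrow> t \<le> s + 2 * pi \<longrightarrow>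
        f (circle_cis t) - f (circle_cis s) =
        measure \<mu> (circle_cis ` {s..t}) - measure \<mu>0 (circle_cis ` {s..t}))"
      using twisted_harmonic_of_stationary S(3) \<mu>0 by simp
    then obtain f where f: "\<And>\<mu>. \<mu> \<in> S \<Longrightarrow> twisted_harmonic (f \<mu>)"
      and arc: "\<And>\<mu> s t. \<mu> \<in> S \<Longrightarrow> s \<le> t \<Longrightarrow> t \<le> s + 2 * pi \<Longrightarrow>
        f \<mu> (circle_cis t) - f \<mu> (circle_cis s) =
        measure \<mu> (circle_cis ` {s..t}) - measure \<mu>0 (circle_cis ` {s..t})"
      by metis
    \<comment> \<open>The reference measure \<mu>0 has zero increments against itself, so its slot
      is free to hold the constant 1. The family is indexed by \<open>I\<close> in general, and by
      all of \<open>S\<close> once the constant is known to be harmonic.\<close>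
    define f' where "f' \<mu> = (if \<mu> = \<mu>0 then (\<lambda>_. 1) else f \<mu>)" for \<mu>
    have f'_arc: "f' \<mu> (circle_cis t) - f' \<mu> (circle_cis s) =
        measure \<mu> (circle_cis ` {s..t}) - measure \<mu>0 (circle_cis ` {s..t})"
      if "\<mu> \<in> S" "s \<le> t" "t \<le> s + 2 * pi" for \<mu> s t
      using arc[OF that] by (simp add: f'_def)
    have main: "card J \<le> card Z"
      if J: "I \<subseteq> J" "J \<subseteq> S" and tw: "\<And>\<mu>. \<mu> \<in> J \<Longrightarrow> twisted_harmonic (f' \<mu>)" for J
    proof (rule ccontr)
      have finJ: "finite J" using J(2) S(1) finite_subset by blast
      assume "\<not> card J \<le> card Z"
      then obtain c where c: "\<exists>\<mu>\<in>J. c \<mu> \<noteq> 0" "\<forall>z\<in>Z. (\<Sum>\<mu>\<in>J. c \<mu> * f' \<mu> z) = 0"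
        using linear_dependence_on_finite_set[OF \<open>finite Z\<close> finJ, of f'] by auto
      have fZ: "(\<Sum>\<mu>\<in>J. c \<mu> * f' \<mu> x) = 0" for x
      proof (rule twisted_harmonic_eq_zero)
        show "twisted_harmonic (\<lambda>x. \<Sum>\<mu>\<in>J. c \<mu> * f' \<mu> x)" by (rule twisted_harmonic_sum[OF tw])
        fix N assume "N \<in> minimal_sets F"
        from Z[OF this] obtain s t where st: "s \<le> t" "t \<le> s + 2 * pi" "circle_cis s \<in> N" "circle_cis t \<in> Z"
          and eq: "\<And>\<mu>. \<mu> \<in> S \<Longrightarrow> measure \<mu> (circle_cis ` {s..t}) = measure \<mu>0 (circle_cis ` {s..t})"
          using \<mu>0 by metis
        have "f' \<mu> (circle_cis s) = f' \<mu> (circle_cis t)" if "\<mu> \<in> J" for \<mu>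
          using f'_arc[of \<mu> s t] eq[of \<mu>] st that J by auto
        then have "(\<Sum>\<mu>\<in>J. c \<mu> * f' \<mu> (circle_cis s)) = (\<Sum>\<mu>\<in>J. c \<mu> * f' \<mu> (circle_cis t))"
          by (intro sum.cong) auto
        with c(2) st show "\<exists>y\<in>N. (\<Sum>\<mu>\<in>J. c \<mu> * f' \<mu> y) = 0" by auto
      qed
      \<comment> \<open>Rewrites a combination of differences with \<mu>0 as a combination of the
        measures themselves, with coefficients summing to 0.\<close>
      define c' where "c' \<mu> = (if \<mu> = \<mu>0 then - (\<Sum>\<mu>\<in>I. c \<mu>) else c \<mu>)" for \<mu>
      have c'_sum: "(\<Sum>\<mu>\<in>S. c' \<mu> * x \<mu>) = (\<Sum>\<mu>\<in>I. c \<mu> * (x \<mu> - x \<mu>0))" for x :: "_ \<Rightarrow> real"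
      proof -
        have "(\<Sum>\<mu>\<in>S. c' \<mu> * x \<mu>) = c' \<mu>0 * x \<mu>0 + (\<Sum>\<mu>\<in>I. c' \<mu> * x \<mu>)"
          using I by simp
        also have "(\<Sum>\<mu>\<in>I. c' \<mu> * x \<mu>) = (\<Sum>\<mu>\<in>I. c \<mu> * x \<mu>)"
          using I(3) by (intro sum.cong) (auto simp: c'_def)
        finally show ?thesis
          by (simp add: c'_def right_diff_distrib sum_subtractf sum_distrib_right)
      qed
      have comb0: "(\<Sum>\<mu>\<in>S. c' \<mu> * measure \<mu> A) = 0" if "A \<in> sets borel" for A
      proof (rule circle_arcs_determine_combination[OF _ _ _ _ that])
        show "(\<Sum>\<mu>\<in>S. c' \<mu>) = 0" using c'_sum[of "\<lambda>_. 1"] by simp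
        fix t :: real assume t: "0 \<le> t" "t < 2 * pi"
        have "(\<Sum>\<mu>\<in>S. c' \<mu> * measure \<mu> (circle_cis ` {0..t})) =
            (\<Sum>\<mu>\<in>I. c \<mu> * (f' \<mu> (circle_cis t) - f' \<mu> (circle_cis 0)))"
          unfolding c'_sum using f'_arc[of _ 0 t] t I by (intro sum.cong) auto
        also have "\<dots> = (\<Sum>\<mu>\<in>J. c \<mu> * (f' \<mu> (circle_cis t) - f' \<mu> (circle_cis 0)))"
          using finJ J I by (intro sum.mono_neutral_left) (auto simp: f'_def)
        also have "\<dots> = 0" by (simp add: right_diff_distrib sum_subtractf fZ)
        finally show "(\<Sum>\<mu>\<in>S. c' \<mu> * measure \<mu> (circle_cis ` {0..t})) = 0" .
      qed (use inverse_stationaryD S(3) in auto)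
      have c'0: "c' \<mu> = 0" if "\<mu> \<in> S" for \<mu>
        by (rule separated_independent[OF S(2,1) _ comb0 that])
          (use inverse_stationaryD[OF S(3)] in auto)
      then have cI: "c \<mu> = 0" if "\<mu> \<in> I" for \<mu>
      proof -
        have "\<mu> \<in> S" "\<mu> \<noteq> \<mu>0" using that I by auto
        with c'0[of \<mu>] show ?thesis by (simp add: c'_def)
      qed
      \<comment> \<open>Only the coefficient of the constant function can survive, and the vanishing
        of the sum at a single point removes it.\<close>
      with c(1) J I obtain "\<mu>0 \<in> J" "c \<mu>0 \<noteq> 0" by blast
      have "J = insert \<mu>0 I" using J I \<open>\<mu>0 \<in> J\<close> by auto
      then have "(\<Sum>\<mu>\<in>J. c \<mu> * f' \<mu> (circle_cis 0)) = c \<mu>0"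
        using I cI by (simp add: f'_def)
      with fZ \<open>c \<mu>0 \<noteq> 0\<close> show False by simp
    qed
    have "card I \<le> card Z"
      using I f by (intro main) (auto simp: f'_def)
    moreover have "card S \<le> card Z" if op: "F \<subseteq> orientation_preserving_homeos"
    proof (rule main)
      have AE1: "AE g in \<nu>. orientation_sign g = 1"
        using AE_in_F by eventually_elim (use op orientation_preserving_iff in auto)
      have "(\<integral>g. orientation_sign g \<partial>\<nu>) = (\<integral>g. 1 \<partial>\<nu>)"
        by (rule integral_cong_AE) (use AE1 in auto)
      then have "twisted_harmonic (\<lambda>_. 1)"
        by (simp add: twisted_harmonic_def \<nu>.prob_space)
      then show "twisted_harmonic (f' \<mu>)" if "\<mu> \<in> S" for \<mu>
        using f[OF that] by (simp add: f'_def)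
    qed (use I in auto)
    ultimately show ?thesis using I by simp
  qed simp
  show "card S \<le> Suc (card Z)" and "F \<subseteq> orientation_preserving_homeos \<Longrightarrow> card S \<le> card Z"
    using * by auto
qed

section \<open>Evaluation points: chosen in minimal sets, or on a grid\<close>

lemma inverse_inverse: "inverse_family (inverse_family F) = F" "inverse_measure (inverse_measure \<nu>) = \<nu>"
proof -
  show "inverse_family (inverse_family F) = F"
    by (simp add: inverse_family_def image_image)
  have "inverse_measure (inverse_measure \<nu>) = distr \<nu> borel (\<lambda>g. g)"
    unfolding inverse_measure_def by (subst distr_distr) (auto simp: o_def)
  then show "inverse_measure (inverse_measure \<nu>) = \<nu>"
    using sets_\<nu> by (simp add: distr_id2)
qed

text \<open>With one evaluation point chosen in each minimal set, the connecting arcs shrink to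
  single points, which are null for every measure involved.\<close>

lemma card_separated_le_minimal_sets:
  assumes S: "finite S" "separated S" "\<And>\<mu>. \<mu> \<in> S \<Longrightarrow> markov_stationary (inverse_measure \<nu>) \<mu>"
    and fin: "finite (minimal_sets F)"
  shows "card S \<le> Suc (card (minimal_sets F))"
    and "F \<subseteq> orientation_preserving_homeos \<Longrightarrow> card S \<le> card (minimal_sets F)"
proof -
  define y where "y N = (SOME x :: circle. x \<in> N)" for N
  have y: "y N \<in> N" if "N \<in> minimal_sets F" for N
    using minimal_setsD(3)[OF that] unfolding y_def by (simp add: some_in_eq)
  have Z: "finite (y ` minimal_sets F)" "card (y ` minimal_sets F) \<le> card (minimal_sets F)"
    using fin by (auto intro: card_image_le)
  have zero: "measure \<mu> {x} = 0" if "\<mu> \<in> S" for \<mu> x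
    using random_homeo.markov_stationary_atomless[OF random_homeo_inverse S(3)[OF that]] .
  have cov: "\<exists>s t. s \<le> t \<and> t \<le> s + 2 * pi \<and>
      circle_cis s \<in> N \<and> circle_cis t \<in> y ` minimal_sets F \<and> (\<forall>\<mu>\<in>S. \<forall>\<mu>'\<in>S.
        measure \<mu> (circle_cis ` {s..t}) = measure \<mu>' (circle_cis ` {s..t}))"
    if "N \<in> minimal_sets F" for N
    using y[OF that] that zero
    by (intro exI[of _ "circle_angle (y N)"]) auto
  show "card S \<le> Suc (card (minimal_sets F))"
    using card_separated_le(1)[OF S Z(1) cov] Z(2) by simp
  show "card S \<le> card (minimal_sets F)" if "F \<subseteq> orientation_preserving_homeos"
    using card_separated_le(2)[OF S Z(1) cov that] Z(2) by simp
qed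

text \<open>Fix two minimal sets of the inverse system, at distance at least \<open>\<delta>\<close>. An arc shorter than
  \<open>\<delta>\<close> misses one of them, so if the harmonic functions agree at its endpoints then it is null for
  all stationary measures of the inverse system. Every minimal set \<open>N\<close> of the system itself is
  covered by a bounded number of such flat arcs, hence one of them has a definite mass for a
  stationary measure living on \<open>N\<close>, therefore a definite length, and contains a grid point. Since
  the grid does not depend on \<open>N\<close>, the number of stationary measures is bounded.\<close>

lemma flat_arc_meets_grid:
  assumes S: "finite S" "\<And>\<mu>. \<mu> \<in> S \<Longrightarrow> markov_stationary (inverse_measure \<nu>) \<mu>"
    and \<mu>01: "\<mu>0 \<in> S" "\<mu>1 \<in> S" "measure \<mu>0 M0 = 1" "measure \<mu>1 M1 = 1" "closed M0" "closed M1"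
    and \<delta>: "\<And>x y. x \<in> M0 \<Longrightarrow> y \<in> M1 \<Longrightarrow> \<delta> \<le> dist x y"
    and B: "B > 0" "2 * pi / real B < \<delta>"
    and \<eta>: "\<eta> > 0" "\<And>\<mu> x. markov_stationary \<nu> \<mu> \<Longrightarrow> measure \<mu> (cball x \<eta>) < 1 / (2 * real B)"
    and N: "N \<in> minimal_sets F"
  shows "\<exists>s t. s \<le> t \<and> t \<le> s + 2 * pi \<and> circle_cis s \<in> N \<and>
    circle_cis t \<in> (\<lambda>j. circle_cis (\<eta> * real j)) ` {..nat \<lceil>2 * pi / \<eta>\<rceil>} \<and>
    (\<forall>\<mu>\<in>S. \<forall>\<mu>'\<in>S. measure \<mu> (circle_cis ` {s..t}) = measure \<mu>' (circle_cis ` {s..t}))"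
proof -
  have "\<forall>\<mu>\<in>S. \<exists>f. twisted_harmonic f \<and> (\<forall>s t. s \<le> t \<longrightarrow> t \<le> s + 2 * pi \<longrightarrow>
      f (circle_cis t) - f (circle_cis s) =
      measure \<mu> (circle_cis ` {s..t}) - measure \<mu>0 (circle_cis ` {s..t}))"
    using twisted_harmonic_of_stationary S(2) \<mu>01(1) by simp
  then obtain f where f: "\<And>\<mu>. \<mu> \<in> S \<Longrightarrow> twisted_harmonic (f \<mu>)"
    and arc: "\<And>\<mu> s t. \<mu> \<in> S \<Longrightarrow> s \<le> t \<Longrightarrow> t \<le> s + 2 * pi \<Longrightarrow>
      f \<mu> (circle_cis t) - f \<mu> (circle_cis s) =
      measure \<mu> (circle_cis ` {s..t}) - measure \<mu>0 (circle_cis ` {s..t})"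
    by metis
  obtain m where m: "markov_stationary \<nu> m" "measure m N = 1"
    using markov_stationary_exists[OF minimal_setsD(1)[OF N]] by blast
  interpret m: prob_space m using markov_stationaryD(1)[OF m(1)] .
  have sets_m: "sets m = sets borel" using markov_stationaryD(2)[OF m(1)] .
  obtain x0 where x0: "x0 \<in> N" using minimal_setsD(3)[OF N] by blast
  \<comment> \<open>A cell: the parameters in the \<open>j\<close>-th of \<open>B\<close> equal
    intervals whose points lie in \<open>N\<close> and carry the common sign \<sigma>. The
    2\<open>B\<close> cells cover \<open>N\<close>, whence the mass 1/(2\<open>B\<close>).\<close>
  define T :: "nat \<times> real \<Rightarrow> real set" where "T = (\<lambda>(j, \<sigma>). {2 * pi * real j / real B..2 * pi * real (Suc j) / real B} \<inter>
      (circle_cis -` N \<inter> (\<Inter>\<mu>\<in>S. (\<lambda>t. f \<mu> (circle_cis t)) -` {\<sigma> * f \<mu> x0})))"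
  have compact_T: "compact (T p)" for p
  proof -
    obtain j \<sigma> where p: "p = (j, \<sigma>)" by (cases p)
    have "closed (circle_cis -` N)"
      using continuous_on_circle_cis[of UNIV] minimal_setsD(2)[OF N] by (simp add: continuous_on_closed_vimage)
    moreover have "closed ((\<lambda>t. f \<mu> (circle_cis t)) -` {a})" if "\<mu> \<in> S" for \<mu> a
      using continuous_on_compose2[OF twisted_harmonic_continuous[OF f[OF that]] continuous_on_circle_cis[of UNIV]]
      by (simp add: continuous_on_closed_vimage)
    ultimately show ?thesis
      unfolding T_def p by (auto intro!: compact_Int_closed closed_Int closed_INT)
  qed
  have compact_cT: "compact (circle_cis ` T p)" for p
    by (intro compact_continuous_image continuous_on_circle_cis compact_T)
  then have sets_cT: "circle_cis ` T p \<in> sets m" for p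
    by (simp add: sets_m compact_imp_closed)
  define P where "P = {..<B} \<times> {1, - 1 :: real}"
  have P: "finite P" "card P = 2 * B" "P \<noteq> {}"
    using B(1) by (auto simp: P_def card_cartesian_product)
  have cover: "N \<subseteq> (\<Union>p\<in>P. circle_cis ` T p)"
  proof
    fix x assume x: "x \<in> N"
    obtain \<sigma> :: real where \<sigma>: "\<sigma> \<in> {1, - 1}" "\<And>\<mu>. \<mu> \<in> S \<Longrightarrow> f \<mu> x = \<sigma> * f \<mu> x0"
      using twisted_harmonic_family_on_minimal[OF f S(1) N x0 x] by force
    define j where "j = nat \<lfloor>circle_angle x * B / (2 * pi)\<rfloor>"
    have j: "real j = of_int \<lfloor>circle_angle x * B / (2 * pi)\<rfloor>"
      using circle_angle_bounds[of x] by (simp add: j_def)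
    have "circle_angle x * B / (2 * pi) < B"
      using circle_angle_bounds[of x] B(1) by (simp add: field_simps)
    then have "real j < real B" unfolding j by linarith
    moreover have "real j \<le> circle_angle x * B / (2 * pi)" "circle_angle x * B / (2 * pi) < real j + 1"
      unfolding j by linarith+
    then have "circle_angle x \<in> {2 * pi * j / B..2 * pi * Suc j / B}"
      using B(1) by (simp add: field_simps)
    then have "circle_angle x \<in> T (j, \<sigma>)"
      using x \<sigma>(2) by (simp add: T_def)
    then have "x \<in> circle_cis ` T (j, \<sigma>)" by (metis circle_cis_angle image_eqI)
    moreover have "(j, \<sigma>) \<in> P" using \<open>real j < real B\<close> \<sigma>(1) by (simp add: P_def)
    ultimately show "x \<in> (\<Union>p\<in>P. circle_cis ` T p)" by blast
  qed
  have "\<exists>p\<in>P. 1 / (2 * real B) \<le> measure m (circle_cis ` T p)"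
  proof (rule ccontr)
    assume "\<not> ?thesis"
    then have "(\<Sum>p\<in>P. measure m (circle_cis ` T p)) < (\<Sum>p\<in>P. 1 / (2 * real B))"
      using P by (intro sum_strict_mono) auto
    also have "\<dots> = 1" using P(2) B(1) by simp
    finally have "(\<Sum>p\<in>P. measure m (circle_cis ` T p)) < 1" .
    moreover have "measure m N \<le> measure m (\<Union>p\<in>P. circle_cis ` T p)"
      using cover sets_cT P(1) by (intro m.finite_measure_mono) auto
    moreover have "measure m (\<Union>p\<in>P. circle_cis ` T p) \<le> (\<Sum>p\<in>P. measure m (circle_cis ` T p))"
      using sets_cT P(1) by (intro m.finite_measure_subadditive_finite) auto
    ultimately show False using m(2) by simp
  qed
  then obtain p where p: "1 / (2 * real B) \<le> measure m (circle_cis ` T p)" "p \<in> P" by blast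
  then obtain j \<sigma> where p_eq: "p = (j, \<sigma>)" and "j < B" by (auto simp: P_def)
  have "T p \<noteq> {}"
  proof
    assume "T p = {}"
    with p(1) B(1) show False by (simp add: divide_le_0_iff)
  qed
  \<comment> \<open>The extreme parameters of the heavy cell: both endpoints lie in \<open>N\<close>
    and carry the same sign, so all the functions agree there, while the arc between them contains
    the cell.\<close>
  obtain a where a: "a \<in> T p" "\<And>t. t \<in> T p \<Longrightarrow> a \<le> t"
    using compact_attains_inf[OF compact_T \<open>T p \<noteq> {}\<close>] by blast
  obtain b where b: "b \<in> T p" "\<And>t. t \<in> T p \<Longrightarrow> t \<le> b"
    using compact_attains_sup[OF compact_T \<open>T p \<noteq> {}\<close>] by blast
  have "a \<le> b" using a b by blast
  have ab: "2 * pi * real j / real B \<le> a" "b \<le> 2 * pi * real (Suc j) / real B"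
    using a(1) b(1) by (auto simp: T_def p_eq)
  have "b - a \<le> 2 * pi * real (Suc j) / real B - 2 * pi * real j / real B" using ab by linarith
  also have "\<dots> = 2 * pi / real B" by (simp add: diff_divide_distrib[symmetric] algebra_simps)
  finally have ba: "b - a \<le> 2 * pi / real B" .
  also have "\<dots> \<le> 2 * pi" using B(1) by (simp add: field_simps)
  finally have ba': "b - a \<le> 2 * pi" .
  have "a \<ge> 0" using order_trans[OF _ ab(1), of 0] by simp
  have "real (Suc j) \<le> real B" using \<open>j < B\<close> by simp
  then have "2 * pi * real (Suc j) / real B \<le> 2 * pi * real B / real B"
    by (intro divide_right_mono mult_left_mono) auto
  also have "\<dots> = 2 * pi" using B(1) by simp
  finally have "2 * pi * real (Suc j) / real B \<le> 2 * pi" .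
  then have "b \<le> 2 * pi" using ab(2) by linarith
  have inS: "circle_cis a \<in> N" "f \<mu> (circle_cis a) = f \<mu> (circle_cis b)" if "\<mu> \<in> S" for \<mu>
    using a(1) b(1) that by (auto simp: T_def p_eq)
  have flat: "measure \<mu> (circle_cis ` {a..b}) = measure \<mu>0 (circle_cis ` {a..b})" if "\<mu> \<in> S" for \<mu>
    using arc[OF that \<open>a \<le> b\<close>] ba' inS(2)[OF that] by simp
  have null_if: "measure \<mu> A = 0" if "\<mu> \<in> S" "measure \<mu> M = 1" "closed M" "A \<inter> M = {}" "A \<in> sets borel" for \<mu> A M
  proof -
    interpret \<mu>: prob_space \<mu> using inverse_stationaryD(1)[OF S(2)[OF that(1)]] .
    have "sets \<mu> = sets borel" using inverse_stationaryD(2)[OF S(2)[OF that(1)]] .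
    then have "measure \<mu> (A \<union> M) = measure \<mu> A + measure \<mu> M"
      using that by (intro \<mu>.finite_measure_Union) auto
    with \<mu>.prob_le_1[of "A \<union> M"] measure_nonneg[of \<mu> A] that(2) show ?thesis by linarith
  qed
  \<comment> \<open>The arc is shorter than \<delta>, so it cannot meet both sets. Being null for
    one of the two measures, it is null for all, because all give it equal mass.\<close>
  have "circle_cis ` {a..b} \<inter> M0 = {} \<or> circle_cis ` {a..b} \<inter> M1 = {}"
  proof (rule ccontr)
    assume "\<not> ?thesis"
    then obtain t u where tu: "t \<in> {a..b}" "u \<in> {a..b}" "circle_cis t \<in> M0" "circle_cis u \<in> M1" by blast
    then have "\<delta> \<le> \<bar>t - u\<bar>" using \<delta>[OF tu(3,4)] dist_circle_cis_le[of t u] by linarith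
    also have "\<dots> \<le> b - a" using tu by auto
    finally show False using ba B(2) by linarith
  qed
  then have "measure \<mu>0 (circle_cis ` {a..b}) = 0"
  proof
    assume "circle_cis ` {a..b} \<inter> M0 = {}"
    then show ?thesis using null_if[OF \<mu>01(1,3,5)] by simp
  next
    assume "circle_cis ` {a..b} \<inter> M1 = {}"
    then have "measure \<mu>1 (circle_cis ` {a..b}) = 0" using null_if[OF \<mu>01(2,4,6)] by simp
    then show ?thesis using flat[OF \<mu>01(2)] by simp
  qed
  with flat have null: "measure \<mu> (circle_cis ` {a..b}) = 0" if "\<mu> \<in> S" for \<mu> using that by simp
  \<comment> \<open>Otherwise the whole cell would fit into a ball of radius \<eta>, which has too
    little mass.\<close>
  have "\<eta> < b - a"
  proof (rule ccontr)
    assume "\<not> \<eta> < b - a"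
    have "circle_cis ` T p \<subseteq> cball (circle_cis a) \<eta>"
    proof
      fix x assume "x \<in> circle_cis ` T p"
      then obtain t where t: "t \<in> T p" "x = circle_cis t" by blast
      have "dist (circle_cis a) (circle_cis t) \<le> \<bar>a - t\<bar>" by (rule dist_circle_cis_le)
      also have "\<dots> \<le> \<eta>" using a(2)[OF t(1)] b(2)[OF t(1)] \<open>\<not> \<eta> < b - a\<close> by linarith
      finally show "x \<in> cball (circle_cis a) \<eta>" by (simp add: t)
    qed
    then have "measure m (circle_cis ` T p) \<le> measure m (cball (circle_cis a) \<eta>)"
      by (intro m.finite_measure_mono) (auto simp: sets_m)
    with p(1) \<eta>(2)[OF m(1), of "circle_cis a"] show False by linarith
  qed
  \<comment> \<open>The first grid index with \<eta> * i at or beyond \<open>a\<close>; as the arc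
    is longer than \<eta>, this grid point is not beyond \<open>b\<close>.\<close>
  define i where "i = nat \<lceil>a / \<eta>\<rceil>"
  have i: "real i = of_int \<lceil>a / \<eta>\<rceil>" using \<open>a \<ge> 0\<close> \<eta>(1) by (simp add: i_def)
  have "a / \<eta> \<le> real i" "real i < a / \<eta> + 1" unfolding i by linarith+
  then have ai: "a \<le> \<eta> * real i" "\<eta> * real i \<le> b"
    using \<eta>(1) \<open>\<eta> < b - a\<close> by (auto simp: field_simps)
  have "i \<le> nat \<lceil>2 * pi / \<eta>\<rceil>"
  proof -
    have "a / \<eta> \<le> 2 * pi / \<eta>"
      using \<open>a \<le> b\<close> \<open>b \<le> 2 * pi\<close> \<eta>(1) by (intro divide_right_mono) auto
    then show ?thesis unfolding i_def by (intro nat_mono ceiling_mono)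
  qed
  moreover have "measure \<mu> (circle_cis ` {a..\<eta> * real i}) = 0" if "\<mu> \<in> S" for \<mu>
  proof -
    have "measure \<mu> (circle_cis ` {a..\<eta> * real i}) \<le> measure \<mu> (circle_cis ` {a..b})"
      using ai(2) inverse_stationaryD[OF S(2)[OF that]]
      by (intro finite_measure.finite_measure_mono image_mono) auto
    then show ?thesis using null[OF that] by (simp add: measure_le_0_iff)
  qed
  ultimately show ?thesis
    using ai ba' inS(1)[OF \<mu>01(1)]
    by (intro exI[of _ a] exI[of _ "\<eta> * real i"]) auto
qed

text \<open>Infinitely many minimal sets would carry arbitrarily large separated families of
  stationary measures, against a bound from a grid fixed beforehand by the distance of just two of
  the sets.\<close>

lemma finite_minimal_sets_inverse: "finite (minimal_sets (inverse_family F))"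
proof (rule ccontr)
  let ?\<M> = "minimal_sets (inverse_family F)"
  assume inf: "infinite ?\<M>"
  obtain M0 where M0: "M0 \<in> ?\<M>" using inf by (metis finite.emptyI ex_in_conv)
  obtain M1 where M1: "M1 \<in> ?\<M>" "M1 \<noteq> M0"
    using inf by (metis finite.emptyI finite_insert finite_subset insert_iff subsetI)
  have "\<forall>M\<in>?\<M>. \<exists>\<mu>. markov_stationary (inverse_measure \<nu>) \<mu> \<and> measure \<mu> M = 1"
    using random_homeo.markov_stationary_exists[OF random_homeo_inverse] minimal_setsD(1) by blast
  then obtain \<mu> where \<mu>: "\<And>M. M \<in> ?\<M> \<Longrightarrow> markov_stationary (inverse_measure \<nu>) (\<mu> M)"
    "\<And>M. M \<in> ?\<M> \<Longrightarrow> measure (\<mu> M) M = 1" by metis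
  obtain \<delta> where \<delta>: "\<delta> > 0" "\<And>x y. x \<in> M0 \<Longrightarrow> y \<in> M1 \<Longrightarrow> \<delta> \<le> dist x y"
    using separate_compact_closed[of M0 M1] minimal_sets_disjoint[OF M0 M1(1)] M1(2)
      closed_circle_imp_compact[OF minimal_setsD(2)[OF M0]] minimal_setsD(2)[OF M1(1)] by auto
  obtain B :: nat where B: "2 * pi / \<delta> < real B" using reals_Archimedean2 by blast
  have "0 < 2 * pi / \<delta>" using \<delta>(1) by simp
  with B have "B > 0" by (metis gr0I of_nat_0 order_less_asym)
  with B \<delta>(1) have B': "2 * pi / real B < \<delta>" by (simp add: field_simps)
  have "1 / (2 * real B) > 0" using \<open>B > 0\<close> by simp
  from uniformly_small_cballs[OF this] obtain \<eta> where \<eta>: "\<eta> > 0"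
    "\<And>\<mu> x. markov_stationary \<nu> \<mu> \<Longrightarrow> measure \<mu> (cball x \<eta>) < 1 / (2 * real B)" by blast
  define Z where "Z = (\<lambda>j. circle_cis (\<eta> * real j)) ` {..nat \<lceil>2 * pi / \<eta>\<rceil>}"
  have "finite Z" by (simp add: Z_def)
  obtain \<N> where \<N>: "\<N> \<subseteq> ?\<M>" "finite \<N>" "card \<N> = card Z + 2"
    using infinite_arbitrarily_large[OF inf] by blast
  \<comment> \<open>The measures on \<open>M0\<close> and \<open>M1\<close> must belong to the
    family for the flat arcs to be null; with at least \<open>card Z + 2\<close> members the family
    exceeds the bound \<open>Suc (card Z)\<close>.\<close>
  define \<N>' where "\<N>' = insert M0 (insert M1 \<N>)"
  have \<N>': "\<N>' \<subseteq> ?\<M>" "finite \<N>'" "card \<N>' \<ge> card Z + 2"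
    using \<N> M0 M1 card_mono[of \<N>' \<N>] by (auto simp: \<N>'_def)
  have null: "measure (\<mu> M) M' = 0" if "M \<in> ?\<M>" "M' \<in> ?\<M>" "M \<noteq> M'" for M M'
  proof -
    interpret p: prob_space "\<mu> M" using inverse_stationaryD(1)[OF \<mu>(1)[OF that(1)]] .
    have "sets (\<mu> M) = sets borel" using inverse_stationaryD(2)[OF \<mu>(1)[OF that(1)]] .
    then have "measure (\<mu> M) (M \<union> M') = measure (\<mu> M) M + measure (\<mu> M) M'"
      using minimal_sets_disjoint[OF that] minimal_setsD(2) that by (intro p.finite_measure_Union) auto
    with p.prob_le_1[of "M \<union> M'"] measure_nonneg[of "\<mu> M" M'] \<mu>(2)[OF that(1)] show ?thesis by linarith
  qed
  have inj: "inj_on \<mu> \<N>'"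
  proof (rule inj_onI, rule ccontr)
    fix M M' assume "M \<in> \<N>'" "M' \<in> \<N>'" "\<mu> M = \<mu> M'" "M \<noteq> M'"
    then have M: "M \<in> ?\<M>" "M' \<in> ?\<M>" using \<N>'(1) by auto
    show False using null[OF M \<open>M \<noteq> M'\<close>] \<mu>(2)[OF M(2)] \<open>\<mu> M = \<mu> M'\<close> by simp
  qed
  define S where "S = \<mu> ` \<N>'"
  have S: "finite S" "\<And>m. m \<in> S \<Longrightarrow> markov_stationary (inverse_measure \<nu>) m"
    using \<N>' \<mu>(1) by (auto simp: S_def)
  have "separated S"
    unfolding separated_def S_def
  proof (intro ballI impI)
    fix m m' assume "m \<in> \<mu> ` \<N>'" "m' \<in> \<mu> ` \<N>'" "m \<noteq> m'"
    then obtain M M' where M: "M \<in> ?\<M>" "M' \<in> ?\<M>" "m = \<mu> M" "m' = \<mu> M'" "M \<noteq> M'"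
      using \<N>'(1) by blast
    then show "\<exists>A\<in>sets borel. measure m A = 1 \<and> measure m' A = 0"
      using \<mu>(2) null[of M' M] minimal_setsD(2)[OF M(1)] by (intro bexI[of _ M]) auto
  qed
  moreover have "card S = card \<N>'" using inj by (simp add: S_def card_image)
  ultimately show False
    using card_separated_le(1)[OF S(1) _ S(2) \<open>finite Z\<close>
        flat_arc_meets_grid[OF S, of "\<mu> M0" "\<mu> M1" M0 M1 \<delta> B \<eta>, folded Z_def]]
      \<mu>(2)[OF M0] \<mu>(2)[OF M1(1)] minimal_setsD(2)[OF M0] minimal_setsD(2)[OF M1(1)]
      \<delta>(2) \<open>B > 0\<close> B' \<eta> \<N>'(3)
    by (auto simp: S_def \<N>'_def)
qed

end

section \<open>Ergodicity of the skew product\<close>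

text \<open>A Hahn decomposition of the difference of two probability measures which is strict on the
  positive part, read off from the densities with respect to their mean.\<close>

lemma strict_Hahn_decomposition:
  assumes "prob_space M" "prob_space N" and sets [measurable_cong]: "sets N = sets M"
  shows "\<exists>A\<in>sets M. (\<forall>D\<in>sets M. D \<subseteq> A \<longrightarrow> emeasure M D \<le> emeasure N D \<longrightarrow>
      emeasure M D = 0 \<and> emeasure N D = 0) \<and>
    (\<forall>D\<in>sets M. D \<inter> A = {} \<longrightarrow> emeasure M D \<le> emeasure N D)"
proof -
  interpret M: prob_space M by fact
  interpret N: prob_space N by fact
  have space: "space N = space M" using sets by (rule sets_eq_imp_space_eq)
  define K where "K b = (if b then M else N)" for b
  define R where "R = measure_pmf (bernoulli_pmf (1 / 2)) \<bind> K"
  have K: "K \<in> measure_pmf (bernoulli_pmf (1 / 2)) \<rightarrow>\<^sub>M subprob_algebra M"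
    by (auto simp: K_def space_subprob_algebra sets
        M.prob_space_axioms N.prob_space_axioms prob_space_imp_subprob_space)
  have setsR [measurable_cong]: "sets R = sets M"
    unfolding R_def by (rule sets_bind_measurable[OF K]) simp
  have spaceR: "space R = space M" using setsR by (rule sets_eq_imp_space_eq)
  have emR: "emeasure R X = emeasure M X * (1 / 2) + emeasure N X * (1 / 2)" if "X \<in> sets M" for X
  proof -
    have "emeasure R X = (\<integral>\<^sup>+b. emeasure (K b) X \<partial>measure_pmf (bernoulli_pmf (1 / 2)))"
      unfolding R_def by (rule emeasure_bind[OF _ K that]) simp
    also have "\<dots> = emeasure (K True) X * ennreal (1 / 2) + emeasure (K False) X * ennreal (1 - 1 / 2)"
      by (rule nn_integral_bernoulli_pmf) auto
    finally show ?thesis by (simp add: K_def ennreal_divide_numeral divide_ennreal[symmetric] flip: ennreal_1)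
  qed
  have "prob_space R" unfolding R_def
    by (rule measure_pmf.prob_space_bind[OF _ K])
      (simp add: K_def M.prob_space_axioms N.prob_space_axioms)
  then interpret R: prob_space R .
  have null: "emeasure R X = 0 \<longleftrightarrow> emeasure M X = 0 \<and> emeasure N X = 0" if "X \<in> sets M" for X
    by (simp add: emR[OF that])
  have "absolutely_continuous R M" "absolutely_continuous R N"
    using null by (auto simp: absolutely_continuous_def null_sets_def setsR sets)
  then obtain f g where f: "f \<in> borel_measurable R" "density R f = M"
    and g: "g \<in> borel_measurable R" "density R g = N"
    using R.Radon_Nikodym[of M] R.Radon_Nikodym[of N] setsR sets by metis
  have fm [measurable]: "f \<in> borel_measurable M" and gm [measurable]: "g \<in> borel_measurable M"
    using f(1) g(1) by (simp_all cong: measurable_cong_sets[OF setsR refl])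
  \<comment> \<open>The strict inequality of densities is what makes a subset of \<open>A\<close>
    null as soon as \<open>M\<close> does not exceed \<open>N\<close> on it.\<close>
  define A where "A = {x \<in> space M. g x < f x}"
  have "A \<in> sets M" unfolding A_def by measurable
  moreover have em: "emeasure M D = (\<integral>\<^sup>+x. f x * indicator D x \<partial>R)"
    "emeasure N D = (\<integral>\<^sup>+x. g x * indicator D x \<partial>R)" if "D \<in> sets M" for D
    using emeasure_density[OF f(1), of D] emeasure_density[OF g(1), of D] that f(2) g(2)
    by (simp_all add: setsR)
  have "emeasure M D = 0 \<and> emeasure N D = 0"
    if D: "D \<in> sets M" "D \<subseteq> A" and le: "emeasure M D \<le> emeasure N D" for D
  proof -
    note D(1)[measurable]
    define X where "X = (\<integral>\<^sup>+x. (f x - g x) * indicator D x \<partial>R)"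
    have mX: "(\<lambda>x. (f x - g x) * indicator D x) \<in> borel_measurable R"
      and mg: "(\<lambda>x. g x * indicator D x) \<in> borel_measurable R" by measurable
    have "emeasure M D = (\<integral>\<^sup>+x. (f x - g x) * indicator D x + g x * indicator D x \<partial>R)"
      unfolding em(1)[OF D(1)] using D(2)
      by (intro nn_integral_cong) (auto simp: A_def indicator_def diff_add_cancel_ennreal less_imp_le)
    also have "\<dots> = X + emeasure N D"
      unfolding X_def em(2)[OF D(1)] using mX mg by (rule nn_integral_add)
    finally have "X + emeasure N D \<le> 0 + emeasure N D" using le by simp
    then have "X = 0" using N.emeasure_finite[of D] by (metis add.commute ennreal_add_left_cancel_le le_zero_eq top.not_eq_extremum infinity_ennreal_def)
    then have "AE x in R. (f x - g x) * indicator D x = 0"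
      unfolding X_def using mX by (subst (asm) nn_integral_0_iff_AE) auto
    then have "AE x in R. x \<notin> D"
    proof eventually_elim
      case (elim x)
      show ?case
      proof
        assume "x \<in> D"
        then have "g x < f x" "f x - g x = 0" using D(2) elim by (auto simp: A_def)
        then show False by (simp add: ennreal_minus_eq_0 leD)
      qed
    qed
    then have "emeasure R D = 0"
      using D(1) sets.sets_into_space[OF D(1)] by (subst (asm) AE_iff_measurable[of D]) (auto simp: setsR spaceR)
    with null[OF D(1)] show ?thesis by simp
  qed
  moreover have "emeasure M D \<le> emeasure N D" if D: "D \<in> sets M" "D \<inter> A = {}" for D
    unfolding em[OF D(1)] using D(2) sets.sets_into_space[OF D(1)]
    by (intro nn_integral_mono) (auto simp: A_def indicator_def spaceR not_less)
  ultimately show ?thesis by blast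
qed

text \<open>Almost invariance propagates along the orbit, so visiting \<open>A\<close> infinitely
  often is almost surely the same as starting in \<open>A\<close>. The set of such points is exactly
  invariant and does not depend on the measure, so it can serve two measures at once.\<close>

lemma almost_invariant_to_invariant:
  assumes M: "prob_space M" "invariant_measure M T" and A: "A \<in> sets M"
    and AE: "AE x in M. T x \<in> A \<longleftrightarrow> x \<in> A"
  shows "AE x in M. (\<forall>n. \<exists>k\<ge>n. (T ^^ k) x \<in> A) \<longleftrightarrow> x \<in> A"
proof -
  have T: "T \<in> M \<rightarrow>\<^sub>M M" "distr M M T = M" using M(2) by (auto simp: invariant_measure_def)
  have Tk [measurable]: "T ^^ k \<in> M \<rightarrow>\<^sub>M M" for k
    using T(1) by (rule measurable_compose_n)
  have Tk_distr: "distr M M (T ^^ k) = M" for k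
  proof (induction k)
    case 0
    show ?case by (simp add: id_def distr_id)
  next
    case (Suc k)
    have "distr M M (T ^^ Suc k) = distr (distr M M (T ^^ k)) M T"
      using Tk T(1) by (simp add: distr_distr)
    then show ?case using Suc T(2) by (simp add: o_def)
  qed
  note A[measurable] T(1)[measurable]
  have "AE x in M. T ((T ^^ k) x) \<in> A \<longleftrightarrow> (T ^^ k) x \<in> A" for k
  proof -
    have "AE x in distr M M (T ^^ k). T x \<in> A \<longleftrightarrow> x \<in> A" unfolding Tk_distr by (rule AE)
    moreover have "{x \<in> space M. T x \<in> A \<longleftrightarrow> x \<in> A} \<in> sets M" by measurable
    ultimately show ?thesis using AE_distr_iff[OF Tk] by simp
  qed
  then have "AE x in M. \<forall>k. T ((T ^^ k) x) \<in> A \<longleftrightarrow> (T ^^ k) x \<in> A"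
    by (simp add: AE_all_countable)
  then show ?thesis
  proof eventually_elim
    case (elim x)
    have "(T ^^ k) x \<in> A \<longleftrightarrow> x \<in> A" for k
      by (induction k) (use elim in auto)
    then show ?case by auto
  qed
qed

text \<open>The set where the first measure strictly dominates is almost invariant for both
  measures. Replaced by an exactly invariant set, it has mass 0 or 1 for each of them, and only the
  separating combination is possible.\<close>

lemma ergodic_measures_separated:
  assumes M: "prob_space M" "ergodic_measure M T" and N: "prob_space N" "ergodic_measure N T"
    and sets: "sets N = sets M" and "M \<noteq> N"
  shows "\<exists>A\<in>sets M. emeasure M A = 1 \<and> emeasure N A = 0"
proof -
  interpret M: prob_space M by fact
  interpret N: prob_space N by fact
  have space: "space N = space M" using sets by (rule sets_eq_imp_space_eq)
  have inv: "invariant_measure M T" "invariant_measure N T"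
    using M(2) N(2) by (auto simp: ergodic_measure_def)
  have T: "T \<in> M \<rightarrow>\<^sub>M M" "distr M M T = M" "T \<in> N \<rightarrow>\<^sub>M N" "distr N N T = N"
    using inv by (auto simp: invariant_measure_def)
  obtain A where A: "A \<in> sets M"
    and pos: "\<And>D. D \<in> sets M \<Longrightarrow> D \<subseteq> A \<Longrightarrow> emeasure M D \<le> emeasure N D \<Longrightarrow>
      emeasure M D = 0 \<and> emeasure N D = 0"
    and neg: "\<And>D. D \<in> sets M \<Longrightarrow> D \<inter> A = {} \<Longrightarrow> emeasure M D \<le> emeasure N D"
    using strict_Hahn_decomposition[OF M(1) N(1) sets] by metis
  define B where "B = T -` A \<inter> space M"
  have B: "B \<in> sets M" using measurable_sets[OF T(1) A] by (simp add: B_def)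
  have BM: "measure M B = measure M A"
    using measure_distr[OF T(1) A] T(2) by (simp add: B_def)
  have BN: "measure N B = measure N A"
    using measure_distr[OF T(3), of A] A T(4) by (simp add: B_def sets space)
  have diffM: "measure M (A - B) = measure M (B - A)"
    using BM M.finite_measure_Diff'[OF A B] M.finite_measure_Diff'[OF B A] by (simp add: Int_commute)
  have diffN: "measure N (A - B) = measure N (B - A)"
    using BN N.finite_measure_Diff'[of A B] N.finite_measure_Diff'[of B A] A B
    by (simp add: Int_commute sets)
  \<comment> \<open>By invariance the preimage \<open>B\<close> has the mass of \<open>A\<close>, so
    \<open>A - B\<close> and \<open>B - A\<close> have equal mass for either measure. The comparison
    valid outside \<open>A\<close> thus transfers to \<open>A - B\<close>, where strictness makes
    both masses 0.\<close>
  have "emeasure M (B - A) \<le> emeasure N (B - A)" using A B by (intro neg) auto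
  then have "emeasure M (A - B) \<le> emeasure N (A - B)"
    using diffM diffN by (simp add: M.emeasure_eq_measure N.emeasure_eq_measure)
  then have "emeasure M (A - B) = 0" "emeasure N (A - B) = 0"
    using pos[of "A - B"] A B by auto
  then have z: "emeasure M (A - B) = 0" "emeasure N (A - B) = 0"
      "emeasure M (B - A) = 0" "emeasure N (B - A) = 0"
    using diffM diffN by (simp_all add: M.emeasure_eq_measure N.emeasure_eq_measure)
  have AE: "AE x in P. T x \<in> A \<longleftrightarrow> x \<in> A"
    if P: "sets P = sets M" "space P = space M" "emeasure P (A - B) = 0" "emeasure P (B - A) = 0" for P
  proof (rule AE_I'[of "(A - B) \<union> (B - A)"])
    show "(A - B) \<union> (B - A) \<in> null_sets P"
      using P A B by (intro null_sets.Un) (auto simp: null_sets_def)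
  qed (use P in \<open>auto simp: B_def\<close>)
  define C where "C = {x \<in> space M. \<forall>n. \<exists>k\<ge>n. (T ^^ k) x \<in> A}"
  have AEM: "AE x in M. x \<in> C \<longleftrightarrow> x \<in> A"
    using almost_invariant_to_invariant[OF M(1) inv(1) A AE[OF refl refl z(1,3)]] AE_space
    by eventually_elim (simp add: C_def)
  have AEN: "AE x in N. x \<in> C \<longleftrightarrow> x \<in> A"
    using almost_invariant_to_invariant[OF N(1) inv(2) A[folded sets] AE[OF sets space z(2,4)]] AE_space
    by eventually_elim (simp add: C_def space)
  have Tk [measurable]: "T ^^ k \<in> M \<rightarrow>\<^sub>M M" for k
    using T(1) by (rule measurable_compose_n)
  have C: "C \<in> sets M" unfolding C_def using A by measurable
  have Cinv: "T -` C \<inter> space M = C"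
  proof (intro set_eqI iffI)
    fix x assume x: "x \<in> T -` C \<inter> space M"
    then have "\<forall>n. \<exists>k\<ge>n. (T ^^ k) (T x) \<in> A" by (simp add: C_def)
    then have "\<forall>n. \<exists>k\<ge>n. (T ^^ k) x \<in> A"
      by (metis funpow_Suc_right o_apply le_SucI)
    with x show "x \<in> C" by (simp add: C_def)
  next
    fix x assume x: "x \<in> C"
    then have xs: "x \<in> space M" by (simp add: C_def)
    have "\<exists>k\<ge>n. (T ^^ k) (T x) \<in> A" for n
    proof -
      obtain k where k: "k \<ge> Suc n" "(T ^^ k) x \<in> A" using x unfolding C_def by blast
      then obtain j where "k = Suc j" "j \<ge> n" by (metis Suc_le_D Suc_le_mono)
      with k(2) show ?thesis by (metis funpow_Suc_right o_apply)
    qed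
    then show "x \<in> T -` C \<inter> space M" using xs measurable_space[OF T(1) xs] by (simp add: C_def)
  qed
  have eqM: "emeasure M C = emeasure M A" using AEM C A by (intro emeasure_eq_AE) auto
  have eqN: "emeasure N C = emeasure N A" using AEN C A by (intro emeasure_eq_AE) (auto simp: sets)
  have zoM: "emeasure M C = 0 \<or> emeasure M (space M - C) = 0"
    using M(2) C Cinv unfolding ergodic_measure_def by blast
  have zoN: "emeasure N C = 0 \<or> emeasure N (space M - C) = 0"
    using N(2) C Cinv unfolding ergodic_measure_def by (metis sets space)
  \<comment> \<open>A null \<open>A\<close> would give domination of \<open>M\<close> by
    \<open>N\<close> on all sets, and two probability measures so related are equal.\<close>
  have "emeasure M A \<noteq> 0"
  proof
    assume A0: "emeasure M A = 0"
    have le: "emeasure M X \<le> emeasure N X" if X: "X \<in> sets M" for X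
    proof -
      have "emeasure M X \<le> emeasure M (X - A) + emeasure M A"
        using emeasure_subadditive[of "X - A" M A] emeasure_mono[of X "X - A \<union> A" M] X A by auto
      also have "\<dots> \<le> emeasure N (X - A)" using A0 neg[of "X - A"] X A by auto
      also have "\<dots> \<le> emeasure N X" using X by (intro emeasure_mono) (auto simp: sets)
      finally show ?thesis .
    qed
    have "M = N"
    proof (rule measure_eqI)
      fix X assume X: "X \<in> sets M"
      have "measure M X \<le> measure N X" "measure M (space M - X) \<le> measure N (space M - X)"
        using le[OF X] le[of "space M - X"] X by (auto simp: M.emeasure_eq_measure N.emeasure_eq_measure)
      then have "measure M X = measure N X"
        using M.prob_compl[OF X] N.prob_compl[of X] X by (simp add: sets space)
      then show "emeasure M X = emeasure N X" by (simp add: M.emeasure_eq_measure N.emeasure_eq_measure)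
    qed (simp add: sets)
    with \<open>M \<noteq> N\<close> show False ..
  qed
  with zoM eqM have "emeasure M (space M - C) = 0" by auto
  then have M1: "emeasure M C = 1"
    using M.prob_compl[OF C] by (simp add: M.emeasure_eq_measure)
  moreover have "emeasure N C = 0"
  proof (rule ccontr)
    assume "emeasure N C \<noteq> 0"
    with zoN have "emeasure N (space N - C) = 0" by (simp add: space)
    then have "emeasure N C = 1"
      using N.prob_compl[of C] C by (simp add: N.emeasure_eq_measure sets)
    \<comment> \<open>Both measures would give \<open>A\<close> mass 1, and strictness would then
      make it null.\<close>
    with M1 eqM eqN pos[OF A] \<open>emeasure M A \<noteq> 0\<close> show False by auto
  qed
  ultimately show ?thesis using C by blast
qed

section \<open>The skew product compared with the Markov chain\<close>

context random_homeo
begin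

lemma closed_F: "closed F"
proof -
  have "- F = \<Union>{U. open U \<and> emeasure \<nu> U = 0}"
    unfolding support_\<nu>[symmetric] measure_support_def by (auto simp: zero_less_iff_neq_zero)
  moreover have "open (\<Union>{U :: circle_homeo set. open U \<and> emeasure \<nu> U = 0})" by blast
  ultimately show ?thesis by (simp add: closed_def)
qed

lemma F_borel: "F \<in> sets borel"
  using closed_F by simp

lemma F_sets: "F \<in> sets \<nu>"
  using F_borel by (simp add: sets_\<nu>)

lemma emeasure_F: "emeasure \<nu> F = 1"
  using \<nu>.prob_eq_1[OF F_sets] AE_in_F by (simp add: \<nu>.emeasure_eq_measure)

abbreviation \<nu>F :: "circle_homeo measure" where
  "\<nu>F \<equiv> restrict_space \<nu> F"

lemma prob_space_\<nu>F: "prob_space \<nu>F"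
  using F_sets emeasure_F by (rule prob_space_restrict_space)

sublocale seq: sequence_space \<nu>F
proof -
  interpret p: prob_space \<nu>F by (rule prob_space_\<nu>F)
  show "sequence_space \<nu>F" ..
qed

lemma nn_integral_\<nu>F:
  assumes "f \<in> borel_measurable borel"
  shows "(\<integral>\<^sup>+g. f g \<partial>\<nu>F) = (\<integral>\<^sup>+g. f g \<partial>\<nu>)"
proof -
  have "(\<integral>\<^sup>+g. f g \<partial>\<nu>F) = (\<integral>\<^sup>+g. f g * indicator F g \<partial>\<nu>)"
    using F_sets by (intro nn_integral_restrict_space) (simp add: space_\<nu>)
  also have "\<dots> = (\<integral>\<^sup>+g. f g \<partial>\<nu>)"
    using AE_in_F by (intro nn_integral_cong_AE) (auto elim!: eventually_mono)
  finally show ?thesis .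
qed

lemma measurable_\<nu>F_borel [measurable]: "(\<lambda>g. g) \<in> \<nu>F \<rightarrow>\<^sub>M borel"
  using measurable_restrict_space1[OF measurable_ident_sets[OF sets_\<nu>]] .

lemma measurable_eval_\<nu>F [measurable]: "(\<lambda>g. app_homeo g x) \<in> \<nu>F \<rightarrow>\<^sub>M borel"
  using measurable_compose[OF measurable_\<nu>F_borel measurable_app_homeo_left] .

text \<open>The first map and the shifted sequence are independent, and the shifted sequence has the
  law of the whole one.\<close>

lemma nn_integral_paths:
  assumes "k \<in> borel_measurable (\<nu>F \<Otimes>\<^sub>M seq.S)"
  shows "(\<integral>\<^sup>+\<omega>. k (\<omega> 0, \<lambda>n. \<omega> (Suc n)) \<partial>seq.S) = (\<integral>\<^sup>+g. \<integral>\<^sup>+\<omega>. k (g, \<omega>) \<partial>seq.S \<partial>\<nu>F)"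
proof -
  have split: "(\<lambda>\<omega>. (\<omega> 0, \<lambda>n. \<omega> (Suc n))) \<in> seq.S \<rightarrow>\<^sub>M \<nu>F \<Otimes>\<^sub>M seq.S"
    by (intro measurable_Pair measurable_component_singleton measurable_PiM_single')
      (auto intro!: measurable_component_singleton simp: space_PiM PiE_iff)
  have "(\<integral>\<^sup>+\<omega>. k (\<omega> 0, \<lambda>n. \<omega> (Suc n)) \<partial>seq.S) =
      (\<integral>\<^sup>+\<omega>. k (\<omega> 0, \<lambda>n. \<omega> (Suc n)) \<partial>distr (\<nu>F \<Otimes>\<^sub>M seq.S) seq.S (\<lambda>(s, \<omega>). case_nat s \<omega>))"
    by (simp only: seq.PiM_iter)
  also have "\<dots> = (\<integral>\<^sup>+p. k p \<partial>(\<nu>F \<Otimes>\<^sub>M seq.S))"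
    using measurable_compose[OF split assms]
    by (subst nn_integral_distr) (auto simp: split_beta)
  also have "\<dots> = (\<integral>\<^sup>+g. \<integral>\<^sup>+\<omega>. k (g, \<omega>) \<partial>seq.S \<partial>\<nu>F)"
    using assms by (rule seq.P.nn_integral_fst[symmetric])
  finally show ?thesis .
qed

lemma measurable_skew_product:
  assumes [measurable_cong]: "sets \<mu> = sets borel"
  shows "skew_product \<in> seq.S \<Otimes>\<^sub>M \<mu> \<rightarrow>\<^sub>M seq.S \<Otimes>\<^sub>M \<mu>"
proof -
  have comp: "(\<lambda>p. fst p n) \<in> seq.S \<Otimes>\<^sub>M \<mu> \<rightarrow>\<^sub>M \<nu>F" for n
    by (rule measurable_compose[OF measurable_fst measurable_component_singleton]) simp
  have "(\<lambda>p. (fst p 0, snd p)) \<in> seq.S \<Otimes>\<^sub>M \<mu> \<rightarrow>\<^sub>M borel \<Otimes>\<^sub>M borel"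
    using measurable_compose[OF comp measurable_\<nu>F_borel] by measurable
  from measurable_compose[OF this measurable_eval]
  have "(\<lambda>p. app_homeo (fst p 0) (snd p)) \<in> seq.S \<Otimes>\<^sub>M \<mu> \<rightarrow>\<^sub>M \<mu>"
    by (simp add: measurable_cong_sets[OF refl assms])
  moreover have "(\<lambda>p n. fst p (Suc n)) \<in> seq.S \<Otimes>\<^sub>M \<mu> \<rightarrow>\<^sub>M seq.S"
    by (rule measurable_PiM_single')
      (use comp measurable_space[OF comp] in \<open>auto simp: PiE_iff\<close>)
  ultimately have "(\<lambda>p. (\<lambda>n. fst p (Suc n), app_homeo (fst p 0) (snd p))) \<in> seq.S \<Otimes>\<^sub>M \<mu> \<rightarrow>\<^sub>M seq.S \<Otimes>\<^sub>M \<mu>"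
    by (intro measurable_Pair) (auto simp: o_def)
  then show ?thesis by (simp add: skew_product_def split_beta')
qed

lemma measurable_fix_first_map:
  assumes "h \<in> borel_measurable (seq.S \<Otimes>\<^sub>M borel)"
  shows "(\<lambda>(g, \<omega>). h (\<omega>, app_homeo g x)) \<in> borel_measurable (\<nu>F \<Otimes>\<^sub>M seq.S)"
proof -
  have "(\<lambda>p. (snd p, app_homeo (fst p) x)) \<in> \<nu>F \<Otimes>\<^sub>M seq.S \<rightarrow>\<^sub>M seq.S \<Otimes>\<^sub>M borel"
    by (intro measurable_Pair measurable_snd measurable_compose[OF measurable_fst measurable_eval_\<nu>F])
  from measurable_compose[OF this assms] show ?thesis by (simp add: split_beta')
qed

lemma measurable_nn_integral_paths:
  assumes "h \<in> borel_measurable (seq.S \<Otimes>\<^sub>M borel)"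
  shows "(\<lambda>y. \<integral>\<^sup>+\<omega>. h (\<omega>, y) \<partial>seq.S) \<in> borel_measurable borel"
  by (rule seq.P.borel_measurable_nn_integral)
    (use measurable_compose[OF measurable_pair_swap' assms] in \<open>simp add: split_beta'\<close>)

text \<open>After one step the remaining maps are independent of the new point, whose law is the
  convolution. Invariance of the product measure thereby becomes a condition on \<mu> alone.\<close>

lemma distr_skew_product:
  assumes \<mu>: "prob_space \<mu>" "sets \<mu> = sets borel"
  shows "distr (seq.S \<Otimes>\<^sub>M \<mu>) (seq.S \<Otimes>\<^sub>M \<mu>) skew_product = seq.S \<Otimes>\<^sub>M transport \<nu> \<mu>"
proof (rule measure_eqI)
  note [measurable_cong] = \<mu>(2)
  interpret \<mu>: prob_space \<mu> by fact
  interpret t: prob_space "transport \<nu> \<mu>" by (rule prob_space_transport[OF \<mu>(2,1)])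
  interpret P: pair_sigma_finite seq.S \<mu> ..
  interpret Q: pair_sigma_finite seq.S "transport \<nu> \<mu>" ..
  have sets_t [measurable_cong]: "sets (transport \<nu> \<mu>) = sets borel"
    by (rule sets_transport[OF \<mu>(2,1)])
  have sets_eq: "sets (seq.S \<Otimes>\<^sub>M \<mu>) = sets (seq.S \<Otimes>\<^sub>M borel)"
      "sets (seq.S \<Otimes>\<^sub>M transport \<nu> \<mu>) = sets (seq.S \<Otimes>\<^sub>M borel)"
    using \<mu>(2) sets_t by (intro sets_pair_measure_cong refl; simp)+
  show "sets (distr (seq.S \<Otimes>\<^sub>M \<mu>) (seq.S \<Otimes>\<^sub>M \<mu>) skew_product) = sets (seq.S \<Otimes>\<^sub>M transport \<nu> \<mu>)"
    by (simp add: sets_eq)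
  fix A assume "A \<in> sets (distr (seq.S \<Otimes>\<^sub>M \<mu>) (seq.S \<Otimes>\<^sub>M \<mu>) skew_product)"
  then have A: "A \<in> sets (seq.S \<Otimes>\<^sub>M \<mu>)" "A \<in> sets (seq.S \<Otimes>\<^sub>M borel)" by (simp_all add: sets_eq)
  define h :: "_ \<Rightarrow> ennreal" where "h = indicator A"
  have h: "h \<in> borel_measurable (seq.S \<Otimes>\<^sub>M borel)" using A(2) by (simp add: h_def)
  have h\<mu>: "h \<in> borel_measurable (seq.S \<Otimes>\<^sub>M \<mu>)" using A(1) by (simp add: h_def)
  note T = measurable_skew_product[OF \<mu>(2)]
  have "emeasure (distr (seq.S \<Otimes>\<^sub>M \<mu>) (seq.S \<Otimes>\<^sub>M \<mu>) skew_product) A =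
      (\<integral>\<^sup>+p. h p \<partial>distr (seq.S \<Otimes>\<^sub>M \<mu>) (seq.S \<Otimes>\<^sub>M \<mu>) skew_product)"
    using A by (simp add: h_def)
  also have "\<dots> = (\<integral>\<^sup>+p. h (skew_product p) \<partial>(seq.S \<Otimes>\<^sub>M \<mu>))"
    using h\<mu> by (intro nn_integral_distr[OF T]) simp
  also have "\<dots> = (\<integral>\<^sup>+x. \<integral>\<^sup>+\<omega>. h (skew_product (\<omega>, x)) \<partial>seq.S \<partial>\<mu>)"
    using measurable_compose[OF T h\<mu>] by (subst P.nn_integral_snd[symmetric]) auto
  also have "\<dots> = (\<integral>\<^sup>+x. \<integral>\<^sup>+g. \<integral>\<^sup>+\<omega>. h (\<omega>, app_homeo g x) \<partial>seq.S \<partial>\<nu>F \<partial>\<mu>)"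
    using nn_integral_paths[OF measurable_fix_first_map[OF h]]
    by (simp add: skew_product_def)
  also have "\<dots> = (\<integral>\<^sup>+x. \<integral>\<^sup>+g. (\<integral>\<^sup>+\<omega>. h (\<omega>, app_homeo g x) \<partial>seq.S) \<partial>\<nu> \<partial>\<mu>)"
  proof -
    have H: "(\<lambda>y. \<integral>\<^sup>+\<omega>. h (\<omega>, y) \<partial>seq.S) \<in> borel_measurable borel"
      by (rule measurable_nn_integral_paths[OF h])
    show ?thesis
      by (intro nn_integral_cong nn_integral_\<nu>F measurable_compose[OF measurable_app_homeo_left H])
  qed
  also have "\<dots> = (\<integral>\<^sup>+y. \<integral>\<^sup>+\<omega>. h (\<omega>, y) \<partial>seq.S \<partial>transport \<nu> \<mu>)"
  proof -
    have H: "(\<lambda>y. \<integral>\<^sup>+\<omega>. h (\<omega>, y) \<partial>seq.S) \<in> borel_measurable borel"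
      by (rule measurable_nn_integral_paths[OF h])
    show ?thesis by (rule nn_integral_transport[OF \<mu>(2,1) H, symmetric])
  qed
  also have "\<dots> = emeasure (seq.S \<Otimes>\<^sub>M transport \<nu> \<mu>) A"
    using A(2) h sets_eq
    by (subst Q.nn_integral_snd) (auto simp: h_def)
  finally show "emeasure (distr (seq.S \<Otimes>\<^sub>M \<mu>) (seq.S \<Otimes>\<^sub>M \<mu>) skew_product) A =
    emeasure (seq.S \<Otimes>\<^sub>M transport \<nu> \<mu>) A" .
qed

lemma skew_measure_eq: "skew_measure F \<nu> \<mu> = seq.S \<Otimes>\<^sub>M \<mu>"
  by (simp add: skew_measure_def)

lemma pair_measure_seq_inject:
  assumes "prob_space \<mu>" "sets \<mu> = sets borel" "prob_space \<mu>'" "sets \<mu>' = sets borel"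
    and eq: "seq.S \<Otimes>\<^sub>M \<mu> = seq.S \<Otimes>\<^sub>M \<mu>'"
  shows "\<mu> = \<mu>'"
proof (rule measure_eqI)
  interpret \<mu>: prob_space \<mu> by fact
  interpret \<mu>': prob_space \<mu>' by fact
  fix A assume "A \<in> sets \<mu>"
  then have A: "A \<in> sets \<mu>" "A \<in> sets \<mu>'" using assms by simp_all
  have "emeasure \<mu> A = emeasure (seq.S \<Otimes>\<^sub>M \<mu>) (space seq.S \<times> A)"
    using A by (subst \<mu>.emeasure_pair_measure_Times) (auto simp: seq.P.emeasure_space_1)
  also have "\<dots> = emeasure \<mu>' A"
    unfolding eq using A by (subst \<mu>'.emeasure_pair_measure_Times) (auto simp: seq.P.emeasure_space_1)
  finally show "emeasure \<mu> A = emeasure \<mu>' A" .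
qed (simp add: assms)

lemma stationary_iff_markov_stationary: "stationary F \<nu> \<mu> \<longleftrightarrow> markov_stationary \<nu> \<mu>"
proof (cases "prob_space \<mu> \<and> sets \<mu> = sets borel")
  case True
  then have \<mu>: "prob_space \<mu>" "sets \<mu> = sets borel" by auto
  have "invariant_measure (seq.S \<Otimes>\<^sub>M \<mu>) skew_product \<longleftrightarrow> seq.S \<Otimes>\<^sub>M transport \<nu> \<mu> = seq.S \<Otimes>\<^sub>M \<mu>"
    using measurable_skew_product[OF \<mu>(2)] distr_skew_product[OF \<mu>]
    by (simp add: invariant_measure_def)
  also have "\<dots> \<longleftrightarrow> transport \<nu> \<mu> = \<mu>"
    using pair_measure_seq_inject[of "transport \<nu> \<mu>" \<mu>] \<mu> prob_space_transport sets_transport by auto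
  finally show ?thesis
    using \<mu> by (simp add: stationary_def markov_stationary_def skew_measure_eq)
qed (auto simp: stationary_def markov_stationary_def)

text \<open>The separating set \<open>W\<close> lives on sequences and points. Its sections have
  probability 1 over almost every point for one measure and 0 for the other, so the points with
  sections of probability 1 separate on the circle.\<close>

lemma ergodic_stationary_separated:
  assumes "\<mu> \<in> ergodic_stationary_measures F \<nu>" "\<mu>' \<in> ergodic_stationary_measures F \<nu>" "\<mu> \<noteq> \<mu>'"
  shows "\<exists>A\<in>sets borel. measure \<mu> A = 1 \<and> measure \<mu>' A = 0"
proof -
  have stat: "markov_stationary \<nu> \<mu>" "markov_stationary \<nu> \<mu>'"
    and erg: "ergodic_measure (seq.S \<Otimes>\<^sub>M \<mu>) skew_product" "ergodic_measure (seq.S \<Otimes>\<^sub>M \<mu>') skew_product"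
    using assms stationary_iff_markov_stationary
    by (auto simp: ergodic_stationary_measures_def skew_measure_eq)
  interpret \<mu>: prob_space \<mu> using markov_stationaryD(1)[OF stat(1)] .
  interpret \<mu>': prob_space \<mu>' using markov_stationaryD(1)[OF stat(2)] .
  have sets: "sets \<mu> = sets borel" "sets \<mu>' = sets borel"
    using markov_stationaryD(2)[OF stat(1)] markov_stationaryD(2)[OF stat(2)] .
  interpret P: pair_prob_space seq.S \<mu> ..
  interpret P': pair_prob_space seq.S \<mu>' ..
  have "seq.S \<Otimes>\<^sub>M \<mu> \<noteq> seq.S \<Otimes>\<^sub>M \<mu>'"
    using pair_measure_seq_inject[OF \<mu>.prob_space_axioms sets(1) \<mu>'.prob_space_axioms sets(2)] assms(3) by auto
  moreover have sets_eq: "sets (seq.S \<Otimes>\<^sub>M \<mu>') = sets (seq.S \<Otimes>\<^sub>M \<mu>)"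
    using sets by (intro sets_pair_measure_cong) auto
  ultimately obtain W where W: "W \<in> sets (seq.S \<Otimes>\<^sub>M \<mu>)"
    "emeasure (seq.S \<Otimes>\<^sub>M \<mu>) W = 1" "emeasure (seq.S \<Otimes>\<^sub>M \<mu>') W = 0"
    using ergodic_measures_separated[OF P.prob_space_axioms erg(1) P'.prob_space_axioms erg(2)] by blast
  define w where "w x = emeasure seq.S ((\<lambda>\<omega>. (\<omega>, x)) -` W)" for x
  have w: "w \<in> borel_measurable \<mu>" unfolding w_def using P.measurable_emeasure_Pair2[OF W(1)] .
  then have wb: "w \<in> borel_measurable borel" by (simp cong: measurable_cong_sets[OF sets(1) refl])
  have w_le: "w x \<le> 1" for x unfolding w_def by (rule seq.P.emeasure_le_1)
  have int: "(\<integral>\<^sup>+x. w x \<partial>\<mu>) = 1" "(\<integral>\<^sup>+x. w x \<partial>\<mu>') = 0"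
    using W P.emeasure_pair_measure_alt2[OF W(1)] P'.emeasure_pair_measure_alt2[of W] sets_eq
    unfolding w_def by auto
  define A where "A = {x. w x = 1}"
  have A: "A \<in> sets borel" unfolding A_def using wb by measurable
  have "AE x in \<mu>'. w x = 0"
    using int(2) wb by (subst (asm) nn_integral_0_iff_AE) (auto cong: measurable_cong_sets[OF sets(2) refl])
  then have "AE x in \<mu>'. x \<notin> A" by eventually_elim (simp add: A_def)
  then have "measure \<mu>' A = 0"
    using A sets(2) \<mu>'.prob_eq_0 by blast
  moreover have "AE x in \<mu>. x \<in> A"
  proof -
    have "(\<integral>\<^sup>+x. 1 - w x \<partial>\<mu>) = (\<integral>\<^sup>+x. 1 \<partial>\<mu>) - (\<integral>\<^sup>+x. w x \<partial>\<mu>)"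
      using w int(1) w_le by (intro nn_integral_diff) auto
    also have "\<dots> = 0" using int(1) \<mu>.emeasure_space_1 by simp
    finally have "AE x in \<mu>. 1 - w x = 0"
      using w by (subst (asm) nn_integral_0_iff_AE) auto
    then show ?thesis
    proof eventually_elim
      case (elim x)
      then have "1 \<le> w x" by (simp add: ennreal_minus_eq_0)
      with w_le[of x] show ?case by (simp add: A_def antisym)
    qed
  qed
  then have "measure \<mu> A = 1" using A sets(1) \<mu>.prob_eq_1 by blast
  ultimately show ?thesis using A by blast
qed

section \<open>From irreducibility on the circle to ergodicity of the skew product\<close>

definition almost_invariant :: "circle measure \<Rightarrow> circle set \<Rightarrow> bool" where
  "almost_invariant \<mu> B \<longleftrightarrow> B \<in> sets borel \<and> (AE x in \<mu>. AE g in \<nu>. app_homeo g x \<in> B \<longleftrightarrow> x \<in> B)"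

text \<open>Ergodicity of the Markov chain, phrased without sequences of maps so that a failure can
  be used to split the measure.\<close>

definition irreducible_stationary :: "circle measure \<Rightarrow> bool" where
  "irreducible_stationary \<mu> \<longleftrightarrow> markov_stationary \<nu> \<mu> \<and>
    (\<forall>B. almost_invariant \<mu> B \<longrightarrow> measure \<mu> B = 0 \<or> measure \<mu> B = 1)"

lemma measurable_eval_swap: "(\<lambda>(x, g). app_homeo g x) \<in> borel \<Otimes>\<^sub>M \<nu> \<rightarrow>\<^sub>M borel"
proof -
  have "(\<lambda>(x, g). app_homeo g x) \<in> borel \<Otimes>\<^sub>M borel \<rightarrow>\<^sub>M borel"
    using measurable_compose[OF measurable_pair_swap' measurable_eval] by (simp add: split_beta')
  then show ?thesis by (simp cong: measurable_cong_sets sets_pair_measure_cong)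
qed

lemma measurable_nn_markov:
  "f \<in> borel_measurable borel \<Longrightarrow> (\<lambda>x. \<integral>\<^sup>+g. f (app_homeo g x) \<partial>\<nu>) \<in> borel_measurable borel"
  by (rule \<nu>.borel_measurable_nn_integral)
    (use measurable_compose[OF measurable_eval_swap] in \<open>simp add: split_beta'\<close>)

lemma measurable_markov:
  fixes f :: "circle \<Rightarrow> real"
  shows "f \<in> borel_measurable borel \<Longrightarrow> (\<lambda>x. \<integral>g. f (app_homeo g x) \<partial>\<nu>) \<in> borel_measurable borel"
  by (rule \<nu>.borel_measurable_lebesgue_integral)
    (use measurable_compose[OF measurable_eval_swap] in \<open>simp add: split_beta'\<close>)

text \<open>Started from a stationary measure, the chain has the same law after one step, so the
  step hits an exceptional null set with probability 0.\<close>

lemma AE_markov_step: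
  assumes \<mu>: "markov_stationary \<nu> \<mu>" and P: "{x. P x} \<in> sets borel" and AE: "AE x in \<mu>. P x"
  shows "AE x in \<mu>. AE g in \<nu>. P (app_homeo g x)"
proof -
  note \<mu>D = markov_stationaryD[OF \<mu>]
  have N: "{x. \<not> P x} \<in> sets borel" using sets.compl_sets[OF P] by (simp add: Compl_eq_Diff_UNIV[symmetric] Collect_neg_eq)
  then have m: "(indicator {x. \<not> P x} :: circle \<Rightarrow> ennreal) \<in> borel_measurable borel" by simp
  have "emeasure \<mu> {x. \<not> P x} = 0"
    using AE N by (subst (asm) AE_iff_measurable[of "{x. \<not> P x}"]) (auto simp: \<mu>D)
  then have "(\<integral>\<^sup>+x. indicator {x. \<not> P x} x \<partial>transport \<nu> \<mu>) = (0 :: ennreal)"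
    using N by (simp add: \<mu>D)
  then have "(\<integral>\<^sup>+x. \<integral>\<^sup>+g. indicator {x. \<not> P x} (app_homeo g x) \<partial>\<nu> \<partial>\<mu>) = (0 :: ennreal)"
    using nn_integral_transport[OF \<mu>D(2,1) m] by simp
  then have "AE x in \<mu>. (\<integral>\<^sup>+g. indicator {x. \<not> P x} (app_homeo g x) \<partial>\<nu>) = (0 :: ennreal)"
    using measurable_nn_markov[OF m]
    by (subst (asm) nn_integral_0_iff_AE) (auto cong: measurable_cong_sets[OF \<mu>D(2) refl])
  then show ?thesis
  proof eventually_elim
    case (elim x)
    have "(\<lambda>g. indicator {x. \<not> P x} (app_homeo g x) :: ennreal) \<in> borel_measurable \<nu>"
      using measurable_compose[OF measurable_app_homeo_left m] by (simp cong: measurable_cong_sets[OF sets_\<nu> refl])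
    with elim have "AE g in \<nu>. indicator {x. \<not> P x} (app_homeo g x) = (0 :: ennreal)"
      by (subst (asm) nn_integral_0_iff_AE) auto
    then show ?case by eventually_elim (auto simp: indicator_def split: if_splits)
  qed
qed

text \<open>A bounded harmonic function has zero variance along the chain started from a stationary
  measure, so its superlevel sets are almost invariant.\<close>

lemma harmonic_AE_const:
  fixes \<phi> :: "circle \<Rightarrow> real"
  assumes irr: "irreducible_stationary \<mu>" and \<phi> [measurable]: "\<phi> \<in> borel_measurable borel"
    and bd: "\<And>x. 0 \<le> \<phi> x \<and> \<phi> x \<le> 1" and harm: "\<And>x. \<phi> x = (\<integral>g. \<phi> (app_homeo g x) \<partial>\<nu>)"
  shows "AE x in \<mu>. \<phi> x = (\<integral>x. \<phi> x \<partial>\<mu>)"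
proof -
  have \<mu>: "markov_stationary \<nu> \<mu>" using irr by (simp add: irreducible_stationary_def)
  note \<mu>D = markov_stationaryD[OF \<mu>]
  note [measurable_cong] = \<mu>D(2)
  interpret \<mu>: prob_space \<mu> by (rule \<mu>D)
  have sq: "(\<phi> x)\<^sup>2 \<le> 1" "\<bar>(\<phi> x)\<^sup>2\<bar> \<le> 1" "\<bar>\<phi> x\<bar> \<le> 1" for x
    using bd[of x] by (auto simp: power_le_one)
  have sqm [measurable]: "(\<lambda>x. (\<phi> x)\<^sup>2) \<in> borel_measurable borel" by measurable
  have [measurable]: "(\<lambda>g. \<phi> (app_homeo g x)) \<in> borel_measurable \<nu>" for x
    using measurable_compose[OF measurable_app_homeo_left \<phi>]
    by (simp cong: measurable_cong_sets[OF sets_\<nu> refl])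
  \<comment> \<open>The conditional variance of one step. By harmonicity it is the mean of the
    squared function after the step minus its square before, so stationarity makes its integral
    0.\<close>
  define V where "V x = (\<integral>g. (\<phi> (app_homeo g x) - \<phi> x)\<^sup>2 \<partial>\<nu>)" for x
  have i1: "integrable \<nu> (\<lambda>g. \<phi> (app_homeo g x))" "integrable \<nu> (\<lambda>g. (\<phi> (app_homeo g x))\<^sup>2)" for x
    using sq by (auto intro!: \<nu>.integrable_const_bound[of _ 1])
  have V: "V x = (\<integral>g. (\<phi> (app_homeo g x))\<^sup>2 \<partial>\<nu>) - (\<phi> x)\<^sup>2" for x
  proof -
    have "V x = (\<integral>g. (\<phi> (app_homeo g x))\<^sup>2 - 2 * \<phi> x * \<phi> (app_homeo g x) + (\<phi> x)\<^sup>2 \<partial>\<nu>)"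
      unfolding V_def by (intro Bochner_Integration.integral_cong) (auto simp: power2_diff algebra_simps)
    also have "\<dots> = (\<integral>g. (\<phi> (app_homeo g x))\<^sup>2 \<partial>\<nu>) - 2 * \<phi> x * (\<integral>g. \<phi> (app_homeo g x) \<partial>\<nu>) + (\<phi> x)\<^sup>2"
      using i1 by (simp add: \<nu>.prob_space)
    also have "\<dots> = (\<integral>g. (\<phi> (app_homeo g x))\<^sup>2 \<partial>\<nu>) - (\<phi> x)\<^sup>2"
      unfolding harm[of x, symmetric] by (simp add: power2_eq_square)
    finally show ?thesis .
  qed
  have Pm: "(\<lambda>x. \<integral>g. (\<phi> (app_homeo g x))\<^sup>2 \<partial>\<nu>) \<in> borel_measurable borel"
    using measurable_markov[OF sqm] .
  have Pbd: "\<bar>\<integral>g. (\<phi> (app_homeo g x))\<^sup>2 \<partial>\<nu>\<bar> \<le> 1" for x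
  proof -
    have "(\<integral>g. (\<phi> (app_homeo g x))\<^sup>2 \<partial>\<nu>) \<le> (\<integral>g. 1 \<partial>\<nu>)"
      using i1 sq by (intro integral_mono) auto
    then show ?thesis by (simp add: \<nu>.prob_space)
  qed
  have i2: "integrable \<mu> (\<lambda>x. \<integral>g. (\<phi> (app_homeo g x))\<^sup>2 \<partial>\<nu>)" "integrable \<mu> (\<lambda>x. (\<phi> x)\<^sup>2)"
    using Pm Pbd sq by (auto intro!: \<mu>.integrable_const_bound[of _ 1])
  have "(\<integral>x. V x \<partial>\<mu>) = (\<integral>x. (\<phi> x)\<^sup>2 \<partial>transport \<nu> \<mu>) - (\<integral>x. (\<phi> x)\<^sup>2 \<partial>\<mu>)"
    using i2 by (simp add: V integral_transport[OF \<mu>D(2,1) sqm sq(2)])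
  then have "(\<integral>x. V x \<partial>\<mu>) = 0" by (simp add: \<mu>D)
  moreover have "integrable \<mu> V" unfolding V[abs_def] using i2 by simp
  moreover have "0 \<le> V x" for x unfolding V_def by simp
  ultimately have "AE x in \<mu>. V x = 0"
    by (subst (asm) integral_nonneg_eq_0_iff_AE) auto
  then have inv: "AE x in \<mu>. AE g in \<nu>. \<phi> (app_homeo g x) = \<phi> x"
  proof eventually_elim
    case (elim x)
    have "integrable \<nu> (\<lambda>g. (\<phi> (app_homeo g x) - \<phi> x)\<^sup>2)"
    proof (rule \<nu>.integrable_const_bound[of _ 1])
      have "\<bar>\<phi> y - \<phi> x\<bar> \<le> 1" for y using bd[of x] bd[of y] by linarith
      then have "(\<phi> y - \<phi> x)\<^sup>2 \<le> 1" for y by (simp add: abs_square_le_1)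
      then show "AE g in \<nu>. norm ((\<phi> (app_homeo g x) - \<phi> x)\<^sup>2) \<le> 1" by simp
    qed measurable
    then have "AE g in \<nu>. (\<phi> (app_homeo g x) - \<phi> x)\<^sup>2 = 0"
      using elim unfolding V_def by (subst (asm) integral_nonneg_eq_0_iff_AE) auto
    then show ?case by eventually_elim simp
  qed
  define c where "c = (\<integral>x. \<phi> x \<partial>\<mu>)"
  \<comment> \<open>The set above the mean cannot have full measure, since the mean would exceed
    itself. So it is null, and a function bounded by its mean equals it almost everywhere.\<close>
  define B where "B = {x. c < \<phi> x}"
  have B: "B \<in> sets borel" unfolding B_def by measurable
  have "AE x in \<mu>. AE g in \<nu>. app_homeo g x \<in> B \<longleftrightarrow> x \<in> B"
    using inv
  proof eventually_elim
    case (elim x)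
    then show ?case by eventually_elim (simp add: B_def)
  qed
  then have "measure \<mu> B = 0 \<or> measure \<mu> B = 1"
    using irr B by (simp add: irreducible_stationary_def almost_invariant_def)
  moreover have int\<phi>: "integrable \<mu> \<phi>"
    using sq by (intro \<mu>.integrable_const_bound[of _ 1]) auto
  have "measure \<mu> B \<noteq> 1"
  proof
    assume "measure \<mu> B = 1"
    then have AEB: "AE x in \<mu>. x \<in> B" using \<mu>.AE_prob_1 by blast
    have "(\<integral>x. \<phi> x - c \<partial>\<mu>) = 0" using int\<phi> \<mu>.prob_space by (simp add: c_def)
    moreover have "AE x in \<mu>. 0 \<le> \<phi> x - c" using AEB by eventually_elim (simp add: B_def)
    ultimately have "AE x in \<mu>. \<phi> x - c = 0"
      using int\<phi> by (subst (asm) integral_nonneg_eq_0_iff_AE) auto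
    with AEB have "AE x in \<mu>. False" by eventually_elim (simp add: B_def)
    then show False by simp
  qed
  ultimately have "measure \<mu> B = 0" by blast
  then have "AE x in \<mu>. x \<notin> B" using B \<mu>.prob_eq_0[of B] by (simp add: \<mu>D)
  then have "AE x in \<mu>. 0 \<le> c - \<phi> x" by eventually_elim (simp add: B_def not_less)
  moreover have "(\<integral>x. c - \<phi> x \<partial>\<mu>) = 0" using int\<phi> \<mu>.prob_space by (simp add: c_def)
  ultimately have "AE x in \<mu>. c - \<phi> x = 0"
    using int\<phi> by (subst (asm) integral_nonneg_eq_0_iff_AE) auto
  then show ?thesis by eventually_elim (simp add: c_def)
qed

text \<open>An invariant set of the skew product has, over almost every point, conditional probability
  \<open>c\<close> given any finite number of coordinates, because it can be shifted past them. Hence it is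
  independent of everything, including itself.\<close>

lemma irreducible_stationary_ergodic:
  assumes irr: "irreducible_stationary \<mu>"
  shows "\<mu> \<in> ergodic_stationary_measures F \<nu>"
proof -
  have \<mu>: "markov_stationary \<nu> \<mu>" using irr by (simp add: irreducible_stationary_def)
  note \<mu>D = markov_stationaryD[OF \<mu>]
  interpret \<mu>: prob_space \<mu> by (rule \<mu>D)
  let ?P = "seq.S \<Otimes>\<^sub>M \<mu>"
  interpret P: pair_prob_space seq.S \<mu> ..
  have sets_eq: "sets ?P = sets (seq.S \<Otimes>\<^sub>M borel)"
    using \<mu>D(2) by (intro sets_pair_measure_cong) auto
  have space_P: "space ?P = space seq.S \<times> UNIV" by (simp add: space_pair_measure \<mu>D)
  have stat: "stationary F \<nu> \<mu>" using \<mu> stationary_iff_markov_stationary by simp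
  have shift: "(\<lambda>n. \<omega> (Suc n)) \<in> space seq.S" if "\<omega> \<in> space seq.S" for \<omega>
    using that by (auto simp: space_PiM PiE_iff)
  have zero_one: "emeasure ?P A = 0 \<or> emeasure ?P (space ?P - A) = 0"
    if A: "A \<in> sets ?P" and inv: "skew_product -` A \<inter> space ?P = A" for A
  proof -
    define h :: "_ \<Rightarrow> ennreal" where "h = indicator A"
    have h: "h \<in> borel_measurable (seq.S \<Otimes>\<^sub>M borel)" using A by (simp add: h_def sets_eq)
    have hP: "h \<in> borel_measurable ?P" using A by (simp add: h_def)
    have h_inv: "h (\<omega>, x) = h (\<lambda>n. \<omega> (Suc n), app_homeo (\<omega> 0) x)" if "\<omega> \<in> space seq.S" for \<omega> x
    proof -
      have "(\<omega>, x) \<in> A \<longleftrightarrow> skew_product (\<omega>, x) \<in> A"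
        using inv that space_P by auto
      then show ?thesis by (simp add: h_def skew_product_def indicator_def)
    qed
    \<comment> \<open>The probability that the sequence lies in \<open>C\<close> and, together with
      the starting point \<open>x\<close>, in \<open>A\<close>.\<close>
    define e where "e x C = (\<integral>\<^sup>+\<omega>. h (\<omega>, x) * indicator C \<omega> \<partial>seq.S)" for x C
    have e_meas: "(\<lambda>x. e x C) \<in> borel_measurable borel" if C: "C \<in> sets seq.S" for C
    proof -
      have "(\<lambda>p. h p * indicator C (fst p)) \<in> borel_measurable (seq.S \<Otimes>\<^sub>M borel)"
        using h C by measurable
      from measurable_nn_integral_paths[OF this] show ?thesis by (simp add: e_def)
    qed
    have e_le: "e x C \<le> 1" for x C
    proof -
      have "e x C \<le> (\<integral>\<^sup>+\<omega>. 1 \<partial>seq.S)"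
        unfolding e_def by (intro nn_integral_mono) (auto simp: h_def indicator_def)
      then show ?thesis by (simp add: seq.P.emeasure_space_1)
    qed
    define cyl where "cyl X C = {\<omega> \<in> space seq.S. \<omega> 0 \<in> X \<and> (\<lambda>n. \<omega> (Suc n)) \<in> C}" for X C
    \<comment> \<open>Invariance replaces a pair by its image under the skew product, which uses up
      the first map; the remaining sequence is independent of it.\<close>
    have step: "e x (cyl X C) = (\<integral>\<^sup>+g. indicator X g * e (app_homeo g x) C \<partial>\<nu>F)"
      and step': "emeasure seq.S (cyl X C) = (\<integral>\<^sup>+g. indicator X g * emeasure seq.S C \<partial>\<nu>F)"
      if X: "X \<in> sets \<nu>F" and C: "C \<in> sets seq.S" for x X C
    proof -
      note X[measurable] C[measurable]
      have m: "(\<lambda>(g, \<omega>). h (\<omega>, app_homeo g x)) \<in> borel_measurable (\<nu>F \<Otimes>\<^sub>M seq.S)"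
        by (rule measurable_fix_first_map[OF h])
      have "e x (cyl X C) = (\<integral>\<^sup>+\<omega>. h (\<lambda>n. \<omega> (Suc n), app_homeo (\<omega> 0) x) *
          (indicator X (\<omega> 0) * indicator C (\<lambda>n. \<omega> (Suc n))) \<partial>seq.S)"
        unfolding e_def by (intro nn_integral_cong) (auto simp: h_inv cyl_def indicator_def)
      also have "\<dots> = (\<integral>\<^sup>+g. \<integral>\<^sup>+\<omega>. h (\<omega>, app_homeo g x) * (indicator X g * indicator C \<omega>) \<partial>seq.S \<partial>\<nu>F)"
        by (rule nn_integral_paths[of "\<lambda>p. h (snd p, app_homeo (fst p) x) * (indicator X (fst p) * indicator C (snd p))", simplified])
          (use m in \<open>simp add: split_beta'\<close>)
      also have "\<dots> = (\<integral>\<^sup>+g. indicator X g * e (app_homeo g x) C \<partial>\<nu>F)"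
        unfolding e_def by (intro nn_integral_cong) (auto simp: indicator_def)
      finally show "e x (cyl X C) = \<dots>" .
      have cyl: "cyl X C \<in> sets seq.S"
      proof -
        have "(\<lambda>\<omega> n. \<omega> (Suc n)) \<in> seq.S \<rightarrow>\<^sub>M seq.S"
          by (intro measurable_PiM_single')
            (auto intro!: measurable_component_singleton simp: space_PiM PiE_iff)
        from measurable_sets[OF this C]
        have "{\<omega> \<in> space seq.S. (\<lambda>n. \<omega> (Suc n)) \<in> C} \<in> sets seq.S"
          by (simp add: vimage_def Int_def conj_commute)
        moreover have "{\<omega> \<in> space seq.S. \<omega> 0 \<in> X} \<in> sets seq.S" by measurable
        ultimately have "{\<omega> \<in> space seq.S. \<omega> 0 \<in> X} \<inter> {\<omega> \<in> space seq.S. (\<lambda>n. \<omega> (Suc n)) \<in> C} \<in> sets seq.S"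
          by blast
        moreover have "{\<omega> \<in> space seq.S. \<omega> 0 \<in> X} \<inter> {\<omega> \<in> space seq.S. (\<lambda>n. \<omega> (Suc n)) \<in> C} = cyl X C"
          by (auto simp: cyl_def)
        ultimately show ?thesis by simp
      qed
      have "emeasure seq.S (cyl X C) = (\<integral>\<^sup>+\<omega>. indicator X (\<omega> 0) * indicator C (\<lambda>n. \<omega> (Suc n)) \<partial>seq.S)"
        unfolding nn_integral_indicator[OF cyl, symmetric]
        by (intro nn_integral_cong) (auto simp: cyl_def indicator_def)
      also have "\<dots> = (\<integral>\<^sup>+g. \<integral>\<^sup>+\<omega>. indicator X g * indicator C \<omega> \<partial>seq.S \<partial>\<nu>F)"
        by (rule nn_integral_paths[of "\<lambda>p. indicator X (fst p) * indicator C (snd p)", simplified])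
      also have "\<dots> = (\<integral>\<^sup>+g. indicator X g * emeasure seq.S C \<partial>\<nu>F)"
        using C by (intro nn_integral_cong) (simp add: nn_integral_cmult)
      finally show "emeasure seq.S (cyl X C) = \<dots>" .
    qed
    \<comment> \<open>The probability of \<open>A\<close> given the starting point: the bounded
      harmonic function to which the zero variance argument applies.\<close>
    define \<phi> where "\<phi> x = enn2real (e x (space seq.S))" for x
    have e\<phi>: "e x (space seq.S) = ennreal (\<phi> x)" for x
      using e_le[of x "space seq.S"] unfolding \<phi>_def
      by (simp add: ennreal_enn2real_if top.not_eq_extremum) (metis ennreal_one_less_top order_le_less_trans)
    have \<phi>: "\<phi> \<in> borel_measurable borel"
      unfolding \<phi>_def[abs_def] using e_meas[OF sets.top] by measurable
    have bd: "0 \<le> \<phi> x \<and> \<phi> x \<le> 1" for x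
      using e_le[of x "space seq.S"] unfolding e\<phi> by (simp add: \<phi>_def)
    have harm: "\<phi> x = (\<integral>g. \<phi> (app_homeo g x) \<partial>\<nu>)" for x
    proof -
      have "cyl (space \<nu>F) (space seq.S) = space seq.S"
        using shift by (auto simp: cyl_def space_PiM PiE_iff)
      then have "e x (space seq.S) = (\<integral>\<^sup>+g. indicator (space \<nu>F) g * e (app_homeo g x) (space seq.S) \<partial>\<nu>F)"
        using step[OF sets.top sets.top, of x] by simp
      also have "\<dots> = (\<integral>\<^sup>+g. ennreal (\<phi> (app_homeo g x)) \<partial>\<nu>F)"
        unfolding e\<phi> by (intro nn_integral_cong) simp
      also have "\<dots> = (\<integral>\<^sup>+g. ennreal (\<phi> (app_homeo g x)) \<partial>\<nu>)"
        using measurable_compose[OF measurable_app_homeo_left \<phi>] by (intro nn_integral_\<nu>F) simp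
      also have "\<dots> = ennreal (\<integral>g. \<phi> (app_homeo g x) \<partial>\<nu>)"
        using bd measurable_compose[OF measurable_app_homeo_left \<phi>]
        by (intro nn_integral_eq_integral \<nu>.integrable_const_bound[of _ 1])
          (auto cong: measurable_cong_sets[OF sets_\<nu> refl])
      finally show ?thesis using bd by (simp add: e\<phi>)
    qed
    define c where "c = ennreal (\<integral>x. \<phi> x \<partial>\<mu>)"
    have AEc: "AE x in \<mu>. e x (space seq.S) = c"
      using harmonic_AE_const[OF irr \<phi> bd harm] by eventually_elim (simp only: e\<phi> c_def)
    have c: "emeasure ?P A = c"
    proof -
      have "emeasure ?P A = (\<integral>\<^sup>+p. h p \<partial>?P)" using A by (simp add: h_def)
      also have "\<dots> = (\<integral>\<^sup>+x. \<integral>\<^sup>+\<omega>. h (\<omega>, x) \<partial>seq.S \<partial>\<mu>)"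
        using P.nn_integral_snd[OF hP] by simp
      also have "\<dots> = (\<integral>\<^sup>+x. e x (space seq.S) \<partial>\<mu>)"
        unfolding e_def by (intro nn_integral_cong) simp
      also have "\<dots> = (\<integral>\<^sup>+x. c \<partial>\<mu>)" using AEc by (intro nn_integral_cong_AE)
      finally show ?thesis by (simp add: \<mu>.emeasure_space_1)
    qed
    define box where "box n X = {\<omega> \<in> space seq.S. \<forall>i<n. \<omega> i \<in> X i}" for n :: nat and X
    have box_sets: "box n X \<in> sets seq.S" if "\<And>i. X i \<in> sets \<nu>F" for n X
      unfolding box_def using that by measurable
    \<comment> \<open>Induction on the number of prescribed coordinates: each step uses up one map,
      and \<open>AE_markov_step\<close> keeps the image point outside the exceptional null set of
      the induction hypothesis.\<close>
    have box_AE: "AE x in \<mu>. e x (box n X) = c * emeasure seq.S (box n X)" if "\<And>i. X i \<in> sets \<nu>F" for n X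
      using that
    proof (induction n arbitrary: X)
      case 0
      have "box 0 X = space seq.S" by (simp add: box_def)
      then show ?case using AEc by (simp add: seq.P.emeasure_space_1)
    next
      case (Suc n)
      define X' where "X' i = X (Suc i)" for i
      define Q where "Q y \<longleftrightarrow> e y (box n X') = c * emeasure seq.S (box n X')" for y
      have X': "\<And>i. X' i \<in> sets \<nu>F" using Suc.prems by (simp add: X'_def)
      have box_Suc: "box (Suc n) X = cyl (X 0) (box n X')"
        using shift by (auto simp: box_def cyl_def X'_def All_less_Suc2)
      have "AE y in \<mu>. Q y" unfolding Q_def using Suc.IH[OF X'] .
      moreover have "{y. Q y} \<in> sets borel"
        unfolding Q_def using e_meas[OF box_sets[OF X']] by measurable
      ultimately have "AE x in \<mu>. AE g in \<nu>. Q (app_homeo g x)" by (intro AE_markov_step[OF \<mu>])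
      then show ?case
      proof eventually_elim
        case (elim x)
        then have AEF: "AE g in \<nu>F. Q (app_homeo g x)"
          using F_sets by (subst AE_restrict_space_iff) (auto simp: space_\<nu> elim: eventually_mono)
        have "e x (box (Suc n) X) = (\<integral>\<^sup>+g. indicator (X 0) g * e (app_homeo g x) (box n X') \<partial>\<nu>F)"
          unfolding box_Suc by (rule step[OF Suc.prems box_sets[OF X']])
        also have "\<dots> = (\<integral>\<^sup>+g. c * (indicator (X 0) g * emeasure seq.S (box n X')) \<partial>\<nu>F)"
          using AEF by (intro nn_integral_cong_AE) (auto simp: Q_def mult.left_commute elim!: eventually_mono)
        also have "\<dots> = c * (\<integral>\<^sup>+g. indicator (X 0) g * emeasure seq.S (box n X') \<partial>\<nu>F)"
          by (intro nn_integral_cmult borel_measurable_times_ennreal borel_measurable_indicator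
              borel_measurable_const Suc.prems)
        also have "\<dots> = c * emeasure seq.S (box (Suc n) X)"
          unfolding box_Suc by (simp only: step'[OF Suc.prems box_sets[OF X']])
        finally show ?case .
      qed
    qed
    have rect: "emeasure ?P (A \<inter> C \<times> E) = c * emeasure \<mu> E * emeasure seq.S C"
      if C: "C \<in> sets seq.S" and E: "E \<in> sets borel" for C E
    proof -
      have E\<mu> [measurable]: "E \<in> sets \<mu>" using E by (simp add: \<mu>D)
      note A[measurable]
      \<comment> \<open>Cut down to \<open>A\<close> and to starting points in \<open>E\<close>,
        then projected to sequences, the product measure gives \<open>M\<close>; equality on boxes
        identifies it with a multiple of the path measure.\<close>
      define D where "D = density ?P (\<lambda>p. indicator (A \<inter> space seq.S \<times> E) p)"
      define M where "M = distr D seq.S fst"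
      have AE_sets: "A \<inter> space seq.S \<times> E \<in> sets ?P" by measurable
      have em_rect: "emeasure ?P (A \<inter> C \<times> E) = (\<integral>\<^sup>+x. e x C * indicator E x \<partial>\<mu>)" if C: "C \<in> sets seq.S" for C
      proof -
        note C[measurable]
        have "A \<inter> C \<times> E \<in> sets ?P" by measurable
        then have "emeasure ?P (A \<inter> C \<times> E) = (\<integral>\<^sup>+p. indicator (A \<inter> C \<times> E) p \<partial>?P)" by simp
        also have "\<dots> = (\<integral>\<^sup>+x. \<integral>\<^sup>+\<omega>. indicator (A \<inter> C \<times> E) (\<omega>, x) \<partial>seq.S \<partial>\<mu>)"
          by (rule P.nn_integral_snd[symmetric]) measurable
        also have "\<dots> = (\<integral>\<^sup>+x. e x C * indicator E x \<partial>\<mu>)"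
          unfolding e_def by (intro nn_integral_cong) (auto simp: indicator_def h_def intro!: nn_integral_cong)
        finally show ?thesis .
      qed
      have emM: "emeasure M C = emeasure ?P (A \<inter> C \<times> E)" if C: "C \<in> sets seq.S" for C
      proof -
        note C[measurable]
        have fstD: "fst \<in> D \<rightarrow>\<^sub>M seq.S" by (simp add: D_def)
        have "fst -` C \<inter> space D = C \<times> UNIV"
          using sets.sets_into_space[OF C] by (auto simp: D_def space_P)
        then have "emeasure M C = emeasure D (C \<times> UNIV)"
          unfolding M_def by (simp add: emeasure_distr[OF fstD C])
        also have "\<dots> = emeasure ?P ((A \<inter> space seq.S \<times> E) \<inter> C \<times> UNIV)"
        proof -
          have "C \<times> UNIV \<in> sets ?P" using pair_measureI[OF C sets.top[of \<mu>]] by (simp add: \<mu>D)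
          then show ?thesis unfolding D_def using AE_sets by (simp add: emeasure_restricted)
        qed
        also have "(A \<inter> space seq.S \<times> E) \<inter> C \<times> UNIV = A \<inter> C \<times> E"
          using sets.sets_into_space[OF C] by auto
        finally show ?thesis .
      qed
      have "M = scale_measure (c * emeasure \<mu> E) seq.S"
      proof (rule measure_eqI_PiM_infinite)
        show "sets M = sets seq.S" "sets (scale_measure (c * emeasure \<mu> E) seq.S) = sets seq.S"
          by (simp_all add: M_def)
        show "finite_measure M"
        proof (rule finite_measureI)
          have "emeasure M (space M) = emeasure ?P (A \<inter> space seq.S \<times> E)"
            using emM[OF sets.top] by (simp add: M_def)
          then show "emeasure M (space M) \<noteq> \<infinity>" by simp
        qed
        fix X :: "nat \<Rightarrow> circle_homeo set" and J :: "nat set"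
        assume J: "finite J" "J \<subseteq> UNIV" and X: "\<And>i. i \<in> J \<Longrightarrow> X i \<in> sets \<nu>F"
        obtain n where n: "J \<subseteq> {..<n}" using J(1) finite_nat_bounded by blast
        \<comment> \<open>Coordinates outside \<open>J\<close> are left free, which turns the
          cylinder over \<open>J\<close> into a box over the first \<open>n\<close>
          coordinates.\<close>
        define Y where "Y i = (if i \<in> J then X i else space \<nu>F)" for i
        have Y: "\<And>i. Y i \<in> sets \<nu>F" using X by (auto simp: Y_def)
        have box_eq: "prod_emb UNIV (\<lambda>_. \<nu>F) J (Pi\<^sub>E J X) = box n Y"
          using n by (auto simp: prod_emb_def box_def Y_def space_PiM PiE_iff subset_iff)
        have "emeasure M (box n Y) = (\<integral>\<^sup>+x. e x (box n Y) * indicator E x \<partial>\<mu>)"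
          using emM[OF box_sets[of Y n, OF Y]] em_rect[OF box_sets[of Y n, OF Y]] by simp
        also have "\<dots> = (\<integral>\<^sup>+x. c * emeasure seq.S (box n Y) * indicator E x \<partial>\<mu>)"
          using box_AE[of Y n, OF Y] by (intro nn_integral_cong_AE) (auto elim!: eventually_mono)
        also have "\<dots> = c * emeasure seq.S (box n Y) * emeasure \<mu> E"
          by (rule nn_integral_cmult_indicator[OF E\<mu>])
        finally show "emeasure M (prod_emb UNIV (\<lambda>_. \<nu>F) J (Pi\<^sub>E J X)) =
            emeasure (scale_measure (c * emeasure \<mu> E) seq.S) (prod_emb UNIV (\<lambda>_. \<nu>F) J (Pi\<^sub>E J X))"
          unfolding box_eq by (simp add: ac_simps)
      qed
      then show ?thesis using emM[OF C] by simp
    qed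
    have c_le: "c \<le> 1" using P.emeasure_le_1[of A] c by simp
    \<comment> \<open>By \<open>rect\<close>, cutting with \<open>A\<close> just multiplies the
      product measure by \<open>c\<close>. Applied to \<open>A\<close> itself this reads
      \<open>c = c * c\<close>.\<close>
    define R where "R = scale_measure c seq.S"
    have emR: "emeasure R C = c * emeasure seq.S C" for C by (simp add: R_def)
    have "finite_measure R"
      by (rule finite_measureI) (use c_le ennreal_one_neq_top in \<open>auto simp: R_def space_scale_measure seq.P.emeasure_space_1 top_unique\<close>)
    then interpret R: finite_measure R .
    have setsR: "sets R = sets seq.S" by (simp add: R_def)
    interpret RP: pair_sigma_finite R \<mu> ..
    have "R \<Otimes>\<^sub>M \<mu> = density ?P (indicator A)"
    proof (rule pair_measure_eqI)
      show "sigma_finite_measure R" "sigma_finite_measure \<mu>" by unfold_locales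
      show "sets (R \<Otimes>\<^sub>M \<mu>) = sets (density ?P (indicator A))"
        using setsR by (simp cong: sets_pair_measure_cong)
      fix C E assume "C \<in> sets R" "E \<in> sets \<mu>"
      then have CE: "C \<in> sets seq.S" "E \<in> sets \<mu>" "E \<in> sets borel" by (simp_all add: setsR \<mu>D)
      have "emeasure (density ?P (indicator A)) (C \<times> E) = emeasure ?P (A \<inter> C \<times> E)"
        using A CE by (intro emeasure_restricted pair_measureI) auto
      then show "emeasure R C * emeasure \<mu> E = emeasure (density ?P (indicator A)) (C \<times> E)"
        using rect[OF CE(1,3)] by (simp add: emR ac_simps)
    qed
    then have "emeasure (R \<Otimes>\<^sub>M \<mu>) A = emeasure ?P (A \<inter> A)"
      using A by (simp add: emeasure_restricted)
    then have "emeasure (R \<Otimes>\<^sub>M \<mu>) A = c" using c by simp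
    moreover have "emeasure (R \<Otimes>\<^sub>M \<mu>) A = c * c"
    proof -
      have "A \<in> sets (R \<Otimes>\<^sub>M \<mu>)" using A setsR by (simp cong: sets_pair_measure_cong)
      then have "emeasure (R \<Otimes>\<^sub>M \<mu>) A = (\<integral>\<^sup>+x. c * emeasure seq.S ((\<lambda>\<omega>. (\<omega>, x)) -` A) \<partial>\<mu>)"
        using RP.emeasure_pair_measure_alt2 by (simp add: emR)
      also have "\<dots> = c * (\<integral>\<^sup>+x. emeasure seq.S ((\<lambda>\<omega>. (\<omega>, x)) -` A) \<partial>\<mu>)"
        using P.measurable_emeasure_Pair2[OF A] by (rule nn_integral_cmult)
      also have "\<dots> = c * c" using P.emeasure_pair_measure_alt2[OF A] c by simp
      finally show ?thesis .
    qed
    ultimately have "emeasure ?P A * emeasure ?P A = emeasure ?P A" using c by simp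
    then have "measure ?P A * measure ?P A = measure ?P A"
      by (simp add: P.emeasure_eq_measure flip: ennreal_mult)
    then have "measure ?P A = 0 \<or> measure ?P A = 1" by auto
    then show ?thesis
      using P.prob_compl[OF A] by (auto simp: P.emeasure_eq_measure)
  qed
  have "invariant_measure ?P skew_product"
    using stat by (simp add: stationary_def skew_measure_eq)
  with zero_one have "ergodic_measure ?P skew_product" by (auto simp: ergodic_measure_def)
  with stat show ?thesis by (simp add: ergodic_stationary_measures_def skew_measure_eq)
qed

text \<open>A random step almost surely neither enters nor leaves \<open>B\<close>, so the indicator
  of \<open>B\<close> can be moved from before the step to after it, and stationarity of \<mu>
  restricts to \<open>B\<close>.\<close>

lemma uniform_measure_stationary:
  assumes \<mu>: "markov_stationary \<nu> \<mu>" and B: "almost_invariant \<mu> B" and pos: "measure \<mu> B \<noteq> 0"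
  shows "markov_stationary \<nu> (uniform_measure \<mu> B)"
proof -
  note \<mu>D = markov_stationaryD[OF \<mu>]
  interpret \<mu>: prob_space \<mu> by (rule \<mu>D)
  note [measurable_cong] = \<mu>D(2)
  have Bb [measurable]: "B \<in> sets borel" and inv: "AE x in \<mu>. AE g in \<nu>. app_homeo g x \<in> B \<longleftrightarrow> x \<in> B"
    using B by (auto simp: almost_invariant_def)
  have B\<mu>: "B \<in> sets \<mu>" by (simp add: \<mu>D)
  have em: "emeasure \<mu> B \<noteq> 0" using pos by (simp add: \<mu>.emeasure_eq_measure)
  let ?u = "uniform_measure \<mu> B"
  have prob: "prob_space ?u" using em by (intro prob_space_uniform_measure) auto
  have sets: "sets ?u = sets borel" by (simp add: \<mu>D)
  have "transport \<nu> ?u = ?u"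
  proof (rule measure_eqI)
    show "sets (transport \<nu> ?u) = sets ?u" using sets_transport[OF sets prob] sets by simp
    fix E assume "E \<in> sets (transport \<nu> ?u)"
    then have E [measurable]: "E \<in> sets borel" by (simp add: sets_transport[OF sets prob])
    have ind: "(indicator X :: circle \<Rightarrow> ennreal) \<in> borel_measurable borel" if "X \<in> sets borel" for X
      using that by simp
    have m: "(\<lambda>x. \<integral>\<^sup>+g. indicator X (app_homeo g x) \<partial>\<nu>) \<in> borel_measurable \<mu>"
      if "X \<in> sets borel" for X
      using measurable_nn_markov[OF ind[OF that]] by (simp cong: measurable_cong_sets[OF \<mu>D(2) refl])
    have "emeasure (transport \<nu> ?u) E = (\<integral>\<^sup>+x. indicator E x \<partial>transport \<nu> ?u)"
      using E by (simp add: sets_transport[OF sets prob])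
    also have "\<dots> = (\<integral>\<^sup>+x. \<integral>\<^sup>+g. indicator E (app_homeo g x) \<partial>\<nu> \<partial>?u)"
      by (rule nn_integral_transport[OF sets prob ind[OF E]])
    also have "\<dots> = (\<integral>\<^sup>+x. (\<integral>\<^sup>+g. indicator E (app_homeo g x) \<partial>\<nu>) * indicator B x \<partial>\<mu>) / emeasure \<mu> B"
      by (rule nn_integral_uniform_measure[OF m[OF E] B\<mu>])
    also have "(\<integral>\<^sup>+x. (\<integral>\<^sup>+g. indicator E (app_homeo g x) \<partial>\<nu>) * indicator B x \<partial>\<mu>) =
        (\<integral>\<^sup>+x. \<integral>\<^sup>+g. indicator (B \<inter> E) (app_homeo g x) \<partial>\<nu> \<partial>\<mu>)"
    proof (rule nn_integral_cong_AE)
      show "AE x in \<mu>. (\<integral>\<^sup>+g. indicator E (app_homeo g x) \<partial>\<nu>) * indicator B x =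
          (\<integral>\<^sup>+g. indicator (B \<inter> E) (app_homeo g x) \<partial>\<nu>)"
        using inv
      proof eventually_elim
        case (elim x)
        show ?case
        proof (cases "x \<in> B")
          case True
          have "(\<integral>\<^sup>+g. indicator E (app_homeo g x) \<partial>\<nu>) = (\<integral>\<^sup>+g. indicator (B \<inter> E) (app_homeo g x) \<partial>\<nu> :: ennreal)"
            using elim by (intro nn_integral_cong_AE) (auto simp: True indicator_def elim!: eventually_mono)
          then show ?thesis using True by simp
        next
          case False
          have "(\<integral>\<^sup>+g. indicator (B \<inter> E) (app_homeo g x) \<partial>\<nu>) = (\<integral>\<^sup>+g. 0 \<partial>\<nu> :: ennreal)"
            using elim by (intro nn_integral_cong_AE) (auto simp: False indicator_def elim!: eventually_mono)
          then show ?thesis using False by simp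
        qed
      qed
    qed
    also have "\<dots> = (\<integral>\<^sup>+x. indicator (B \<inter> E) x \<partial>transport \<nu> \<mu>)"
      by (rule nn_integral_transport[OF \<mu>D(2,1) ind, symmetric]) simp
    also have "\<dots> = emeasure \<mu> (B \<inter> E)" by (simp add: \<mu>D)
    also have "\<dots> / emeasure \<mu> B = emeasure ?u E" by (simp add: \<mu>D)
    finally show "emeasure (transport \<nu> ?u) E = emeasure ?u E" .
  qed
  with prob sets show ?thesis by (simp add: markov_stationary_def)
qed

lemma measure_uniform_measure_cases:
  assumes \<mu>: "markov_stationary \<nu> \<mu>" and B: "B \<in> sets borel" "measure \<mu> B \<noteq> 0" and A: "A \<in> sets borel"
  shows "measure \<mu> A = 0 \<Longrightarrow> measure (uniform_measure \<mu> B) A = 0"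
    and "measure \<mu> A = 1 \<Longrightarrow> measure (uniform_measure \<mu> B) A = 1"
    and "measure (uniform_measure \<mu> B) B = 1"
    and "measure (uniform_measure \<mu> B) (- B) = 0"
proof -
  note \<mu>D = markov_stationaryD[OF \<mu>]
  interpret \<mu>: prob_space \<mu> by (rule \<mu>D)
  have em: "emeasure \<mu> B \<noteq> 0" using B(2) by (simp add: \<mu>.emeasure_eq_measure)
  have m: "measure (uniform_measure \<mu> B) X = measure \<mu> (B \<inter> X) / measure \<mu> B" if "X \<in> sets borel" for X
    using that B em by (subst measure_uniform_measure) (auto simp: \<mu>D)
  show "measure (uniform_measure \<mu> B) A = 0" if "measure \<mu> A = 0"
  proof -
    have "measure \<mu> (B \<inter> A) \<le> measure \<mu> A" using A by (intro \<mu>.finite_measure_mono) (auto simp: \<mu>D)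
    then show ?thesis using that m[OF A] by (simp add: measure_le_0_iff)
  qed
  show "measure (uniform_measure \<mu> B) A = 1" if "measure \<mu> A = 1"
  proof -
    have "AE x in \<mu>. x \<in> A" using that \<mu>.AE_prob_1 by blast
    then have "AE x in \<mu>. x \<in> B \<inter> A \<longleftrightarrow> x \<in> B" by eventually_elim simp
    then have "measure \<mu> (B \<inter> A) = measure \<mu> B"
      using A B by (intro measure_eq_AE) (auto simp: \<mu>D)
    then show ?thesis using m[OF A] B(2) by simp
  qed
  show "measure (uniform_measure \<mu> B) B = 1" using m[OF B(1)] B(2) by simp
  have "- B \<in> sets borel" using B(1) by (simp add: Compl_eq_Diff_UNIV)
  from m[OF this] show "measure (uniform_measure \<mu> B) (- B) = 0" by simp
qed

text \<open>The counting bound with the roles exchanged: it is applied to the inverse system, whose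
  own inverse is the original one.\<close>

lemma card_separated_stationary_le:
  assumes S: "finite S" "separated S" "\<And>\<mu>. \<mu> \<in> S \<Longrightarrow> markov_stationary \<nu> \<mu>"
  shows "card S \<le> Suc (card (minimal_sets (inverse_family F)))"
    and "F \<subseteq> orientation_preserving_homeos \<Longrightarrow> card S \<le> card (minimal_sets (inverse_family F))"
proof -
  note bounds = random_homeo.card_separated_le_minimal_sets[OF random_homeo_inverse S(1,2), unfolded inverse_inverse,
      OF S(3) finite_minimal_sets_inverse]
  show "card S \<le> Suc (card (minimal_sets (inverse_family F)))" by (rule bounds(1))
  show "card S \<le> card (minimal_sets (inverse_family F))" if "F \<subseteq> orientation_preserving_homeos"
    using that inv_homeo_orientation_preserving
    by (intro bounds(2)) (auto simp: inverse_family_def)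
qed

text \<open>A separated family of maximal size on \<open>K\<close> consists of irreducible measures: a nontrivial
  almost invariant set would split one of its members in two.\<close>

lemma irreducible_stationary_exists:
  assumes K: "invariant_set F K"
  shows "\<exists>\<mu>. irreducible_stationary \<mu> \<and> measure \<mu> K = 1"
proof (rule ccontr)
  assume none: "\<not> ?thesis"
  define good where "good S \<longleftrightarrow> finite S \<and> S \<noteq> {} \<and> separated S \<and>
    (\<forall>\<mu>\<in>S. markov_stationary \<nu> \<mu> \<and> measure \<mu> K = 1)" for S
  have Kb: "K \<in> sets borel" using K by (simp add: invariant_set_def)
  obtain \<mu>0 where \<mu>0: "markov_stationary \<nu> \<mu>0" "measure \<mu>0 K = 1"
    using markov_stationary_exists[OF K] by blast
  have "good {\<mu>0}" using \<mu>0 by (simp add: good_def separated_def)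
  moreover have "card S \<le> Suc (card (minimal_sets (inverse_family F)))" if "good S" for S
    using that by (intro card_separated_stationary_le) (auto simp: good_def)
  \<comment> \<open>A largest family exists because the number of minimal sets of the inverse system
    bounds all of them.\<close>
  ultimately obtain S where S: "good S" and max: "\<And>S'. good S' \<Longrightarrow> card S' \<le> card S"
    using ex_has_greatest_nat[of good "{\<mu>0}" card "Suc (Suc (card (minimal_sets (inverse_family F))))"]
    by (auto simp: less_Suc_eq_le)
  then obtain \<mu> where \<mu>S: "\<mu> \<in> S" by (auto simp: good_def)
  then have \<mu>: "markov_stationary \<nu> \<mu>" "measure \<mu> K = 1" using S by (auto simp: good_def)
  note \<mu>D = markov_stationaryD[OF \<mu>(1)]
  interpret \<mu>: prob_space \<mu> by (rule \<mu>D)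
  obtain B where B: "almost_invariant \<mu> B" "measure \<mu> B \<noteq> 0" "measure \<mu> B \<noteq> 1"
    using none \<mu> unfolding irreducible_stationary_def by blast
  have Bb: "B \<in> sets borel" using B(1) by (simp add: almost_invariant_def)
  have B': "almost_invariant \<mu> (- B)"
    using B(1) by (simp add: almost_invariant_def borel_comp)
  have B'b: "- B \<in> sets borel" using B' by (simp add: almost_invariant_def)
  have B'0: "measure \<mu> (- B) \<noteq> 0"
    using \<mu>.prob_compl[of B] Bb B(3) by (simp add: \<mu>D Compl_eq_Diff_UNIV)
  define u v where "u = uniform_measure \<mu> B" and "v = uniform_measure \<mu> (- B)"
  define S0 where "S0 = S - {\<mu>}"
  have uv: "markov_stationary \<nu> w \<and> measure w K = 1" if "w \<in> {u, v}" for w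
    using that uniform_measure_stationary[OF \<mu>(1) B(1,2)] uniform_measure_stationary[OF \<mu>(1) B' B'0]
      measure_uniform_measure_cases(2)[OF \<mu>(1) Bb B(2) Kb \<mu>(2)]
      measure_uniform_measure_cases(2)[OF \<mu>(1) B'b B'0 Kb \<mu>(2)]
    by (auto simp: u_def v_def)
  \<comment> \<open>Both halves inherit null sets and sets of full mass from \<mu>, so sets
    separating \<mu> from another member of the family also separate the halves from it.\<close>
  have ac: "measure w A = 0 \<or> measure \<mu> A \<noteq> 0" "measure w A = 1 \<or> measure \<mu> A \<noteq> 1"
    if "w \<in> {u, v}" "A \<in> sets borel" for w A
    using that measure_uniform_measure_cases(1,2)[OF \<mu>(1) Bb B(2) that(2)]
      measure_uniform_measure_cases(1,2)[OF \<mu>(1) B'b B'0 that(2)]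
    by (auto simp: u_def v_def)
  have sep_S: "\<exists>A\<in>sets borel. measure m A = 1 \<and> measure m' A = 0"
    if "m \<in> S" "m' \<in> S" "m \<noteq> m'" for m m'
    using S that by (auto simp: good_def separated_def)
  have sep_w: "\<exists>A\<in>sets borel. measure w A = 1 \<and> measure m A = 0"
    "\<exists>A\<in>sets borel. measure m A = 1 \<and> measure w A = 0" if "w \<in> {u, v}" "m \<in> S0" for w m
    using sep_S[of \<mu> m] sep_S[of m \<mu>] ac[OF that(1)] that(2) \<mu>S by (auto simp: S0_def)
  have sep_uv: "\<exists>A\<in>sets borel. measure u A = 1 \<and> measure v A = 0"
    "\<exists>A\<in>sets borel. measure v A = 1 \<and> measure u A = 0"
    using measure_uniform_measure_cases(3,4)[OF \<mu>(1) Bb B(2) Bb]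
      measure_uniform_measure_cases(3,4)[OF \<mu>(1) B'b B'0 Bb] Bb B'b
    unfolding u_def v_def by (metis double_complement)+
  have "u \<notin> S0" "v \<notin> S0" "u \<noteq> v"
    using sep_w(1)[of u u] sep_w(1)[of v v] sep_uv(1) by auto
  have "good (insert u (insert v S0))"
    unfolding good_def separated_def
  proof (intro conjI ballI impI)
    show "finite (insert u (insert v S0))" using S by (simp add: good_def S0_def)
    fix m assume m: "m \<in> insert u (insert v S0)"
    show "markov_stationary \<nu> m" "measure m K = 1"
      using m uv S by (auto simp: good_def S0_def)
    fix m' assume m': "m' \<in> insert u (insert v S0)" "m \<noteq> m'"
    show "\<exists>A\<in>sets borel. measure m A = 1 \<and> measure m' A = 0"
    proof (cases "m \<in> S0")
      case True
      then show ?thesis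
        using m' sep_w(2)[of m' m] sep_S[of m m'] by (auto simp: S0_def)
    next
      case False
      then have "m \<in> {u, v}" using m by auto
      then show ?thesis
        using m' sep_w(1)[of m m'] sep_uv by blast
    qed
  qed simp
  moreover have "card (insert u (insert v S0)) = Suc (card S)"
    using S \<mu>S \<open>u \<notin> S0\<close> \<open>v \<notin> S0\<close> \<open>u \<noteq> v\<close> card.remove[of S \<mu>] by (simp add: good_def S0_def)
  ultimately show False using max by fastforce
qed

section \<open>The counts for a system and for its inverse\<close>

lemma card_ergodic_stationary_measures:
  shows "finite (ergodic_stationary_measures F \<nu>)"
    and "card (ergodic_stationary_measures F \<nu>) \<le> Suc (card (minimal_sets (inverse_family F)))"
    and "F \<subseteq> orientation_preserving_homeos \<Longrightarrow>
      card (ergodic_stationary_measures F \<nu>) \<le> card (minimal_sets (inverse_family F))"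
    and "card (minimal_sets F) \<le> card (ergodic_stationary_measures F \<nu>)"
proof -
  let ?D = "ergodic_stationary_measures F \<nu>"
  have stat: "markov_stationary \<nu> \<mu>" if "\<mu> \<in> ?D" for \<mu>
    using that by (simp add: ergodic_stationary_measures_def stationary_iff_markov_stationary)
  have sep: "separated S" if "S \<subseteq> ?D" for S
    using that ergodic_stationary_separated unfolding separated_def by blast
  have bound: "card S \<le> Suc (card (minimal_sets (inverse_family F)))" if "S \<subseteq> ?D" "finite S" for S
    using that stat sep by (intro card_separated_stationary_le) auto
  show fin: "finite ?D"
    using finite_if_finite_subsets_card_bdd[of ?D "Suc (card (minimal_sets (inverse_family F)))"] bound
    by blast
  show "card ?D \<le> Suc (card (minimal_sets (inverse_family F)))" using bound fin by blast
  show "card ?D \<le> card (minimal_sets (inverse_family F))" if "F \<subseteq> orientation_preserving_homeos"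
    using card_separated_stationary_le(2)[OF fin sep stat that] by simp
  \<comment> \<open>Each minimal set receives an ergodic measure of full mass on it; minimal sets
    are disjoint, so one measure cannot serve two of them.\<close>
  have "\<forall>M\<in>minimal_sets F. \<exists>\<mu>\<in>?D. measure \<mu> M = 1"
    using irreducible_stationary_exists irreducible_stationary_ergodic minimal_setsD(1) by blast
  then obtain m where m: "\<And>M. M \<in> minimal_sets F \<Longrightarrow> m M \<in> ?D \<and> measure (m M) M = 1" by metis
  have "inj_on m (minimal_sets F)"
  proof (rule inj_onI, rule ccontr)
    fix M M' assume M: "M \<in> minimal_sets F" "M' \<in> minimal_sets F" "m M = m M'" "M \<noteq> M'"
    interpret p: prob_space "m M" using markov_stationaryD(1)[OF stat] m[OF M(1)] by blast
    have "sets (m M) = sets borel" using markov_stationaryD(2)[OF stat] m[OF M(1)] by blast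
    then have "measure (m M) (M \<union> M') = measure (m M) M + measure (m M) M'"
      using minimal_sets_disjoint[OF M(1,2,4)] minimal_setsD(2)[OF M(1)] minimal_setsD(2)[OF M(2)]
      by (intro p.finite_measure_Union) auto
    also have "\<dots> = 2" using m[OF M(1)] m[OF M(2)] M(3) by simp
    finally show False using p.prob_le_1[of "M \<union> M'"] by simp
  qed
  then show "card (minimal_sets F) \<le> card ?D"
    using m fin by (intro card_inj_on_le) auto
qed

end

text \<open>A finite invariant set would contain the whole semigroup orbit of each of its
  points.\<close>

lemma random_homeo_of_rds:
  assumes rds: "circle_rds F \<nu>" and orbits: "without_finite_orbits F"
  shows "random_homeo F \<nu>"
proof (rule random_homeo.intro)
  show "prob_space \<nu>" "sets \<nu> = sets borel" "measure_support \<nu> = F"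
    using rds by (auto simp: circle_rds_def)
  fix A :: "circle set" assume A: "finite A" "A \<noteq> {}"
  show "\<exists>g\<in>F. \<not> app_homeo g ` A \<subseteq> A"
  proof (rule ccontr)
    assume "\<not> ?thesis"
    then have inv: "app_homeo g ` A \<subseteq> A" if "g \<in> F" for g using that by blast
    have gen: "app_homeo f ` A \<subseteq> A" if "f \<in> generated_semigroup F" for f
      using that
    proof induction
      case (base f)
      then show ?case by (rule inv)
    next
      case (comp f g)
      then show ?case by (auto simp: comp_homeo.rep_eq)
    qed
    obtain x where x: "x \<in> A" using A(2) by blast
    have "{app_homeo f x | f. f \<in> generated_semigroup F} \<subseteq> A" using gen x by blast
    then have "finite {app_homeo f x | f. f \<in> generated_semigroup F}"
      using A(1) by (rule finite_subset)
    with orbits show False by (auto simp: without_finite_orbits_def)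
  qed
qed

theorem theorem3:
  fixes F :: "circle_homeo set" and \<nu> :: "circle_homeo measure"
  assumes "circle_rds F \<nu>" and "without_finite_orbits F"
  defines "D_plus \<equiv> ergodic_stationary_measures F \<nu>"
    and "D_minus \<equiv> ergodic_stationary_measures (inverse_family F) (inverse_measure \<nu>)"
  shows "finite D_plus \<and> finite D_minus \<and>
    \<bar>int (card D_plus) - int (card D_minus)\<bar> \<le> 1 \<and>
    (F \<subseteq> orientation_preserving_homeos \<longrightarrow> card D_plus = card D_minus)"
proof -
  interpret random_homeo F \<nu> by (rule random_homeo_of_rds[OF assms(1,2)])
  note plus = card_ergodic_stationary_measures
  \<comment> \<open>The same four facts for the inverse system, with its inverse rewritten as the
    original system, so that the two sets of inequalities interlock.\<close>
  note minus = random_homeo.card_ergodic_stationary_measures[OF random_homeo_inverse,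
      unfolded inverse_inverse]
  have "card D_plus \<le> Suc (card D_minus)" "card D_minus \<le> Suc (card D_plus)"
    using plus(2,4) minus(2,4) unfolding D_plus_def D_minus_def by linarith+
  moreover have "card D_plus = card D_minus" if op: "F \<subseteq> orientation_preserving_homeos"
  proof -
    have "inverse_family F \<subseteq> orientation_preserving_homeos"
      using op inv_homeo_orientation_preserving by (auto simp: inverse_family_def)
    with plus(3)[OF op] plus(4) minus(3,4) show ?thesis
      unfolding D_plus_def D_minus_def by linarith
  qed
  ultimately show ?thesis
    using plus(1) minus(1) unfolding D_plus_def D_minus_def by auto
qed

end
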